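(* Let $A_1,A_2$ be admissible with Neumann-to-Dirichlet maps $\Lambda_1,\Lambda_2$. If $\Lambda_1(f)=\Lambda_2(f)$ for every $f\in\mathcal{E}'(\mathbb{R})$, then $A_1=A_2$.
   Context: A function $A:\mathbb{R}\to\mathbb{R}$ is admissible if $A\in C^\infty(\mathbb{R})$, $A>0$, and there are $x_+>x_->0$ and $A_\infty>0$ with $A(x)=1$ for $x<x_-$ and $A(x)=A_\infty$ for $x>x_+$. $\square_Au:=\partial_t^2u-\frac{1}{A(x)}\partial_x(A(x)\partial_xu)$. Neumann-to-Dirichlet map associated with $A$: for $f\in\mathcal{D}'(\mathbb{R})$ with $\operatorname{supp}f\subset(t_0,\infty)$ for some $t_0$ (in particular any $f\in\mathcal{E}'(\mathbb{R})$), $\Lambda(f):=u|_{x=0}$ where $u\in\mathcal{D}'(\mathbb{R}^2)$ with wave front set in $\{(x,t,\xi_x,\xi_t):\xi_t^2=\xi_x^2\}$ is the (unique in $(0,\infty)\times\mathbb{R}$) solution of $\square_Au=0$ in $(0,\infty)\times\mathbb{R}$, $u=0$ in $(0,\infty)\times(-\infty,t_0)$, $\partial_xu|_{x=0}=f$; traces at $x=0$ are defined by pull-back along $t\mapsto(0,t)$. *)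

theory Defs
  imports "HOL-Analysis.Analysis"
begin

text \<open>Points of R^2 are pairs (x,t). Test functions and distributions are complex valued
(complex values are needed for the Fourier transform in the wave front set).\<close>

definition vd :: "(real \<Rightarrow> 'a::real_normed_vector) \<Rightarrow> real \<Rightarrow> 'a" where
  "vd g = (\<lambda>x. vector_derivative g (at x))"

definition smooth1 :: "(real \<Rightarrow> 'a::real_normed_vector) \<Rightarrow> bool" where
  "smooth1 g \<longleftrightarrow> (\<forall>k x. (vd ^^ k) g differentiable (at x))"

definition pdx :: "(real \<times> real \<Rightarrow> complex) \<Rightarrow> real \<times> real \<Rightarrow> complex" where
  "pdx f = (\<lambda>z. vector_derivative (\<lambda>s. f (s, snd z)) (at (fst z)))"

definition pdt :: "(real \<times> real \<Rightarrow> complex) \<Rightarrow> real \<times> real \<Rightarrow> complex" where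
  "pdt f = (\<lambda>z. vector_derivative (\<lambda>s. f (fst z, s)) (at (snd z)))"

definition Dpart :: "bool list \<Rightarrow> (real \<times> real \<Rightarrow> complex) \<Rightarrow> real \<times> real \<Rightarrow> complex" where
  "Dpart ds f = foldr (\<lambda>b. if b then pdx else pdt) ds f"

definition smooth2 :: "(real \<times> real \<Rightarrow> complex) \<Rightarrow> bool" where
  "smooth2 f \<longleftrightarrow> (\<forall>ds. continuous_on UNIV (Dpart ds f) \<and>
     (\<forall>z. (\<lambda>s. Dpart ds f (s, snd z)) differentiable (at (fst z)) \<and>
          (\<lambda>s. Dpart ds f (fst z, s)) differentiable (at (snd z))))"

definition tsupport :: "('a::topological_space \<Rightarrow> complex) \<Rightarrow> 'a set" where
  "tsupport f = closure {z. f z \<noteq> 0}"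

definition test1 :: "(real \<Rightarrow> complex) \<Rightarrow> bool" where
  "test1 \<psi> \<longleftrightarrow> smooth1 \<psi> \<and> compact (tsupport \<psi>)"

definition test2 :: "(real \<times> real \<Rightarrow> complex) \<Rightarrow> bool" where
  "test2 \<phi> \<longleftrightarrow> smooth2 \<phi> \<and> compact (tsupport \<phi>)"

text \<open>Distributions: linear functionals on test functions satisfying the usual seminorm
estimate on every compact set. Only the values on test functions are meaningful.\<close>

definition dist1 :: "((real \<Rightarrow> complex) \<Rightarrow> complex) \<Rightarrow> bool" where
  "dist1 T \<longleftrightarrow>
     (\<forall>\<phi> \<psi> a b. test1 \<phi> \<and> test1 \<psi> \<longrightarrow> T (\<lambda>x. a * \<phi> x + b * \<psi> x) = a * T \<phi> + b * T \<psi>) \<and>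
     (\<forall>K. compact K \<longrightarrow> (\<exists>C N. \<forall>\<phi>. test1 \<phi> \<and> tsupport \<phi> \<subseteq> K \<longrightarrow>
        norm (T \<phi>) \<le> C * (\<Sum>k\<le>N. Sup (range (\<lambda>x. norm ((vd ^^ k) \<phi> x))))))"

definition dist2 :: "((real \<times> real \<Rightarrow> complex) \<Rightarrow> complex) \<Rightarrow> bool" where
  "dist2 T \<longleftrightarrow>
     (\<forall>\<phi> \<psi> a b. test2 \<phi> \<and> test2 \<psi> \<longrightarrow> T (\<lambda>z. a * \<phi> z + b * \<psi> z) = a * T \<phi> + b * T \<psi>) \<and>
     (\<forall>K. compact K \<longrightarrow> (\<exists>C N. \<forall>\<phi>. test2 \<phi> \<and> tsupport \<phi> \<subseteq> K \<longrightarrow>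
        norm (T \<phi>) \<le> C * (\<Sum>ds\<in>{ds::bool list. length ds \<le> N}.
                              Sup (range (\<lambda>z. norm (Dpart ds \<phi> z))))))"

definition cdist1 :: "((real \<Rightarrow> complex) \<Rightarrow> complex) \<Rightarrow> bool" where
  "cdist1 T \<longleftrightarrow> dist1 T \<and>
     (\<exists>K. compact K \<and> (\<forall>\<psi>. test1 \<psi> \<and> tsupport \<psi> \<inter> K = {} \<longrightarrow> T \<psi> = 0))"

definition vanishes_on :: "((real \<times> real \<Rightarrow> complex) \<Rightarrow> complex) \<Rightarrow> (real \<times> real) set \<Rightarrow> bool" where
  "vanishes_on u U \<longleftrightarrow> (\<forall>\<phi>. test2 \<phi> \<and> tsupport \<phi> \<subseteq> U \<longrightarrow> u \<phi> = 0)"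

definition WF :: "((real \<times> real \<Rightarrow> complex) \<Rightarrow> complex) \<Rightarrow> ((real \<times> real) \<times> (real \<times> real)) set" where
  "WF u = {(z, \<xi>). \<xi> \<noteq> 0 \<and> \<not> (\<exists>\<phi>. test2 \<phi> \<and> \<phi> z \<noteq> 0 \<and> (\<exists>\<delta>>0. \<forall>N::nat. \<exists>C. \<forall>\<eta>.
        \<eta> \<noteq> 0 \<and> norm (\<eta> /\<^sub>R norm \<eta> - \<xi> /\<^sub>R norm \<xi>) < \<delta> \<longrightarrow>
        norm (u (\<lambda>y. \<phi> y * cis (- (y \<bullet> \<eta>)))) \<le> C * (1 + norm \<eta>) powr (- real N)))}"

text \<open>Pairing of the mollified distribution u * chi_eps restricted to x = 0 with psi,
written as u applied to the corresponding test function.\<close>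
definition moll :: "(real \<times> real \<Rightarrow> complex) \<Rightarrow> (real \<Rightarrow> complex) \<Rightarrow> real \<Rightarrow> real \<times> real \<Rightarrow> complex" where
  "moll mol \<psi> eps = (\<lambda>(x, t). integral UNIV
       (\<lambda>s. \<psi> s * mol (- x / eps, (s - t) / eps) / complex_of_real (eps\<^sup>2)))"

definition is_trace :: "((real \<times> real \<Rightarrow> complex) \<Rightarrow> complex) \<Rightarrow> ((real \<Rightarrow> complex) \<Rightarrow> complex) \<Rightarrow> bool" where
  "is_trace u g \<longleftrightarrow> (\<forall>mol \<psi>. test2 mol \<and> integral UNIV mol = 1 \<and> test1 \<psi> \<longrightarrow>
      ((\<lambda>eps. u (moll mol \<psi> eps)) \<longlongrightarrow> g \<psi>) (at_right 0))"

definition admissible :: "(real \<Rightarrow> real) \<Rightarrow> bool" where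
  "admissible A \<longleftrightarrow> smooth1 A \<and> (\<forall>x. A x > 0) \<and>
     (\<exists>xm xp Ainf. 0 < xm \<and> xm < xp \<and> Ainf > 0 \<and>
        (\<forall>x. x < xm \<longrightarrow> A x = 1) \<and> (\<forall>x. x > xp \<longrightarrow> A x = Ainf))"

text \<open>Distributional equation box_A u = 0 in (0,inf) x R, via the formal transpose:
<box_A u, phi> = <u, d_t^2 phi - d_x (A d_x (phi / A))>.\<close>
definition wave_A_zero :: "(real \<Rightarrow> real) \<Rightarrow> ((real \<times> real \<Rightarrow> complex) \<Rightarrow> complex) \<Rightarrow> bool" where
  "wave_A_zero A u \<longleftrightarrow> (\<forall>\<phi>. test2 \<phi> \<and> tsupport \<phi> \<subseteq> {0<..} \<times> UNIV \<longrightarrow>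
     u (\<lambda>z. pdt (pdt \<phi>) z -
            pdx (\<lambda>w. complex_of_real (A (fst w)) *
                      pdx (\<lambda>w'. \<phi> w' / complex_of_real (A (fst w'))) w) z) = 0)"

text \<open>NtD A f g: g is (a representative of) Lambda_A(f): g is the trace at x = 0 of a
solution u as in the definition of the Neumann-to-Dirichlet map.\<close>
definition NtD :: "(real \<Rightarrow> real) \<Rightarrow> ((real \<Rightarrow> complex) \<Rightarrow> complex) \<Rightarrow> ((real \<Rightarrow> complex) \<Rightarrow> complex) \<Rightarrow> bool" where
  "NtD A f g \<longleftrightarrow> (\<exists>u t0.
     (\<exists>t1>t0. \<forall>\<psi>. test1 \<psi> \<and> tsupport \<psi> \<subseteq> {..<t1} \<longrightarrow> f \<psi> = 0) \<and>
     dist2 u \<and>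
     (\<forall>(z, \<xi>) \<in> WF u. (snd \<xi>)\<^sup>2 = (fst \<xi>)\<^sup>2) \<and>
     wave_A_zero A u \<and>
     vanishes_on u ({0<..} \<times> {..<t0}) \<and>
     is_trace (\<lambda>\<phi>. - u (pdx \<phi>)) f \<and>
     is_trace u g)"

end

(*
  Put a = sqrt A and V = a''/a, extended evenly. Conjugation by a turns the wave operator into
  d_t^2 - d_x^2 + V, and the Neumann datum f = -delta produces u = H(t - x) y(t - x, t + x) / a(x),
  where y solves the Goursat problem 4 y_(xi eta) + V y = 0 with y = 1 on both axes; evenness of V makes
  y symmetric, which is the Neumann condition. Hence Lambda(-delta) is p(t) = y(t, t) for t > 0.

  Any distributional solution for the same datum has this trace: pair it with a_eps(x) theta(t) Y, where Y
  is a smooth dual solution built from y and a_eps rises from 0 to 1 on (eps, 2 eps). Since Y is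
  F(t - x) + G(t + x) near x = 0, the commutator terms are exactly the test functions that define the
  traces, for two sheared mollifiers. (The wave front set condition is only needed for existence.)

  So equality of the maps gives y1(t, t) = y2(t, t). Both Cauchy data of y1 - y2 on x = 0 then vanish;
  solving sideways in x and using y1 = y2 = 1 on the front t = x gives a Volterra inequality for V1 - V2.
  Finally a is recovered from V by a Wronskian argument.
*)
theory Submission
  imports Defs
begin

section \<open>Smooth functions on Euclidean spaces\<close>

text \<open>\<open>NtD\<close> is a relation, and nothing says in advance that it determines g; this
  shapes the proof. For \<open>A1\<close> an explicit solution is built for one datum. The
  hypothesis hands its trace to \<open>A2\<close>, carried there by some distribution u of which
  only the defining properties are known. Such a u can merely be paired with test functions
  supported in x > 0, chosen so that whatever remains is a term of a trace definition or lives where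
  u vanishes. No error term in u could be estimated, so cutoff and mollifier come from one function
  (\<open>bump\<close> is the derivative of \<open>step\<close>) and match exactly. The minus sign
  of the datum comes from the front: u jumps from 0 to 1 there near x = 0, so d_x u contains
  -\<delta>(t - x). With \<xi> = t - x and \<eta> = t + x the operator d_t^2 - d_x^2 is 4 d_\<xi>
  d_\<eta>, the origin of the factors 4. In the inverse step the unknowns are q = d_t (y1 - y2) and
  V1 - V2 together. Differentiating in t keeps the equation, V being independent of t, and turns y =
  1 on the front into V1 - V2 = -4 q_\<eta> there, which closes the system.\<close>

primrec Ck :: "nat \<Rightarrow> ('a::euclidean_space \<Rightarrow> 'b::real_normed_vector) \<Rightarrow> bool" where
  "Ck 0 f = continuous_on UNIV f"
| "Ck (Suc k) f = (\<exists>f'. (\<forall>x. (f has_derivative f' x) (at x)) \<and> (\<forall>h. Ck k (\<lambda>x. f' x h)))"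

text \<open>\<open>Ck\<close> recurses on the directional derivatives x -> f' x h instead of the
  operator-valued derivative. The value type then never changes, and the closure properties are
  inductions on k with the function arbitrary; on a Euclidean space this is the usual notion of
  C^k.\<close>

definition smooth :: "('a::euclidean_space \<Rightarrow> 'b::real_normed_vector) \<Rightarrow> bool" where
  "smooth f \<longleftrightarrow> (\<forall>k. Ck k f)"

definition dd :: "'a \<Rightarrow> ('a::euclidean_space \<Rightarrow> 'b::real_normed_vector) \<Rightarrow> 'a \<Rightarrow> 'b" where
  "dd h f = (\<lambda>x. frechet_derivative f (at x) h)"

lemma Ck_SucI:
  assumes "\<And>x. (f has_derivative f' x) (at x)" "\<And>h. Ck k (\<lambda>x. f' x h)"
  shows "Ck (Suc k) f"
  using assms by auto

lemma Ck_continuous: "Ck k f \<Longrightarrow> continuous_on UNIV f"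
  by (cases k) (auto intro!: continuous_at_imp_continuous_on dest: has_derivative_continuous)

lemma Ck_SucD: "Ck (Suc k) f \<Longrightarrow> Ck k f"
proof (induction k arbitrary: f)
  case 0
  then show ?case using Ck_continuous[of "Suc 0" f] by simp
next
  case (Suc k)
  then obtain f' where *: "\<And>x. (f has_derivative f' x) (at x)" "\<And>h. Ck (Suc k) (\<lambda>x. f' x h)"
    by (subst (asm) Ck.simps(2)) blast
  from *(1) Suc.IH[OF *(2)] show ?case by (rule Ck_SucI)
qed

lemma Ck_const: "Ck k (\<lambda>x. c)"
proof (induction k arbitrary: c)
  case (Suc k)
  then show ?case by (intro Ck_SucI[where f'="\<lambda>x h. 0"]) auto
qed simp

lemma Ck_add: "Ck k f \<Longrightarrow> Ck k g \<Longrightarrow> Ck k (\<lambda>x. f x + g x)"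
proof (induction k arbitrary: f g)
  case 0
  then show ?case by (auto intro!: continuous_intros)
next
  case (Suc k)
  then obtain f' g' where "\<And>x. (f has_derivative f' x) (at x)" "\<And>h. Ck k (\<lambda>x. f' x h)"
    "\<And>x. (g has_derivative g' x) (at x)" "\<And>h. Ck k (\<lambda>x. g' x h)"
    by auto
  then show ?case using Suc.IH
    by (intro Ck_SucI[where f'="\<lambda>x h. f' x h + g' x h"] has_derivative_add) blast+
qed

lemma Ck_linear_image:
  assumes "bounded_linear L"
  shows "Ck k f \<Longrightarrow> Ck k (\<lambda>x. L (f x))"
proof (induction k arbitrary: f)
  case 0
  then show ?case using assms
    by (simp add: bounded_linear.continuous_on)
next
  case (Suc k)
  then obtain f' where *: "\<And>x. (f has_derivative f' x) (at x)" "\<And>h. Ck k (\<lambda>x. f' x h)"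
    by auto
  from bounded_linear.has_derivative[OF assms *(1)] Suc.IH[OF *(2)] show ?case
    by (rule Ck_SucI)
qed

lemma Ck_bilinear:
  assumes "bounded_bilinear p"
  shows "Ck k f \<Longrightarrow> Ck k g \<Longrightarrow> Ck k (\<lambda>x. p (f x) (g x))"
proof (induction k arbitrary: f g)
  case 0
  then show ?case using assms by (simp add: bounded_bilinear.continuous_on)
next
  case (Suc k)
  then obtain f' g' where *: "\<And>x. (f has_derivative f' x) (at x)" "\<And>h. Ck k (\<lambda>x. f' x h)"
    "\<And>x. (g has_derivative g' x) (at x)" "\<And>h. Ck k (\<lambda>x. g' x h)"
    by auto
  have "Ck k f" "Ck k g" using Suc.prems Ck_SucD by blast+
  then have "Ck k (\<lambda>x. p (f x) (g' x h) + p (f' x h) (g x))" for h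
    using Suc.IH * by (intro Ck_add) blast+
  with bounded_bilinear.FDERIV[OF assms *(1,3)] show ?case
    by (rule Ck_SucI)
qed

lemma Ck_affine:
  assumes "bounded_linear L"
  shows "Ck k f \<Longrightarrow> Ck k (\<lambda>x. f (L x + c))"
proof (induction k arbitrary: f)
  case 0
  then show ?case using linear_continuous_on[OF assms]
    by (auto intro!: continuous_on_compose2[of UNIV f] continuous_intros)
next
  case (Suc k)
  then obtain f' where *: "\<And>x. (f has_derivative f' x) (at x)" "\<And>h. Ck k (\<lambda>x. f' x h)"
    by auto
  have "((\<lambda>x. L x + c) has_derivative L) (at x)" for x
    using has_derivative_add_const[OF bounded_linear_imp_has_derivative[OF assms]] .
  from has_derivative_compose[OF this *(1)] Suc.IH[OF *(2)] show ?case
    by (intro Ck_SucI[where f'="\<lambda>x h. f' (L x + c) (L h)"])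
qed

lemma smooth_continuous: "smooth f \<Longrightarrow> continuous_on S f"
  unfolding smooth_def using Ck_continuous continuous_on_subset by blast

lemma smooth_dd:
  assumes "smooth f"
  shows "smooth (dd h f)"
  unfolding smooth_def
proof
  fix k
  have "Ck (Suc k) f" using assms by (auto simp: smooth_def)
  then obtain f' where *: "\<And>x. (f has_derivative f' x) (at x)" "\<And>h. Ck k (\<lambda>x. f' x h)"
    by auto
  then have "frechet_derivative f (at x) = f' x" for x
    by (simp add: frechet_derivative_at[symmetric])
  with * show "Ck k (dd h f)" by (simp add: dd_def)
qed

lemma smooth_has_derivative:
  assumes "smooth f"
  shows "(f has_derivative (\<lambda>h. dd h f x)) (at x)"
proof -
  have "Ck (Suc 0) f" using assms unfolding smooth_def by blast
  then have "f differentiable (at x)" by (auto simp: differentiable_def)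
  then show ?thesis unfolding dd_def using iffD1[OF frechet_derivative_works] by blast
qed

lemma dd_eqI: "(f has_derivative f') (at x) \<Longrightarrow> dd h f x = f' h"
  unfolding dd_def by (simp add: frechet_derivative_at[symmetric])

lemma smooth_dd_linear:
  assumes "smooth f"
  shows "bounded_linear (\<lambda>h. dd h f x)"
  using smooth_has_derivative[OF assms] by (rule has_derivative_bounded_linear)

lemma smooth_const [simp, intro!]: "smooth (\<lambda>x. c)"
  by (simp add: smooth_def Ck_const)

lemma smooth_add [intro!]: "smooth f \<Longrightarrow> smooth g \<Longrightarrow> smooth (\<lambda>x. f x + g x)"
  by (simp add: smooth_def Ck_add)

lemma smooth_linear_image: "bounded_linear L \<Longrightarrow> smooth f \<Longrightarrow> smooth (\<lambda>x. L (f x))"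
  by (simp add: smooth_def Ck_linear_image)

lemma smooth_minus [intro!]: "smooth f \<Longrightarrow> smooth (\<lambda>x. - f x)"
  using smooth_linear_image[OF bounded_linear_minus[OF bounded_linear_ident]] .

lemma smooth_diff [intro!]: "smooth f \<Longrightarrow> smooth g \<Longrightarrow> smooth (\<lambda>x. f x - g x)"
  using smooth_add[of f "\<lambda>x. - g x"] by auto

lemma smooth_mult [intro!]:
  fixes f g :: "'a::euclidean_space \<Rightarrow> 'b::real_normed_algebra"
  shows "smooth f \<Longrightarrow> smooth g \<Longrightarrow> smooth (\<lambda>x. f x * g x)"
  by (simp add: smooth_def Ck_bilinear[OF bounded_bilinear_mult])

lemma smooth_of_real [intro!]:
  fixes f :: "'a::euclidean_space \<Rightarrow> real"
  shows "smooth f \<Longrightarrow> smooth (\<lambda>x. complex_of_real (f x))"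
  using smooth_linear_image[OF bounded_linear_of_real] .

lemma smooth_affine: "bounded_linear L \<Longrightarrow> smooth f \<Longrightarrow> smooth (\<lambda>x. f (L x + c))"
  by (simp add: smooth_def Ck_affine)

lemma smooth_compose_linear: "bounded_linear L \<Longrightarrow> smooth f \<Longrightarrow> smooth (\<lambda>x. f (L x))"
  using smooth_affine[of L f 0] by simp

lemma dd_affine:
  assumes "bounded_linear L" "smooth f"
  shows "dd h (\<lambda>x. f (L x + c)) x = dd (L h) f (L x + c)"
proof -
  have "((\<lambda>x. L x + c) has_derivative L) (at x)"
    using has_derivative_add_const[OF bounded_linear_imp_has_derivative[OF assms(1)]] .
  from has_derivative_compose[OF this smooth_has_derivative[OF assms(2)]]
  show ?thesis by (rule dd_eqI)
qed

lemma dd_compose_linear: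
  assumes "bounded_linear L" "smooth f"
  shows "dd h (\<lambda>x. f (L x)) x = dd (L h) f (L x)"
  using dd_affine[OF assms, of h 0] by simp

lemma dd_add: "smooth f \<Longrightarrow> smooth g \<Longrightarrow> dd h (\<lambda>x. f x + g x) x = dd h f x + dd h g x"
  by (rule dd_eqI) (auto intro!: derivative_eq_intros smooth_has_derivative)

lemma dd_diff: "smooth f \<Longrightarrow> smooth g \<Longrightarrow> dd h (\<lambda>x. f x - g x) x = dd h f x - dd h g x"
  by (rule dd_eqI) (auto intro!: derivative_eq_intros smooth_has_derivative)

lemma dd_mult:
  fixes f g :: "'a::euclidean_space \<Rightarrow> 'b::real_normed_algebra"
  shows "smooth f \<Longrightarrow> smooth g \<Longrightarrow> dd h (\<lambda>x. f x * g x) x = f x * dd h g x + dd h f x * g x"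
  by (rule dd_eqI) (auto intro!: derivative_eq_intros smooth_has_derivative)

lemma dd_const [simp]: "dd h (\<lambda>x. c) x = 0"
  using dd_eqI[of "\<lambda>x. c" "\<lambda>x. 0" x h] by simp

lemma dd_plus_dir: "smooth f \<Longrightarrow> dd (h + k) f x = dd h f x + dd k f x"
  using linear_add[OF bounded_linear.linear[OF smooth_dd_linear]] .

lemma dd_scale_dir: "smooth f \<Longrightarrow> dd (c *\<^sub>R h) f x = c *\<^sub>R dd h f x"
  using linear_cmul[OF bounded_linear.linear[OF smooth_dd_linear]] .

lemma dd_zero_dir [simp]: "smooth f \<Longrightarrow> dd 0 f x = 0"
  using dd_scale_dir[of f 0 0 x] by simp

lemma dd_Pair:
  fixes f :: "real \<times> real \<Rightarrow> 'b::real_normed_vector"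
  assumes "smooth f"
  shows "dd (h, k) f x = h *\<^sub>R dd (1, 0) f x + k *\<^sub>R dd (0, 1) f x"
proof -
  have "(h, k) = h *\<^sub>R (1::real, 0::real) + k *\<^sub>R (0, 1)" by simp
  then show ?thesis by (metis assms dd_plus_dir dd_scale_dir)
qed

lemma smooth_line_derivative:
  assumes "smooth f"
  shows "((\<lambda>s. f (a + s *\<^sub>R h)) has_vector_derivative dd h f (a + s *\<^sub>R h)) (at s within S)"
proof -
  have "((\<lambda>s. a + s *\<^sub>R h) has_derivative (\<lambda>r. r *\<^sub>R h)) (at s within S)"
    by (auto intro!: derivative_eq_intros)
  from has_derivative_compose[OF this smooth_has_derivative[OF assms]]
  show ?thesis unfolding has_vector_derivative_def
    by (simp add: dd_scale_dir[OF assms])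
qed

section \<open>Differentiation under the integral sign\<close>

lemma Ck_integral:
  fixes f :: "'a::euclidean_space \<times> 'b::euclidean_space \<Rightarrow> 'c::banach"
  shows "Ck k f \<Longrightarrow> Ck k (\<lambda>x. integral (cbox a b) (\<lambda>s. f (x, s)))"
proof (induction k arbitrary: f)
  case 0
  then have "continuous_on UNIV f" by simp
  then have "continuous_on (UNIV \<times> cbox a b) (\<lambda>(x, t). f (x, t))"
    by (auto intro: continuous_on_subset simp: case_prod_eta)
  from integral_continuous_on_param[OF this] show ?case by simp
next
  case (Suc k)
  have contf: "continuous_on S f" for S
    using Suc.prems Ck_continuous continuous_on_subset by blast
  from Suc.prems obtain f' where *: "\<And>x. (f has_derivative f' x) (at x)" "\<And>h. Ck k (\<lambda>x. f' x h)"
    by auto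
  have bl: "bounded_linear (\<lambda>h. f' (x, s) (h, 0))" for x s
    using bounded_linear_compose[OF has_derivative_bounded_linear[OF *(1)[of "(x, s)"]], of "\<lambda>h. (h, 0)"]
    by (simp add: bounded_linear_Pair bounded_linear_ident bounded_linear_zero)
  \<comment> \<open>\<open>leibniz_rule\<close> wants the x-derivative as a bounded linear function
    depending continuously on (x, s); \<open>Ck\<close> gives continuity direction by direction,
    which suffices in finite dimension.\<close>
  define g where "g x s = Blinfun (\<lambda>h. f' (x, s) (h, 0))" for x s
  have g: "blinfun_apply (g x s) = (\<lambda>h. f' (x, s) (h, 0))" for x s
    unfolding g_def using bl by (simp add: bounded_linear_Blinfun_apply)
  have contf': "continuous_on S (\<lambda>x. f' x h)" for S h
    using *(2) Ck_continuous continuous_on_subset by blast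
  have cg: "continuous_on (UNIV \<times> cbox a b) (\<lambda>(x, t). g x t)"
    by (rule continuous_on_blinfun_componentwise) (auto simp: g contf' case_prod_unfold)
  have D: "((\<lambda>x. f (x, t)) has_derivative blinfun_apply (g x t)) (at x)" for x t
  proof -
    have "((\<lambda>x. (x, t)) has_derivative (\<lambda>h. (h, 0))) (at x)"
      by (auto intro!: derivative_eq_intros)
    from has_derivative_compose[OF this *(1)] show ?thesis by (simp add: g)
  qed
  have cgx: "continuous_on (cbox a b) (g x)" for x
    using continuous_on_compose2[OF cg, of "cbox a b" "\<lambda>t. (x, t)"] by (simp add: image_subset_iff continuous_intros)
  have "((\<lambda>x. integral (cbox a b) (\<lambda>s. f (x, s))) has_derivative integral (cbox a b) (g x)) (at x)" for x
  proof (rule leibniz_rule[OF _ _ cg])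
    show "(\<lambda>s. f (x, s)) integrable_on cbox a b" for x
      by (intro integrable_continuous continuous_on_compose2[OF contf[of UNIV]] continuous_intros) auto
  qed (use D in auto)
  moreover have "blinfun_apply (integral (cbox a b) (g x)) h = integral (cbox a b) (\<lambda>s. f' (x, s) (h, 0))" for x h
    using blinfun_apply_integral[of "g x" "cbox a b" h] integrable_continuous[OF cgx] by (simp add: g)
  ultimately show ?case
    using Suc.IH[OF *(2)]
    by (intro Ck_SucI[where f'="\<lambda>x. blinfun_apply (integral (cbox a b) (g x))"]) auto
qed

lemma smooth_integral:
  fixes f :: "'a::euclidean_space \<times> 'b::euclidean_space \<Rightarrow> 'c::banach"
  shows "smooth f \<Longrightarrow> smooth (\<lambda>x. integral (cbox a b) (\<lambda>s. f (x, s)))"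
  by (simp add: smooth_def Ck_integral)

lemma bounded_linear_Pair_0: "bounded_linear (\<lambda>h. (h, 0))" "bounded_linear (\<lambda>h. (0, h))"
  by (simp_all add: bounded_linear_Pair bounded_linear_ident bounded_linear_zero)

lemma smooth_slice_left: "smooth f \<Longrightarrow> smooth (\<lambda>x. f (x, s))"
  using smooth_affine[OF bounded_linear_Pair_0(1), of f "(0, s)"] by simp

lemma dd_slice_left: "smooth f \<Longrightarrow> dd h (\<lambda>x. f (x, s)) x = dd (h, 0) f (x, s)"
  using dd_affine[OF bounded_linear_Pair_0(1), of f h "(0, s)" x] by simp

text \<open>Smoothness of the integral is known already; the value of its derivative is computed
  along the line r -> x + r h and identified by uniqueness of derivatives.\<close>

lemma dd_integral:
  fixes f :: "'a::euclidean_space \<times> 'b::euclidean_space \<Rightarrow> 'c::banach"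
  assumes "smooth f"
  shows "dd h (\<lambda>x. integral (cbox a b) (\<lambda>s. f (x, s))) x = integral (cbox a b) (\<lambda>s. dd (h, 0) f (x, s))"
proof -
  let ?F = "\<lambda>x. integral (cbox a b) (\<lambda>s. f (x, s))"
  define k where "k r s = f (x + r *\<^sub>R h, s)" for r :: real and s
  have D: "((\<lambda>r. f (x + r *\<^sub>R h, s)) has_vector_derivative dd (h, 0) f (x + r *\<^sub>R h, s)) (at r)" for r s
    using smooth_line_derivative[OF assms, of "(x, s)" "(h, 0)"] by simp
  have "continuous_on (UNIV \<times> cbox a b) (\<lambda>(r::real, s). dd (h, 0) f (x + r *\<^sub>R h, s))"
    by (auto simp: case_prod_unfold intro!: continuous_intros
        continuous_on_compose2[OF smooth_continuous[OF smooth_dd[OF assms], of UNIV]])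
  then have "((\<lambda>r. integral (cbox a b) (k r)) has_vector_derivative
      integral (cbox a b) (\<lambda>s. dd (h, 0) f (x + 0 *\<^sub>R h, s))) (at 0 within UNIV)"
    by (intro leibniz_rule_vector_derivative[where U=UNIV])
      (use D in \<open>auto simp: k_def intro!: integrable_continuous continuous_intros
        continuous_on_compose2[OF smooth_continuous[OF assms, of UNIV]]\<close>)
  moreover have "((\<lambda>r. ?F (x + r *\<^sub>R h)) has_vector_derivative dd h ?F (x + 0 *\<^sub>R h)) (at 0)"
    by (rule smooth_line_derivative[OF smooth_integral[OF assms]])
  ultimately show ?thesis
    unfolding k_def using vector_derivative_unique_at by fastforce
qed

section \<open>Functions of one real variable; agreement with \<open>smooth1\<close>\<close>

lemma vd_eqI: "(g has_vector_derivative g') (at x) \<Longrightarrow> vd g x = g'"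
  unfolding vd_def by (rule vector_derivative_at)

lemma smooth_has_vector_derivative:
  assumes "smooth f"
  shows "(f has_vector_derivative dd 1 f x) (at x within S)"
  using smooth_line_derivative[OF assms, of 0 1 x] by simp

lemma Ck_SucI_real:
  fixes f :: "real \<Rightarrow> 'b::real_normed_vector"
  assumes "\<And>x. (f has_vector_derivative f' x) (at x)" "Ck k f'"
  shows "Ck (Suc k) f"
  using assms Ck_bilinear[OF bounded_bilinear_scaleR Ck_const assms(2)]
  by (intro Ck_SucI[where f'="\<lambda>x h. h *\<^sub>R f' x"]) (simp_all add: has_vector_derivative_def)

lemma smooth_realI:
  fixes f :: "real \<Rightarrow> 'b::real_normed_vector"
  assumes "\<And>x. (f has_vector_derivative f' x) (at x)" "smooth f'"
  shows "smooth f"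
proof -
  have "Ck (Suc k) f" for k
    using assms by (intro Ck_SucI_real) (auto simp: smooth_def)
  then show ?thesis using Ck_SucD by (auto simp: smooth_def simp del: Ck.simps)
qed

lemma Ck_vd_funpow: "smooth1 g \<Longrightarrow> Ck k ((vd ^^ j) g)"
proof (induction k arbitrary: j)
  case 0
  then show ?case
    by (auto simp: smooth1_def intro!: continuous_at_imp_continuous_on differentiable_imp_continuous_within)
next
  case (Suc k)
  have "((vd ^^ j) g has_vector_derivative (vd ^^ Suc j) g x) (at x)" for x
    using Suc.prems unfolding smooth1_def by (simp add: vd_def vector_derivative_works)
  then show ?case using Suc.IH[of "Suc j"] Suc.prems by (intro Ck_SucI_real) auto
qed

lemma vd_smooth: "smooth g \<Longrightarrow> vd g = dd 1 g"
  by (rule ext) (rule vd_eqI[OF smooth_has_vector_derivative])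

lemma smooth1_iff_smooth: "smooth1 g \<longleftrightarrow> smooth g"
proof
  show "smooth g" if "smooth1 g" using Ck_vd_funpow[OF that, of _ 0] by (simp add: smooth_def)
next
  assume "smooth g"
  then have "smooth ((vd ^^ k) g)" for k
    by (induction k) (simp_all add: vd_smooth smooth_dd)
  then show "smooth1 g"
    unfolding smooth1_def by (auto dest: smooth_has_derivative simp: differentiable_def)
qed

section \<open>Functions on the plane; agreement with \<open>smooth2\<close>\<close>

lemma has_vector_derivative_slice:
  assumes "smooth f"
  shows "((\<lambda>s. f (s, t)) has_vector_derivative dd (1, 0) f (x, t)) (at x within S)"
    and "((\<lambda>s. f (x, s)) has_vector_derivative dd (0, 1) f (x, t)) (at t within S)"
  using smooth_line_derivative[OF assms, of "(0, t)" "(1, 0)" x S]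
    smooth_line_derivative[OF assms, of "(x, 0)" "(0, 1)" t S] by simp_all

text \<open>Continuity of one partial derivative, here \<open>ft\<close>, is enough for a total
  derivative; the directional derivatives are then combinations of \<open>fx\<close> and
  \<open>ft\<close> with constant coefficients.\<close>

lemma Ck_SucI_prod:
  fixes f :: "real \<times> real \<Rightarrow> 'b::banach"
  assumes x: "\<And>x t. ((\<lambda>s. f (s, t)) has_vector_derivative fx (x, t)) (at x)"
    and t: "\<And>x t. ((\<lambda>s. f (x, s)) has_vector_derivative ft (x, t)) (at t)"
    and "Ck k fx" "Ck k ft"
  shows "Ck (Suc k) f"
proof (rule Ck_SucI)
  fix z :: "real \<times> real"
  obtain x t where z: "z = (x, t)" by fastforce
  have "((\<lambda>(x, t). f (x, t)) has_derivative (\<lambda>(hx, ht). hx *\<^sub>R fx (x, t) + blinfun_scaleR_left (ft (x, t)) ht))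
      (at (x, t) within UNIV \<times> UNIV)"
  proof (rule has_derivative_partialsI)
    show "((\<lambda>x. f (x, t)) has_derivative (\<lambda>h. h *\<^sub>R fx (x, t))) (at x)"
      using x by (simp add: has_vector_derivative_def)
    show "((\<lambda>t. f (x, t)) has_derivative blinfun_apply (blinfun_scaleR_left (ft (x, t)))) (at t)" for x t
      using t by (simp add: has_vector_derivative_def)
    have "continuous_on UNIV ft" using assms(4) by (rule Ck_continuous)
    then have "continuous_on UNIV (\<lambda>z. blinfun_scaleR_left (ft z))"
      by (intro continuous_intros)
    then show "continuous (at (x, t) within UNIV \<times> UNIV) (\<lambda>(x, t). blinfun_scaleR_left (ft (x, t)))"
      by (simp add: continuous_on_eq_continuous_at case_prod_unfold)
  qed auto
  then show "(f has_derivative (\<lambda>h. fst h *\<^sub>R fx z + snd h *\<^sub>R ft z)) (at z)"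
    by (simp add: z case_prod_unfold)
next
  show "Ck k (\<lambda>z. fst h *\<^sub>R fx z + snd h *\<^sub>R ft z)" for h
    using assms(3,4) by (intro Ck_add Ck_bilinear[OF bounded_bilinear_scaleR] Ck_const)
qed

lemma pdx_smooth: "smooth f \<Longrightarrow> pdx f = dd (1, 0) f"
  and pdt_smooth: "smooth f \<Longrightarrow> pdt f = dd (0, 1) f"
  unfolding pdx_def pdt_def
  by (auto intro!: vector_derivative_at has_vector_derivative_slice)

lemma Ck_Dpart: "smooth2 f \<Longrightarrow> Ck k (Dpart ds f)"
proof (induction k arbitrary: ds)
  case 0
  then show ?case by (simp add: smooth2_def)
next
  case (Suc k)
  have "((\<lambda>s. Dpart ds f (s, t)) has_vector_derivative Dpart (True # ds) f (x, t)) (at x)"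
    "((\<lambda>s. Dpart ds f (x, s)) has_vector_derivative Dpart (False # ds) f (x, t)) (at t)" for x t
    using Suc.prems unfolding smooth2_def Dpart_def
    by (simp_all add: pdx_def pdt_def vector_derivative_works[symmetric])
  from Ck_SucI_prod[OF this Suc.IH[OF Suc.prems] Suc.IH[OF Suc.prems]] show ?case .
qed

lemma smooth_Dpart: "smooth f \<Longrightarrow> smooth (Dpart ds f)"
  by (induction ds) (simp_all add: Dpart_def pdx_smooth pdt_smooth smooth_dd)

lemma smooth2_iff_smooth: "smooth2 f \<longleftrightarrow> smooth f"
proof
  show "smooth f" if "smooth2 f" using Ck_Dpart[OF that, of _ "[]"] by (simp add: smooth_def Dpart_def)
next
  assume "smooth f"
  then have "smooth (Dpart ds f)" for ds by (rule smooth_Dpart)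
  then show "smooth2 f"
    unfolding smooth2_def
    by (auto simp: smooth_continuous intro!: differentiableI_vector has_vector_derivative_slice)
qed

lemma Ck_inverse:
  fixes f :: "'a::euclidean_space \<Rightarrow> 'b::real_normed_field"
  assumes "\<And>x. f x \<noteq> 0"
  shows "Ck k f \<Longrightarrow> Ck k (\<lambda>x. inverse (f x))"
proof (induction k)
  case 0
  then show ?case using assms by (auto intro!: continuous_intros)
next
  case (Suc k)
  then obtain f' where *: "\<And>x. (f has_derivative f' x) (at x)" "\<And>h. Ck k (\<lambda>x. f' x h)"
    by auto
  have "Ck k f" using Suc.prems by (rule Ck_SucD)
  then have I: "Ck k (\<lambda>x. inverse (f x))" by (rule Suc.IH)
  have "Ck k (\<lambda>x. - (inverse (f x) * f' x h * inverse (f x)))" for h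
    by (intro Ck_linear_image[OF bounded_linear_minus[OF bounded_linear_ident]]
        Ck_bilinear[OF bounded_bilinear_mult] I *(2))
  with Deriv.has_derivative_inverse[OF assms *(1)] show ?case by (rule Ck_SucI)
qed

lemma smooth_inverse:
  fixes f :: "'a::euclidean_space \<Rightarrow> 'b::real_normed_field"
  shows "smooth f \<Longrightarrow> (\<And>x. f x \<noteq> 0) \<Longrightarrow> smooth (\<lambda>x. inverse (f x))"
  by (simp add: smooth_def Ck_inverse)

text \<open>The derivative f' / (2 sqrt f) contains the square root again, so C^k for the root gives
  C^(k + 1).\<close>

lemma smooth_sqrt:
  fixes f :: "real \<Rightarrow> real"
  assumes f: "smooth f" and pos: "\<And>x. 0 < f x"
  shows "smooth (\<lambda>x. sqrt (f x))"
proof -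
  let ?D = "\<lambda>x. dd 1 f x * inverse 2 * inverse (sqrt (f x))"
  have D: "((\<lambda>x. sqrt (f x)) has_vector_derivative ?D x) (at x)" for x
  proof -
    have "(f has_real_derivative dd 1 f x) (at x)"
      using smooth_has_vector_derivative[OF f] by (simp add: has_real_derivative_iff_has_vector_derivative)
    from DERIV_chain2[OF DERIV_real_sqrt[OF pos] this] show ?thesis
      by (simp add: has_real_derivative_iff_has_vector_derivative field_simps)
  qed
  have ne: "sqrt (f x) \<noteq> 0" for x using pos[of x] by simp
  have "Ck k (\<lambda>x. sqrt (f x))" for k
  proof (induction k)
    case 0
    then show ?case using smooth_continuous[OF f] by (auto intro!: continuous_intros)
  next
    case (Suc k)
    have "Ck k (dd 1 f)" using smooth_dd[OF f] by (simp add: smooth_def)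
    then have "Ck k ?D"
      by (intro Ck_bilinear[OF bounded_bilinear_mult] Ck_const Ck_inverse ne Suc)
    with D show ?case by (rule Ck_SucI_real)
  qed
  then show ?thesis by (simp add: smooth_def)
qed

section \<open>Cutoff functions\<close>

text \<open>The classical exp(-1/x), enlarged by all polynomial factors in 1/x so that the family is
  closed under differentiation and smoothness at 0 becomes one statement about the whole
  family.\<close>

definition flat :: "real poly \<Rightarrow> real \<Rightarrow> real" where
  "flat p x = (if x > 0 then poly p (1 / x) * exp (- (1 / x)) else 0)"

lemma tendsto_poly_mult_exp_0: "((\<lambda>t. poly p t * exp (- t)) \<longlongrightarrow> (0::real)) at_top"
proof -
  have "((\<lambda>t. \<Sum>i\<le>degree p. coeff p i * (t ^ i / exp t)) \<longlongrightarrow> (\<Sum>i\<le>degree p. coeff p i * 0)) at_top"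
    by (intro tendsto_intros tendsto_power_div_exp_0)
  then show ?thesis
    by (simp add: poly_altdef sum_distrib_right exp_minus divide_inverse mult.assoc)
qed

lemma flat_tendsto_0: "(flat p \<longlongrightarrow> 0) (at 0)"
proof -
  have "((\<lambda>x. poly p (inverse x) * exp (- inverse x)) \<longlongrightarrow> 0) (at_right 0)"
    by (rule filterlim_compose[OF tendsto_poly_mult_exp_0 filterlim_inverse_at_top_right])
  then have "(flat p \<longlongrightarrow> 0) (at_right 0)"
    by (rule Lim_transform_eventually)
      (auto simp: eventually_at_right_field flat_def inverse_eq_divide intro!: exI[of _ 1])
  moreover have "(flat p \<longlongrightarrow> 0) (at_left 0)"
    by (rule Lim_transform_eventually[OF tendsto_const])
      (auto simp: eventually_at_left_field flat_def intro!: exI[of _ "-1"])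
  ultimately show ?thesis by (simp add: filterlim_split_at)
qed

lemma flat_has_derivative:
  "(flat p has_real_derivative flat ([:0, 0, 1:] * (p - pderiv p)) x) (at x)"
proof -
  consider "x > 0" | "x < 0" | "x = 0" by linarith
  then show ?thesis
  proof cases
    case 1
    have "((\<lambda>x. poly p (1 / x) * exp (- (1 / x))) has_real_derivative
        flat ([:0, 0, 1:] * (p - pderiv p)) x) (at x)"
      using 1 by (auto intro!: derivative_eq_intros DERIV_chain2[OF poly_DERIV]
          simp: flat_def field_simps power2_eq_square)
    moreover have "eventually (\<lambda>y. flat p y = poly p (1 / y) * exp (- (1 / y))) (nhds x)"
      using eventually_nhds_in_open[of "{0<..}" x] 1 by (auto simp: flat_def elim!: eventually_mono)
    ultimately show ?thesis by (subst DERIV_cong_ev) auto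
  next
    case 2
    have "eventually (\<lambda>y. flat p y = 0) (nhds x)"
      using eventually_nhds_in_open[of "{..<0}" x] 2 by (auto simp: flat_def elim!: eventually_mono)
    then show ?thesis using 2 by (subst DERIV_cong_ev[where g="\<lambda>x. 0"]) (auto simp: flat_def)
  next
    case 3
    \<comment> \<open>The difference quotient at 0 is again in the family, with X p in place of p,
      and so tends to 0.\<close>
    have "((\<lambda>h. flat p h / h) \<longlongrightarrow> 0) (at 0)"
    proof (rule Lim_transform_eventually[OF flat_tendsto_0[of "[:0, 1:] * p"]])
      show "\<forall>\<^sub>F h in at 0. flat ([:0, 1:] * p) h = flat p h / h"
        by (auto simp: flat_def eventually_at_filter)
    qed
    then show ?thesis using 3 by (simp add: has_field_derivative_iff flat_def)
  qed
qed

lemma smooth_flat: "smooth (flat p)"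
proof -
  have "Ck k (flat p)" for k
  proof (induction k arbitrary: p)
    case 0
    have "isCont (flat p) x" for x using flat_has_derivative by (rule DERIV_isCont)
    then show ?case by (simp add: continuous_at_imp_continuous_on)
  next
    case (Suc k)
    show ?case
      using Ck_SucI_real[OF _ Suc, of "flat p" "[:0, 0, 1:] * (p - pderiv p)"] flat_has_derivative[of p]
      by (simp only: has_real_derivative_iff_has_vector_derivative)
  qed
  then show ?thesis by (simp add: smooth_def)
qed

lemma bounded_linear_real_mult: "bounded_linear (\<lambda>x::real. c * x)"
  by (rule bounded_linear_mult_right)

lemma smooth_affine_real: "smooth f \<Longrightarrow> smooth (\<lambda>x::real. f (c * x + d))"
  using smooth_affine[OF bounded_linear_real_mult] .

definition step :: "real \<Rightarrow> real" where
  "step x = flat 1 x * inverse (flat 1 x + flat 1 (1 - x))"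

lemma flat_1_nonneg: "flat 1 x \<ge> 0" and flat_1_pos: "x > 0 \<Longrightarrow> flat 1 x > 0"
  and flat_1_zero: "x \<le> 0 \<Longrightarrow> flat 1 x = 0"
  by (auto simp: flat_def)

lemma smooth_step: "smooth step"
proof -
  have "smooth (\<lambda>x. flat 1 (1 - x))"
    using smooth_affine_real[OF smooth_flat, of 1 "- 1" 1] by simp
  moreover have "flat 1 x + flat 1 (1 - x) \<noteq> 0" for x
    using flat_1_nonneg[of x] flat_1_nonneg[of "1 - x"] flat_1_pos[of x] flat_1_pos[of "1 - x"]
    by (cases "x > 0") auto
  ultimately show ?thesis
    unfolding step_def[abs_def] by (intro smooth_mult smooth_inverse smooth_add smooth_flat)
qed

lemma step_0: "x \<le> 0 \<Longrightarrow> step x = 0"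
  by (simp add: step_def flat_1_zero)

lemma step_1: "x \<ge> 1 \<Longrightarrow> step x = 1"
  using flat_1_pos[of x] by (simp add: step_def flat_1_zero)

lemma dd_eq_0_if_const_on_open:
  assumes "open U" "x \<in> U" "\<And>y. y \<in> U \<Longrightarrow> f y = c"
  shows "dd h f x = 0"
proof -
  have "(f has_derivative (\<lambda>h. 0)) (at x)"
    by (rule has_derivative_transform_within_open[OF has_derivative_const[of c] assms(1,2)])
      (simp add: assms(3))
  then show ?thesis by (rule dd_eqI)
qed

lemma continuous_eq_const_closure:
  fixes f :: "real \<Rightarrow> 'b::t1_space"
  assumes "continuous_on UNIV f" "\<And>x. x \<in> S \<Longrightarrow> f x = c" "y \<in> closure S"
  shows "f y = c"
  using continuous_constant_on_closure[of S f c y] assms continuous_on_subset by blast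

text \<open>This derivative doubles as mollifier: a cutoff built from \<open>step\<close> has a
  mollifier as its derivative, which makes the later identities exact. The mass is step 1 - step 0 =
  1.\<close>

definition bump :: "real \<Rightarrow> complex" where
  "bump x = complex_of_real (dd 1 step x)"

lemma smooth_bump: "smooth bump"
  unfolding bump_def[abs_def] by (intro smooth_of_real smooth_dd smooth_step)

lemma bump_0: "x \<notin> {0..1} \<Longrightarrow> bump x = 0"
  using dd_eq_0_if_const_on_open[of "{..<0}" x step 0 1] dd_eq_0_if_const_on_open[of "{1<..}" x step 1 1]
  by (auto simp: bump_def step_0 step_1 not_le)

lemma integral_bump: "integral {0..1} bump = 1"
proof -
  have "((\<lambda>x. complex_of_real (step x)) has_vector_derivative bump x) (at x within {0..1})" for x
    unfolding bump_def using smooth_has_vector_derivative[OF smooth_step]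
    by (intro has_vector_derivative_of_real) (simp add: has_real_derivative_iff_has_vector_derivative)
  then have "(bump has_integral complex_of_real (step 1) - complex_of_real (step 0)) {0..1}"
    by (intro fundamental_theorem_of_calculus) auto
  then show ?thesis by (simp add: step_0 step_1 integral_unique)
qed

section \<open>Oriented integrals\<close>

text \<open>The integral of f from 0 to x, pulled back to the unit interval: negative x needs no
  separate case, and the domain of integration stays fixed when f depends on parameters.\<close>

definition oi :: "(real \<Rightarrow> 'b::banach) \<Rightarrow> real \<Rightarrow> 'b" where
  "oi f x = x *\<^sub>R integral {0..1} (\<lambda>p. f (x * p))"

lemma oi_eq_diff:
  assumes F: "\<And>y. y \<in> {-R..R} \<Longrightarrow> (F has_vector_derivative f y) (at y within {-R..R})"
    and x: "x \<in> {-R..R}"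
  shows "oi f x = F x - F 0"
proof -
  have sub: "x * p \<in> {-R..R}" if "p \<in> {0..1}" for p
  proof -
    have "\<bar>x * p\<bar> \<le> \<bar>x\<bar>" using that by (simp add: abs_mult mult_left_le)
    then show ?thesis using x by auto
  qed
  have "((\<lambda>p. F (x * p)) has_vector_derivative x *\<^sub>R f (x * p)) (at p within {0..1})" if "p \<in> {0..1}" for p
  proof -
    have "((\<lambda>p. x * p) has_vector_derivative x) (at p within {0..1})"
      by (auto intro!: derivative_eq_intros)
    moreover have "(F has_vector_derivative f (x * p)) (at (x * p) within (\<lambda>p. x * p) ` {0..1})"
      by (rule has_vector_derivative_within_subset[OF F[OF sub[OF that]]]) (use sub in auto)
    ultimately show ?thesis using vector_diff_chain_within[of "\<lambda>p. x * p" x p "{0..1}" F "f (x * p)"] by (simp add: o_def)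
  qed
  then have "((\<lambda>p. x *\<^sub>R f (x * p)) has_integral F (x * 1) - F (x * 0)) {0..1}"
    by (intro fundamental_theorem_of_calculus) auto
  then show ?thesis
    unfolding oi_def by (metis integral_cmul integral_unique mult.right_neutral mult_zero_right)
qed

lemma oi_has_vector_derivative:
  assumes f: "continuous_on UNIV f"
  shows "(oi f has_vector_derivative f x) (at x within S)"
proof -
  define R where "R = \<bar>x\<bar> + 1"
  obtain g where g: "\<And>x. x \<in> {-R..R} \<Longrightarrow> (g has_vector_derivative f x) (at x within {-R..R})"
    using antiderivative_continuous continuous_on_subset[OF f subset_UNIV] by blast
  have eq: "oi f y = g y - g 0" if "y \<in> {-R<..<R}" for y
    using oi_eq_diff[of R g f y] g that by auto
  have x: "x \<in> {-R<..<R}" by (auto simp: R_def)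
  have "(g has_vector_derivative f x) (at x)"
    using g[of x] x by (metis at_within_Icc_at greaterThanLessThan_iff atLeastAtMost_iff less_imp_le)
  then have "((\<lambda>y. g y - g 0) has_vector_derivative f x) (at x)"
    by (auto intro!: derivative_eq_intros)
  then have "(oi f has_vector_derivative f x) (at x)"
    by (rule has_vector_derivative_transform_within_open[of _ _ _ "{-R<..<R}"]) (use x eq in auto)
  then show ?thesis by (rule has_vector_derivative_at_within)
qed

lemma oi_unique:
  assumes "\<And>y. (F has_vector_derivative f y) (at y)"
  shows "oi f x = F x - F 0"
  by (rule oi_eq_diff[of "\<bar>x\<bar>"]) (auto intro: has_vector_derivative_at_within assms)

lemma oi_0 [simp]: "oi f 0 = 0"
  by (simp add: oi_def)

lemma smooth_oi: "smooth f \<Longrightarrow> smooth (oi f)"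
  by (rule smooth_realI[OF oi_has_vector_derivative[OF smooth_continuous]])

text \<open>Integrating the weight exp (l |s|) yields a factor 1/l, so a large l makes integration
  contract in the weighted norm.\<close>

lemma norm_oi_le:
  assumes f: "continuous_on UNIV f" and b: "\<And>s. norm (f s) \<le> C * exp (l * \<bar>s\<bar>)" and l: "l > 0"
  shows "norm (oi f x) \<le> C / l * exp (l * \<bar>x\<bar>)"
proof -
  have C: "C \<ge> 0" using order_trans[OF norm_ge_zero b[of 0]] by simp
  let ?E = "\<lambda>p. C / l * exp (l * (\<bar>x\<bar> * p))"
  have I: "((\<lambda>p. \<bar>x\<bar> * (C * exp (l * (\<bar>x\<bar> * p)))) has_integral ?E 1 - ?E 0) {0..1}"
    by (rule fundamental_theorem_of_calculus)
      (use l in \<open>auto intro!: derivative_eq_intros simp: has_real_derivative_iff_has_vector_derivative[symmetric]\<close>)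
  have cont: "(\<lambda>p. x *\<^sub>R f (x * p)) integrable_on {0..1}"
    by (intro integrable_continuous_interval continuous_intros continuous_on_compose2[OF f]) auto
  have "oi f x = integral {0..1} (\<lambda>p. x *\<^sub>R f (x * p))"
    by (simp add: oi_def)
  also have "norm \<dots> \<le> integral {0..1} (\<lambda>p. \<bar>x\<bar> * (C * exp (l * (\<bar>x\<bar> * p))))"
  proof (rule integral_norm_bound_integral[OF cont has_integral_integrable[OF I]])
    fix p :: real assume "p \<in> {0..1}"
    then show "norm (x *\<^sub>R f (x * p)) \<le> \<bar>x\<bar> * (C * exp (l * (\<bar>x\<bar> * p)))"
      using b[of "x * p"] by (auto simp: abs_mult intro!: mult_left_mono)
  qed
  also have "\<dots> = ?E 1 - ?E 0" using I by (rule integral_unique)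
  also have "\<dots> \<le> C / l * exp (l * \<bar>x\<bar>)" using C l by simp
  finally show ?thesis .
qed

section \<open>The Goursat problem\<close>

definition J1 :: "(real \<times> real \<Rightarrow> 'b::banach) \<Rightarrow> real \<times> real \<Rightarrow> 'b" where
  "J1 G z = oi (\<lambda>s. G (s, snd z)) (fst z)"

definition J2 :: "(real \<times> real \<Rightarrow> 'b::banach) \<Rightarrow> real \<times> real \<Rightarrow> 'b" where
  "J2 G z = oi (\<lambda>s. G (fst z, s)) (snd z)"

lemma continuous_on_slices:
  assumes "continuous_on UNIV G"
  shows "continuous_on S (\<lambda>s. G (s, t))" "continuous_on S (\<lambda>s. G (x, s))"
  by (auto intro!: continuous_on_compose2[OF assms] continuous_intros)

lemma J1_continuous:
  assumes G: "continuous_on UNIV G"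
  shows "continuous_on UNIV (J1 G)"
proof -
  have "continuous_on (UNIV \<times> cbox 0 1) (\<lambda>(z, p). G (fst z * p, snd z))"
    by (auto simp: case_prod_unfold intro!: continuous_on_compose2[OF G] continuous_intros)
  from integral_continuous_on_param[OF this] show ?thesis
    unfolding J1_def[abs_def] oi_def by (auto intro!: continuous_intros)
qed

lemma J1_deriv_1:
  assumes G: "continuous_on UNIV G"
  shows "((\<lambda>s. J1 G (s, t)) has_vector_derivative G (x, t)) (at x)"
  unfolding J1_def using oi_has_vector_derivative[OF continuous_on_slices(1)[OF G]] by simp

lemma J1_deriv_2:
  assumes G: "continuous_on UNIV G" and G2: "continuous_on UNIV G2"
    and D: "\<And>x t. ((\<lambda>s. G (x, s)) has_vector_derivative G2 (x, t)) (at t)"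
  shows "((\<lambda>s. J1 G (x, s)) has_vector_derivative J1 G2 (x, t)) (at t)"
proof -
  have c: "continuous_on (UNIV \<times> cbox 0 1) (\<lambda>(s, p). G2 (x * p, s))"
    by (auto simp: case_prod_unfold intro!: continuous_on_compose2[OF G2] continuous_intros)
  have "((\<lambda>s. integral (cbox 0 1) (\<lambda>p. G (x * p, s))) has_vector_derivative
     integral (cbox 0 1) (\<lambda>p. G2 (x * p, t))) (at t within UNIV)"
    using D by (intro leibniz_rule_vector_derivative[OF _ _ c])
      (auto intro!: integrable_continuous_interval continuous_on_compose2[OF G] continuous_intros)
  from bounded_linear.has_vector_derivative[OF bounded_linear_scaleR_right[of x] this]
  show ?thesis by (simp add: J1_def oi_def)
qed

text \<open>In the first variable differentiation undoes \<open>J1\<close>, in the second it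
  commutes with \<open>J1\<close>; both partial derivatives are therefore within reach of the
  induction hypothesis.\<close>

lemma Ck_J1: "Ck k G \<Longrightarrow> Ck k (J1 G)"
proof (induction k arbitrary: G)
  case 0
  then show ?case by (simp add: J1_continuous)
next
  case (Suc k)
  then obtain G' where *: "\<And>x. (G has_derivative G' x) (at x)" "\<And>h. Ck k (\<lambda>x. G' x h)"
    by auto
  have cG: "continuous_on UNIV G" using Suc.prems by (rule Ck_continuous)
  have D: "((\<lambda>s. G (x, s)) has_vector_derivative G' (x, t) (0, 1)) (at t)" for x t
  proof -
    have "((\<lambda>s. (x, s)) has_derivative (\<lambda>h. (0, h))) (at t)"
      by (auto intro!: derivative_eq_intros)
    from has_derivative_compose[OF this *(1)[of "(x, t)"]]
    have G: "((\<lambda>s. G (x, s)) has_derivative (\<lambda>h. G' (x, t) (0, h))) (at t)" .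
    have "G' (x, t) (0, h) = h *\<^sub>R G' (x, t) (0, 1)" for h
      using linear_cmul[OF bounded_linear.linear[OF has_derivative_bounded_linear[OF *(1)[of "(x, t)"]]], of h "(0, 1)"]
      by simp
    then have "(\<lambda>h. G' (x, t) (0, h)) = (\<lambda>h. h *\<^sub>R G' (x, t) (0, 1))" by (rule ext)
    with G show ?thesis unfolding has_vector_derivative_def by (rule has_derivative_eq_rhs)
  qed
  show ?case
    by (rule Ck_SucI_prod[OF J1_deriv_1[OF cG] J1_deriv_2[OF cG Ck_continuous[OF *(2)] D]
          Ck_SucD[OF Suc.prems] Suc.IH[OF *(2)]])
qed

lemma bounded_linear_swap: "bounded_linear (\<lambda>z. (snd z, fst z))"
  by (intro bounded_linear_Pair bounded_linear_fst bounded_linear_snd)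

lemma J2_eq_J1: "J2 G = (\<lambda>z. J1 (\<lambda>w. G (snd w, fst w)) (snd z, fst z))"
  by (simp add: J1_def J2_def fun_eq_iff)

lemma Ck_swap: "Ck k G \<Longrightarrow> Ck k (\<lambda>z. G (snd z, fst z))"
  using Ck_affine[OF bounded_linear_swap, of k G 0] by (simp add: zero_prod_def)

lemma Ck_J2: "Ck k G \<Longrightarrow> Ck k (J2 G)"
  unfolding J2_eq_J1 by (intro Ck_swap Ck_J1)

lemma J2_continuous: "continuous_on UNIV G \<Longrightarrow> continuous_on UNIV (J2 G)"
  using Ck_J2[of 0 G] by simp

lemma J2_deriv_2:
  assumes G: "continuous_on UNIV G"
  shows "((\<lambda>s. J2 G (x, s)) has_vector_derivative G (x, t)) (at t)"
  unfolding J2_def using oi_has_vector_derivative[OF continuous_on_slices(2)[OF G]] by simp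

lemma J1_J2_commute:
  assumes G: "continuous_on UNIV G"
  shows "J1 (J2 G) = J2 (J1 G)"
proof
  fix z :: "real \<times> real"
  have "continuous_on (cbox (0, 0) (1, 1)) (\<lambda>(p, q). G (fst z * p, snd z * q))"
    by (auto simp: case_prod_unfold intro!: continuous_on_compose2[OF G] continuous_intros)
  from integral_swap_continuous[OF this] show "J1 (J2 G) z = J2 (J1 G) z"
    by (simp add: J1_def J2_def oi_def mult.commute)
qed

text \<open>The weight that makes the Volterra operator of the Goursat problem a contraction.\<close>
definition wt :: "real \<Rightarrow> real \<times> real \<Rightarrow> real" where
  "wt l z = exp (l * \<bar>fst z\<bar>) * exp (l * \<bar>snd z\<bar>)"

lemma wt_pos: "wt l z > 0" by (simp add: wt_def)

lemma continuous_on_wt: "continuous_on S (wt l)"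
  unfolding wt_def[abs_def] by (intro continuous_intros)

lemma norm_J1_le:
  assumes "continuous_on UNIV G" "\<And>z. norm (G z) \<le> C * wt l z" "l > 0"
  shows "norm (J1 G z) \<le> C / l * wt l z"
  using norm_oi_le[OF continuous_on_slices(1)[OF assms(1)], of "snd z" "C * exp (l * \<bar>snd z\<bar>)" l "fst z"]
    assms(2)[of "(_, snd z)"] assms(3) by (simp add: J1_def wt_def mult_ac)

lemma norm_J2_le:
  assumes "continuous_on UNIV G" "\<And>z. norm (G z) \<le> C * wt l z" "l > 0"
  shows "norm (J2 G z) \<le> C / l * wt l z"
  using norm_oi_le[OF continuous_on_slices(2)[OF assms(1)], of "fst z" "C * exp (l * \<bar>fst z\<bar>)" l "snd z"]
    assms(2)[of "(fst z, _)"] assms(3) by (simp add: J2_def wt_def mult_ac)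

lemma J1_diff:
  assumes "continuous_on UNIV F" "continuous_on UNIV G"
  shows "J1 (\<lambda>z. F z - G z) z = J1 F z - J1 G z"
  unfolding J1_def oi_def
  by (subst integral_diff)
    (auto intro!: integrable_continuous_interval continuous_on_compose2[OF assms(1)]
      continuous_on_compose2[OF assms(2)] continuous_intros simp: algebra_simps)

lemma J2_diff:
  assumes "continuous_on UNIV F" "continuous_on UNIV G"
  shows "J2 (\<lambda>z. F z - G z) z = J2 F z - J2 G z"
  unfolding J2_def oi_def
  by (subst integral_diff)
    (auto intro!: integrable_continuous_interval continuous_on_compose2[OF assms(1)]
      continuous_on_compose2[OF assms(2)] continuous_intros simp: algebra_simps)

text \<open>Integrating 4 y_(\<xi> \<eta>) + K y = 0 from the two axes, where y = 1, gives the
  integral equation. It is solved by Banach's fixed point theorem for w = y / \<open>wt\<close>,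
  which stays bounded.\<close>

lemma goursat_exists:
  fixes K :: "real \<times> real \<Rightarrow> complex"
  assumes K: "continuous_on UNIV K" and M: "\<And>z. norm (K z) \<le> M" and sym: "\<And>z. K (snd z, fst z) = K z"
  obtains y where "continuous_on UNIV y" "\<And>z. y z = 1 - J1 (J2 (\<lambda>w. K w * y w)) z / 4"
    "\<And>z. y (snd z, fst z) = y z"
proof -
  \<comment> \<open>With this l one has M / l^2 \<le> 1, so the contraction constant is the 1/4
    already present in the equation.\<close>
  define l where "l = 1 + M"
  have M0: "M \<ge> 0" using order_trans[OF norm_ge_zero M[of 0]] .
  then have l: "l > 0" by (simp add: l_def)
  define P where "P w = (\<lambda>z. K z * (of_real (wt l z) * w z))" for w :: "real \<times> real \<Rightarrow> complex"
  define T0 where "T0 w = (\<lambda>z. (1 - J1 (J2 (P w)) z / 4) / of_real (wt l z))" for w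
  have ne: "wt l z \<noteq> 0" for z using wt_pos[of l z] by simp
  have cP: "continuous_on UNIV (P w)" if "continuous_on UNIV w" for w
    unfolding P_def by (intro continuous_intros K that continuous_on_wt)
  have nP: "norm (P w z) \<le> (M * C) * wt l z" if "\<And>z. norm (w z) \<le> C" for w C z
    using mult_mono[OF M[of z] that[of z] M0 norm_ge_zero] wt_pos[of l z]
    by (simp add: P_def norm_mult)
  have cT: "continuous_on UNIV (T0 w)" if "continuous_on UNIV w" for w
    unfolding T0_def by (intro continuous_intros J1_continuous J2_continuous cP that continuous_on_wt ballI) (simp_all add: ne)
  have nJ: "norm (J1 (J2 (P w)) z) \<le> M * C / l / l * wt l z"
    if "continuous_on UNIV w" "\<And>z. norm (w z) \<le> C" for w C z
    using norm_J1_le[OF J2_continuous[OF cP[OF that(1)]] norm_J2_le[OF cP[OF that(1)] nP[OF that(2)] l] l] .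
  have wt1: "wt l z \<ge> 1" for z
    unfolding wt_def exp_add[symmetric] using l by simp
  have bT: "T0 (apply_bcontfun w) \<in> bcontfun" for w
  proof -
    obtain C where C: "\<And>z. norm (apply_bcontfun w z) \<le> C"
      using norm_bounded by blast
    have "norm (T0 (apply_bcontfun w) z) \<le> 1 + M * C / l / l / 4" for z
    proof -
      have "norm (T0 (apply_bcontfun w) z) \<le> (1 + M * C / l / l * wt l z / 4) / wt l z"
      proof -
        have "norm (1 - J1 (J2 (P (apply_bcontfun w))) z / 4) \<le> 1 + norm (J1 (J2 (P (apply_bcontfun w))) z) / 4"
          using norm_triangle_ineq4[of 1 "J1 (J2 (P (apply_bcontfun w))) z / 4"] by (simp add: norm_divide)
        also have "\<dots> \<le> 1 + M * C / l / l * wt l z / 4"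
          using nJ[OF continuous_on_apply_bcontfun C] by simp
        finally show ?thesis
          unfolding T0_def using wt_pos[of l z] by (simp add: norm_divide divide_right_mono)
      qed
      also have "\<dots> \<le> 1 + M * C / l / l / 4"
        using wt1[of z] by (simp add: field_simps)
      finally show ?thesis .
    qed
    then show ?thesis
      by (intro bcontfun_normI cT continuous_on_apply_bcontfun)
  qed
  define T where "T w = Bcontfun (T0 (apply_bcontfun w))" for w
  have T: "apply_bcontfun (T w) = T0 (apply_bcontfun w)" for w
    unfolding T_def using bT by (simp add: Bcontfun_inverse)
  have "dist (T v) (T w) \<le> 1 / 4 * dist v w" for v w
  proof (rule dist_bound)
    fix z
    let ?d = "\<lambda>z. apply_bcontfun v z - apply_bcontfun w z"
    have cd: "continuous_on UNIV ?d" by (intro continuous_intros continuous_on_apply_bcontfun)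
    have nd: "norm (?d z) \<le> dist v w" for z
      using dist_bounded[of v z w] by (simp add: dist_norm)
    have c: "continuous_on UNIV (P (apply_bcontfun v))" for v :: "(real \<times> real) \<Rightarrow>\<^sub>C complex"
      by (intro cP continuous_on_apply_bcontfun)
    have "P ?d = (\<lambda>z. P (apply_bcontfun v) z - P (apply_bcontfun w) z)"
      by (auto simp: P_def algebra_simps)
    then have "J2 (P ?d) = (\<lambda>z. J2 (P (apply_bcontfun v)) z - J2 (P (apply_bcontfun w)) z)"
      using J2_diff[OF c c] by presburger
    then have J: "J1 (J2 (P ?d)) z = J1 (J2 (P (apply_bcontfun v))) z - J1 (J2 (P (apply_bcontfun w))) z"
      using J1_diff[OF J2_continuous[OF c] J2_continuous[OF c]] by presburger
    have "M / l / l \<le> 1"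
      using M0 unfolding l_def by (simp add: divide_le_eq) (simp add: algebra_simps)
    have "dist (T v z) (T w z) = norm (J1 (J2 (P ?d)) z) / 4 / wt l z"
    proof -
      have "T0 (apply_bcontfun v) z - T0 (apply_bcontfun w) z = - (J1 (J2 (P ?d)) z / 4 / of_real (wt l z))"
        unfolding T0_def J using ne[of z] by (simp add: field_simps)
      then show ?thesis unfolding T dist_norm using wt_pos[of l z] by (simp add: norm_divide)
    qed
    also have "\<dots> \<le> (M * dist v w / l / l * wt l z) / 4 / wt l z"
      using wt_pos[of l z] by (intro divide_right_mono nJ cd nd) auto
    also have "\<dots> = 1 / 4 * ((M / l / l) * dist v w)"
      using wt_pos[of l z] by simp
    also have "\<dots> \<le> 1 / 4 * dist v w"
      using mult_right_mono[OF \<open>M / l / l \<le> 1\<close> zero_le_dist[of v w]] by simp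
    finally show "dist (T v z) (T w z) \<le> 1 / 4 * dist v w" .
  qed
  then have "\<exists>!w. T w = w" using banach_fix_type[of "1/4" T] by simp
  then obtain w where w: "T w = w" and uniq: "\<And>v. T v = v \<Longrightarrow> v = w" by blast
  define y where "y z = of_real (wt l z) * apply_bcontfun w z" for z
  have Py: "P (apply_bcontfun w) = (\<lambda>z. K z * y z)" by (simp add: P_def y_def)
  have cy: "continuous_on UNIV y"
    unfolding y_def by (intro continuous_intros continuous_on_apply_bcontfun continuous_on_wt)
  have eq: "y z = 1 - J1 (J2 (\<lambda>w. K w * y w)) z / 4" for z
  proof -
    have "apply_bcontfun w z = T0 (apply_bcontfun w) z" using T[of w] w by simp
    then show ?thesis using wt_pos[of l z] by (simp add: T0_def Py) (simp add: y_def)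
  qed
  \<comment> \<open>The reflection of w across the diagonal is a fixed point too, because K is
    symmetric and the two integrations commute; uniqueness gives s = w.\<close>
  define s where "s = Bcontfun (\<lambda>z. apply_bcontfun w (snd z, fst z))"
  have s: "apply_bcontfun s = (\<lambda>z. apply_bcontfun w (snd z, fst z))"
  proof -
    obtain C where C: "\<And>z. norm (apply_bcontfun w z) \<le> C"
      using norm_bounded by blast
    show ?thesis unfolding s_def
      by (rule Bcontfun_inverse, rule bcontfun_normI)
        (auto intro!: continuous_intros continuous_on_compose2[OF continuous_on_apply_bcontfun[of UNIV w]] C)
  qed
  have wts: "wt l (snd z, fst z) = wt l z" for z by (simp add: wt_def)
  have "T0 (apply_bcontfun s) z = apply_bcontfun s z" for z
  proof -
    have "P (apply_bcontfun s) = (\<lambda>z. P (apply_bcontfun w) (snd z, fst z))"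
      by (simp add: P_def s sym wts)
    then have "J1 (J2 (P (apply_bcontfun s))) z = J2 (J1 (P (apply_bcontfun w))) (snd z, fst z)"
      by (simp add: J1_def J2_def)
    also have "\<dots> = J1 (J2 (P (apply_bcontfun w))) (snd z, fst z)"
      by (simp add: J1_J2_commute cP continuous_on_apply_bcontfun)
    finally have "T0 (apply_bcontfun s) z = T0 (apply_bcontfun w) (snd z, fst z)"
      by (simp add: T0_def wts)
    then show ?thesis using T[of w] w by (simp add: s)
  qed
  then have "T s = s" using T[of s] by (simp add: apply_bcontfun_inject[symmetric] ext)
  then have "s = w" by (rule uniq)
  then have "apply_bcontfun w (snd z, fst z) = apply_bcontfun w z" for z using s by metis
  then have "y (snd z, fst z) = y z" for z by (simp add: y_def wts)
  with cy eq show ?thesis using that by blast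
qed

text \<open>The variables are \<xi> = t - x and \<eta> = t + x, hence the potential is taken at
  (\<eta> - \<xi>) / 2 = x. The value on the axis \<xi> = 0 follows by symmetry.\<close>

definition goursat :: "(real \<Rightarrow> complex) \<Rightarrow> (real \<times> real \<Rightarrow> complex) \<Rightarrow> bool" where
  "goursat V y \<longleftrightarrow> smooth y \<and> (\<forall>\<xi> \<eta>. y (\<xi>, \<eta>) = y (\<eta>, \<xi>)) \<and> (\<forall>\<xi>. y (\<xi>, 0) = 1) \<and>
     (\<forall>\<xi> \<eta>. dd (1, 0) (dd (0, 1) y) (\<xi>, \<eta>) = - (V ((\<eta> - \<xi>) / 2) * y (\<xi>, \<eta>)) / 4)"

lemma dd_dir_eqI:
  fixes f :: "real \<times> real \<Rightarrow> 'b::banach"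
  assumes "smooth f"
  shows "((\<lambda>s. f (s, t)) has_vector_derivative D) (at x) \<Longrightarrow> dd (1, 0) f (x, t) = D"
    and "((\<lambda>s. f (x, s)) has_vector_derivative D) (at t) \<Longrightarrow> dd (0, 1) f (x, t) = D"
  by (rule vector_derivative_unique_at, rule has_vector_derivative_slice[OF assms], assumption)+

text \<open>Write f(x, t) as f(0, t) plus the integral of f_x from 0 to x, differentiate in t under
  the integral, then in x: the last derivative undoes the integral.\<close>

lemma dd_commute:
  fixes f :: "real \<times> real \<Rightarrow> complex"
  assumes f: "smooth f"
  shows "dd (1, 0) (dd (0, 1) f) (x, t) = dd (0, 1) (dd (1, 0) f) (x, t)"
proof -
  let ?f1 = "dd (1, 0) f" and ?f2 = "dd (0, 1) f" and ?f21 = "dd (0, 1) (dd (1, 0) f)"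
  note s1 = smooth_dd[OF f] and c1 = smooth_continuous[OF smooth_dd[OF f]] and c2 = smooth_continuous[OF smooth_dd[OF smooth_dd[OF f]]]
  have eq: "f (x, t) = f (0, t) + J1 ?f1 (x, t)" for x t
    using oi_unique[of "\<lambda>s. f (s, t)" "\<lambda>s. ?f1 (s, t)" x, OF has_vector_derivative_slice(1)[OF f]]
    by (simp add: J1_def)
  have f2: "?f2 (x, t) = ?f2 (0, t) + J1 ?f21 (x, t)" for x t
  proof (rule dd_dir_eqI(2)[OF f])
    have "((\<lambda>s. f (0, s) + J1 ?f1 (x, s)) has_vector_derivative ?f2 (0, t) + J1 ?f21 (x, t)) (at t)"
      by (intro has_vector_derivative_add has_vector_derivative_slice(2)[OF f]
          J1_deriv_2[OF c1 c2] has_vector_derivative_slice(2)[OF s1])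
    then show "((\<lambda>s. f (x, s)) has_vector_derivative ?f2 (0, t) + J1 ?f21 (x, t)) (at t)"
      by (simp only: eq[symmetric])
  qed
  show ?thesis
  proof (rule dd_dir_eqI(1)[OF s1])
    have "((\<lambda>s. ?f2 (0, t) + J1 ?f21 (s, t)) has_vector_derivative 0 + ?f21 (x, t)) (at x)"
      by (intro has_vector_derivative_add has_vector_derivative_const J1_deriv_1[OF c2])
    then show "((\<lambda>s. ?f2 (s, t)) has_vector_derivative ?f21 (x, t)) (at x)"
      by (simp only: f2[symmetric] add_0)
  qed
qed

lemma has_vector_derivative_minus_quarter:
  fixes f :: "real \<Rightarrow> complex"
  assumes "(f has_vector_derivative D) F"
  shows "((\<lambda>s. c - f s / 4) has_vector_derivative (- D / 4)) F"
  using has_vector_derivative_diff[OF has_vector_derivative_const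
    bounded_linear.has_vector_derivative[OF bounded_linear_divide assms]] by simp

text \<open>Bootstrapping: the partial derivatives of y are -J2 (K y) / 4 and -J1 (K y) / 4, so C^k
  for y gives C^k for them and C^(k + 1) for y.\<close>

lemma goursat_solvable:
  fixes V :: "real \<Rightarrow> complex"
  assumes V: "smooth V" and even: "\<And>x. V (- x) = V x" and M: "\<And>x. norm (V x) \<le> M"
  obtains y where "goursat V y"
proof -
  let ?K = "\<lambda>z. V ((snd z - fst z) / 2)"
  have "bounded_linear (\<lambda>z::real \<times> real. (snd z - fst z) / 2)"
    using bounded_linear_compose[OF bounded_linear_divide
        bounded_linear_sub[OF bounded_linear_snd bounded_linear_fst]] .
  then have K: "smooth ?K" using V by (rule smooth_compose_linear)
  have sym: "?K (snd z, fst z) = ?K z" for z :: "real \<times> real"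
    using even[of "(snd z - fst z) / 2"] by (simp add: diff_divide_distrib)
  obtain y where cy: "continuous_on UNIV y" and eq: "\<And>z. y z = 1 - J1 (J2 (\<lambda>w. ?K w * y w)) z / 4"
    and ysym: "\<And>z. y (snd z, fst z) = y z"
  proof (rule goursat_exists[of ?K M])
    show "continuous_on UNIV ?K" by (rule smooth_continuous[OF K])
  qed (use M sym in blast)+
  let ?G = "\<lambda>w. ?K w * y w"
  have cG: "continuous_on UNIV ?G" by (intro continuous_intros smooth_continuous[OF K] cy)
  have eq2: "y z = 1 - J2 (J1 ?G) z / 4" for z
    using eq[of z] J1_J2_commute[OF cG] by simp
  have D1: "((\<lambda>s. y (s, t)) has_vector_derivative (- J2 ?G (x, t) / 4)) (at x)" for x t
    using has_vector_derivative_minus_quarter[OF J1_deriv_1[OF J2_continuous[OF cG], of t x], of 1]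
    by (simp add: eq[symmetric])
  have D2: "((\<lambda>s. y (x, s)) has_vector_derivative (- J1 ?G (x, t) / 4)) (at t)" for x t
    using has_vector_derivative_minus_quarter[OF J2_deriv_2[OF J1_continuous[OF cG], of x t], of 1]
    by (simp add: eq2[symmetric])
  have "Ck k y" for k
  proof (induction k)
    case 0
    then show ?case using cy by simp
  next
    case (Suc k)
    have G: "Ck k ?G"
      using K Suc by (intro Ck_bilinear[OF bounded_bilinear_mult]) (simp_all add: smooth_def)
    have "bounded_linear (\<lambda>c::complex. - c / 4)"
      using bounded_linear_compose[OF bounded_linear_divide bounded_linear_minus[OF bounded_linear_ident]] .
    from D1 D2 Ck_linear_image[OF this Ck_J2[OF G]] Ck_linear_image[OF this Ck_J1[OF G]]
    show ?case by (rule Ck_SucI_prod)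
  qed
  then have y: "smooth y" by (simp add: smooth_def)
  have "dd (0, 1) y = (\<lambda>z. - J1 ?G z / 4)"
    using dd_dir_eqI(2)[OF y D2] by auto
  moreover have "((\<lambda>s. - J1 ?G (s, t) / 4) has_vector_derivative - ?G (x, t) / 4) (at x)" for x t
    using has_vector_derivative_minus_quarter[OF J1_deriv_1[OF cG, of t x], of 0] by simp
  ultimately have "dd (1, 0) (dd (0, 1) y) (x, t) = - ?G (x, t) / 4" for x t
    using dd_dir_eqI(1)[OF smooth_dd[OF y], of "(0, 1)"] by simp
  moreover have "y (x, 0) = 1" for x using eq2[of "(x, 0)"] by (simp add: J2_def)
  ultimately have "goursat V y"
    using y ysym[of "(_, _)"] by (simp add: goursat_def)
  then show ?thesis using that by blast
qed

lemma
  assumes "goursat V y"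
  shows goursat_smooth: "smooth y"
    and goursat_sym: "y (\<xi>, \<eta>) = y (\<eta>, \<xi>)"
    and goursat_axis: "y (\<xi>, 0) = 1" "y (0, \<eta>) = 1"
    and goursat_mixed: "dd (1, 0) (dd (0, 1) y) (\<xi>, \<eta>) = - (V ((\<eta> - \<xi>) / 2) * y (\<xi>, \<eta>)) / 4"
  using assms unfolding goursat_def by (blast, blast, blast, metis, blast)

text \<open>On the diagonal, which is x = 0, this says that (d_\<eta> - d_\<xi>) y = d_x y vanishes:
  the Neumann condition.\<close>

lemma goursat_sym_deriv:
  assumes "goursat V y"
  shows "dd (1, 0) y (\<xi>, \<eta>) = dd (0, 1) y (\<eta>, \<xi>)"
proof -
  have "y = (\<lambda>z. y (snd z, fst z))" using goursat_sym[OF assms] by (auto simp: fun_eq_iff)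
  then have "dd (1, 0) y (\<xi>, \<eta>) = dd (1, 0) (\<lambda>z. y (snd z, fst z)) (\<xi>, \<eta>)"
    by (rule arg_cong)
  also have "\<dots> = dd (0, 1) y (\<eta>, \<xi>)"
    using dd_compose_linear[OF bounded_linear_swap goursat_smooth[OF assms], of "(1, 0)" "(\<xi>, \<eta>)"] by simp
  finally show ?thesis .
qed

lemma goursat_axis_deriv:
  assumes "goursat V y"
  shows "dd (0, 1) y (0, \<eta>) = 0" "dd (1, 0) y (\<xi>, 0) = 0"
proof -
  have "((\<lambda>s. y (0, s)) has_vector_derivative 0) (at \<eta>)" "((\<lambda>s. y (s, 0)) has_vector_derivative 0) (at \<xi>)"
    by (simp_all add: goursat_axis[OF assms])
  then show "dd (0, 1) y (0, \<eta>) = 0" "dd (1, 0) y (\<xi>, 0) = 0"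
    by (simp_all add: dd_dir_eqI goursat_smooth[OF assms])
qed

section \<open>Reduction to a Schroedinger operator\<close>

definition sqA :: "(real \<Rightarrow> real) \<Rightarrow> real \<Rightarrow> complex" where
  "sqA A x = complex_of_real (sqrt (A x))"

definition pot :: "(real \<Rightarrow> real) \<Rightarrow> real \<Rightarrow> complex" where
  "pot A x = dd 1 (dd 1 (sqA A)) x * inverse (sqA A x)"

text \<open>For admissible A the potential vanishes for x < xm with some xm > 0, so the summands
  have disjoint supports and the sum is the even extension, smooth without any gluing at 0.\<close>

definition epot :: "(real \<Rightarrow> real) \<Rightarrow> real \<Rightarrow> complex" where
  "epot A x = pot A x + pot A (- x)"

lemma admissible_pos: "admissible A \<Longrightarrow> A x > 0"
  by (simp add: admissible_def)

lemma sqA_nonzero: "admissible A \<Longrightarrow> sqA A x \<noteq> 0"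
  using admissible_pos[of A x] by (simp add: sqA_def)

lemma sqA_square: "admissible A \<Longrightarrow> sqA A x * sqA A x = complex_of_real (A x)"
  using admissible_pos[of A x] unfolding sqA_def by (simp flip: of_real_mult)

lemma smooth_sqA: "admissible A \<Longrightarrow> smooth (sqA A)"
  unfolding sqA_def[abs_def] by (intro smooth_of_real smooth_sqrt admissible_pos)
    (simp_all add: admissible_def smooth1_iff_smooth)

lemma smooth_pot: "admissible A \<Longrightarrow> smooth (pot A)"
  unfolding pot_def[abs_def] by (intro smooth_mult smooth_dd smooth_sqA smooth_inverse sqA_nonzero)

lemma smooth_epot: "admissible A \<Longrightarrow> smooth (epot A)"
  unfolding epot_def[abs_def] using smooth_affine_real[OF smooth_pot, of A "- 1" 0]
  by (intro smooth_add smooth_pot) simp_all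

lemma epot_even: "epot A (- x) = epot A x"
  by (simp add: epot_def)

lemma admissible_left_right:
  assumes "admissible A"
  obtains xm xp c where "0 < xm" "xm < xp" "\<And>x. x < xm \<Longrightarrow> A x = 1" "\<And>x. x > xp \<Longrightarrow> A x = c"
  using assms unfolding admissible_def by metis

lemma pot_eq_0_on_open:
  assumes "open U" "x \<in> U" "\<And>y. y \<in> U \<Longrightarrow> A y = c"
  shows "pot A x = 0"
proof -
  have "dd 1 (sqA A) y = 0" if "y \<in> U" for y
    by (rule dd_eq_0_if_const_on_open[OF assms(1) that, of _ "complex_of_real (sqrt c)"])
      (simp add: sqA_def assms(3))
  then have "dd 1 (dd 1 (sqA A)) x = 0"
    by (rule dd_eq_0_if_const_on_open[OF assms(1,2)])
  then show ?thesis by (simp add: pot_def)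
qed

lemma pot_support:
  assumes "admissible A"
  obtains xm xp where "0 < xm" "xm < xp" "\<And>x. x < xm \<Longrightarrow> A x = 1"
    "\<And>x. x < xm \<Longrightarrow> pot A x = 0" "\<And>x. x > xp \<Longrightarrow> pot A x = 0"
proof -
  obtain xm xp c where *: "0 < xm" "xm < xp" "\<And>x. x < xm \<Longrightarrow> A x = 1" "\<And>x. x > xp \<Longrightarrow> A x = c"
    using admissible_left_right[OF assms] by metis
  show ?thesis
    by (rule that[of xm xp])
      (use * pot_eq_0_on_open[of "{..<xm}" _ A 1] pot_eq_0_on_open[of "{xp<..}" _ A c] in auto)
qed

lemma epot_near_0:
  assumes "admissible A"
  obtains xm where "0 < xm" "\<And>x. x < xm \<Longrightarrow> A x = 1" "\<And>x. \<bar>x\<bar> < xm \<Longrightarrow> epot A x = 0"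
    "\<And>x. 0 \<le> x \<Longrightarrow> epot A x = pot A x"
proof -
  obtain xm xp where *: "0 < xm" "\<And>x. x < xm \<Longrightarrow> A x = 1" "\<And>x. x < xm \<Longrightarrow> pot A x = 0"
    using pot_support[OF assms] by metis
  show ?thesis by (rule that[of xm]) (use * in \<open>auto simp: epot_def\<close>)
qed

lemma epot_bounded:
  assumes "admissible A"
  obtains M where "\<And>x. norm (epot A x) \<le> M"
proof -
  obtain xm xp where *: "0 < xm" "xm < xp" "\<And>x. x < xm \<Longrightarrow> A x = 1"
      "\<And>x. x < xm \<Longrightarrow> pot A x = 0" "\<And>x. x > xp \<Longrightarrow> pot A x = 0"
    by (rule pot_support[OF assms], rule that)
  have "compact (epot A ` {-xp..xp})"
    by (intro compact_continuous_image smooth_continuous smooth_epot assms compact_Icc)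
  then have "bounded (epot A ` {-xp..xp})" by (rule compact_imp_bounded)
  then obtain B where B0: "\<forall>z \<in> epot A ` {-xp..xp}. norm z \<le> B" unfolding bounded_iff ..
  have B: "norm (epot A x) \<le> B" if "x \<in> {-xp..xp}" for x
    using B0 that by simp
  have "norm (epot A x) \<le> B" for x
  proof (cases "x \<in> {-xp..xp}")
    case True
    then show ?thesis by (rule B)
  next
    case False
    then have "pot A x = 0" "pot A (- x) = 0" using *(1,2,4,5) by (auto simp: not_le)
    then have "epot A x = 0" by (simp add: epot_def)
    moreover have "0 \<le> B" using order_trans[OF norm_ge_zero B[of 0]] *(1,2) by simp
    ultimately show ?thesis by simp
  qed
  then show ?thesis using that by blast
qed

lemma goursat_exists_for:
  assumes "admissible A"
  obtains y where "goursat (epot A) y"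
proof -
  obtain M where "\<And>x. norm (epot A x) \<le> M" by (rule epot_bounded[OF assms], rule that)
  then show ?thesis
    using goursat_solvable[OF smooth_epot[OF assms] epot_even, of M] that by blast
qed

lemma smooth_fst: "smooth f \<Longrightarrow> smooth (\<lambda>z. f (fst z))" 
  and smooth_snd: "smooth g \<Longrightarrow> smooth (\<lambda>z. g (snd z))"
  by (simp_all add: smooth_compose_linear bounded_linear_fst bounded_linear_snd)

lemma dd_fst: "smooth f \<Longrightarrow> dd h (\<lambda>z. f (fst z)) z = dd (fst h) f (fst z)"
  by (simp add: dd_compose_linear bounded_linear_fst)

definition schr :: "(real \<Rightarrow> complex) \<Rightarrow> (real \<times> real \<Rightarrow> complex) \<Rightarrow> real \<times> real \<Rightarrow> complex" where
  "schr V F z = dd (0, 1) (dd (0, 1) F) z - dd (1, 0) (dd (1, 0) F) z + V (fst z) * F z"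

text \<open>The operator is a transpose, so test functions are multiplied by a = sqrt A where
  solutions are divided. Since \<phi> / A = F / a and A d_x (F / a) = a F_x - a' F, one more
  derivative gives a F_xx - a'' F: the terms a' F_x cancel.\<close>

lemma wave_operator_conj:
  assumes A: "admissible A" and F: "smooth F"
  defines "\<phi> \<equiv> \<lambda>z. sqA A (fst z) * F z"
  shows "(\<lambda>z. pdt (pdt \<phi>) z - pdx (\<lambda>w. complex_of_real (A (fst w)) *
            pdx (\<lambda>w'. \<phi> w' / complex_of_real (A (fst w'))) w) z)
    = (\<lambda>z. sqA A (fst z) * schr (pot A) F z)"
proof -
  let ?a = "sqA A" and ?a1 = "dd 1 (sqA A)" and ?a2 = "dd 1 (dd 1 (sqA A))"
  let ?Fx = "dd (1, 0) F" and ?Ft = "dd (0, 1) F"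
  have s: "smooth (\<lambda>z::real \<times> real. ?a (fst z))" "smooth (\<lambda>z::real \<times> real. ?a1 (fst z))" "smooth ?Fx" "smooth ?Ft"
      "smooth (\<lambda>z::real \<times> real. inverse (?a (fst z)))"
    by (auto intro!: smooth_fst smooth_inverse smooth_dd smooth_sqA A F sqA_nonzero)
  have sa: "smooth ?a" "smooth ?a1" by (auto intro!: smooth_sqA A smooth_dd)
  have da: "dd (c, d) (\<lambda>z. ?a (fst z)) z = of_real c * ?a1 (fst z)"
    "dd (c, d) (\<lambda>z. ?a1 (fst z)) z = of_real c * ?a2 (fst z)" for c d :: real and z :: "real \<times> real"
    using dd_scale_dir[of ?a c 1 "fst z"] dd_scale_dir[of ?a1 c 1 "fst z"] sa
    by (simp_all add: dd_fst scaleR_conv_of_real)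
  have \<phi>: "smooth \<phi>" unfolding \<phi>_def by (intro smooth_mult s F)
  have "pdt \<phi> = (\<lambda>z. ?a (fst z) * ?Ft z)"
    unfolding pdt_smooth[OF \<phi>] unfolding \<phi>_def using s F by (auto simp: dd_mult da)
  moreover have "smooth (\<lambda>z. ?a (fst z) * ?Ft z)" by (intro smooth_mult s)
  ultimately have tt: "pdt (pdt \<phi>) z = ?a (fst z) * dd (0, 1) ?Ft z" for z
    using s F by (simp add: pdt_smooth dd_mult da)
  have q: "(\<lambda>w. \<phi> w / complex_of_real (A (fst w))) = (\<lambda>w. F w * inverse (?a (fst w)))"
    unfolding \<phi>_def using sqA_nonzero[OF A] by (auto simp: sqA_square[OF A, symmetric] field_simps)
  have "smooth (\<lambda>w. F w * inverse (?a (fst w)))" by (intro smooth_mult s F)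
  then have "pdx (\<lambda>w. F w * inverse (?a (fst w))) = dd (1, 0) (\<lambda>w. F w * inverse (?a (fst w)))"
    by (rule pdx_smooth)
  moreover have "dd (1, 0) (\<lambda>w. inverse (?a (fst w))) z = - ?a1 (fst z) / (?a (fst z) * ?a (fst z))" for z :: "real \<times> real"
  proof -
    have "((\<lambda>w. inverse (?a (fst w))) has_derivative
       (\<lambda>h. - (inverse (?a (fst z)) * dd h (\<lambda>w. ?a (fst w)) z * inverse (?a (fst z))))) (at z)"
      by (rule Deriv.has_derivative_inverse[OF _ smooth_has_derivative[OF s(1)]]) (rule sqA_nonzero[OF A])
    then show ?thesis using da(1)[of 1 0 z] by (simp add: dd_eqI divide_inverse)
  qed
  ultimately have "pdx (\<lambda>w. F w * inverse (?a (fst w))) z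
     = ?Fx z / ?a (fst z) - F z * ?a1 (fst z) / (?a (fst z) * ?a (fst z))" for z
    using s F by (simp add: dd_mult divide_inverse)
  then have "(\<lambda>w. complex_of_real (A (fst w)) * pdx (\<lambda>w. F w * inverse (?a (fst w))) w)
     = (\<lambda>w. ?a (fst w) * ?Fx w - ?a1 (fst w) * F w)"
    using sqA_nonzero[OF A] by (auto simp: sqA_square[OF A, symmetric] field_simps)
  moreover have "smooth (\<lambda>w. ?a (fst w) * ?Fx w - ?a1 (fst w) * F w)" by (intro smooth_diff smooth_mult s F)
  ultimately have W: "pdx (\<lambda>w. complex_of_real (A (fst w)) * pdx (\<lambda>w. F w * inverse (?a (fst w))) w) z
     = ?a (fst z) * dd (1, 0) ?Fx z - ?a2 (fst z) * F z" for z
    using s F by (simp add: pdx_smooth dd_diff dd_mult da smooth_mult)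
  show ?thesis
    by (rule ext, simp only: q tt W schr_def pot_def) (use sqA_nonzero[OF A] in \<open>simp add: field_simps\<close>)
qed

lemma bounded_linearI_euclidean:
  fixes f :: "'a::euclidean_space \<Rightarrow> 'b::real_normed_vector"
  assumes "\<And>x y. f (x + y) = f x + f y" "\<And>c x. f (c *\<^sub>R x) = c *\<^sub>R f x"
  shows "bounded_linear f"
  using linearI[of f, OF assms] by (simp add: linear_conv_bounded_linear)

section \<open>Integrals of compactly supported functions\<close>

lemma integral_restrict_support:
  fixes f :: "'a::euclidean_space \<Rightarrow> 'b::banach"
  assumes "S \<subseteq> T" "\<And>x. x \<in> T \<Longrightarrow> x \<notin> S \<Longrightarrow> f x = 0"
  shows "integral T f = integral S f"
proof -
  have "integral T f = integral T (\<lambda>x. if x \<in> S then f x else 0)"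
    by (rule integral_cong) (use assms(2) in auto)
  then show ?thesis using integral_restrict_Int[of T S f] assms(1) by (simp add: inf_absorb1)
qed

lemma test2_smooth: "test2 \<phi> \<Longrightarrow> smooth \<phi>"
  by (simp add: test2_def smooth2_iff_smooth)

lemma test1_smooth: "test1 \<psi> \<Longrightarrow> smooth \<psi>"
  by (simp add: test1_def smooth1_iff_smooth)

lemma in_tsupport: "f z \<noteq> 0 \<Longrightarrow> z \<in> tsupport f"
  unfolding tsupport_def using closure_subset[of "{z. f z \<noteq> 0}"] by auto

lemma compact_subset_box:
  fixes K :: "(real \<times> real) set"
  assumes "compact K"
  obtains R where "R > 0" "\<And>x t. (x, t) \<in> K \<Longrightarrow> \<bar>x\<bar> < R \<and> \<bar>t\<bar> < R"
proof -
  obtain B where B: "B > 0" "\<forall>z \<in> K. norm z \<le> B" using compact_imp_bounded[OF assms] unfolding bounded_pos by auto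
  have "\<bar>x\<bar> < B + 1 \<and> \<bar>t\<bar> < B + 1" if "(x, t) \<in> K" for x t
  proof -
    have "norm (x, t) \<le> B" using B(2) that by simp
    then show ?thesis using norm_fst_le[of x t] norm_snd_le[of t x] by auto
  qed
  then show ?thesis using B(1) by (intro that[of "B + 1"]) auto
qed

lemma test2_box:
  assumes "test2 \<phi>"
  obtains R where "R > 0" "\<And>x t. \<phi> (x, t) \<noteq> 0 \<Longrightarrow> \<bar>x\<bar> < R \<and> \<bar>t\<bar> < R"
proof -
  have K: "compact (tsupport \<phi>)" using assms by (simp add: test2_def)
  obtain R where R: "R > 0" "\<And>x t. (x, t) \<in> tsupport \<phi> \<Longrightarrow> \<bar>x\<bar> < R \<and> \<bar>t\<bar> < R"
    by (rule compact_subset_box[OF K], rule that)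
  show ?thesis by (rule that[OF R(1)]) (use R(2) in_tsupport in blast)
qed

lemma test1_box:
  assumes "test1 \<psi>"
  obtains R where "R > 0" "\<And>s. \<psi> s \<noteq> 0 \<Longrightarrow> \<bar>s\<bar> < R"
proof -
  have "bounded (tsupport \<psi>)" using assms compact_imp_bounded unfolding test1_def by auto
  then obtain B where B: "B > 0" "\<forall>z \<in> tsupport \<psi>. norm z \<le> B" unfolding bounded_pos by auto
  have "\<bar>s\<bar> < B + 1" if "\<psi> s \<noteq> 0" for s
    using B(2) in_tsupport[of \<psi> s, OF that] by force
  then show ?thesis using B(1) by (intro that[of "B + 1"]) auto
qed

lemma test2I:
  assumes "smooth \<phi>" "\<And>x t. \<phi> (x, t) \<noteq> 0 \<Longrightarrow> a \<le> x \<and> x \<le> b \<and> c \<le> t \<and> t \<le> d"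
  shows "test2 \<phi>" "tsupport \<phi> \<subseteq> {a..b} \<times> {c..d}"
proof -
  have "{z. \<phi> z \<noteq> 0} \<subseteq> {a..b} \<times> {c..d}" using assms(2) by auto
  moreover have "closed ({a..b} \<times> {c..d})" by (intro closed_Times closed_real_atLeastAtMost)
  ultimately show *: "tsupport \<phi> \<subseteq> {a..b} \<times> {c..d}" unfolding tsupport_def by (rule closure_minimal)
  have "compact ({a..b} \<times> {c..d})" by (intro compact_Times compact_Icc)
  then have "compact (tsupport \<phi>)"
    using compact_Int_closed[of "{a..b} \<times> {c..d}" "tsupport \<phi>"] * by (simp add: tsupport_def inf_absorb2)
  then show "test2 \<phi>" using assms(1) by (simp add: test2_def smooth2_iff_smooth)
qed

lemma test1I:
  assumes "smooth \<psi>" "\<And>t. \<psi> t \<noteq> 0 \<Longrightarrow> c \<le> t \<and> t \<le> d"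
  shows "test1 \<psi>"
proof -
  have "{z. \<psi> z \<noteq> 0} \<subseteq> {c..d}" using assms(2) by auto
  then have *: "tsupport \<psi> \<subseteq> {c..d}" unfolding tsupport_def
    by (rule closure_minimal) (rule closed_real_atLeastAtMost)
  then have "compact (tsupport \<psi>)"
    using compact_Int_closed[of "{c..d}" "tsupport \<psi>"] by (simp add: tsupport_def inf_absorb2)
  then show ?thesis using assms(1) by (simp add: test1_def smooth1_iff_smooth)
qed

lemma integral_eq_lborel:
  fixes f :: "real \<Rightarrow> complex"
  assumes "continuous_on UNIV f" "\<And>x. x \<notin> {-R..R} \<Longrightarrow> f x = 0"
  shows "integral UNIV f = integral\<^sup>L lborel f"
proof -
  have "integrable lborel (\<lambda>x. indicator {-R..R} x *\<^sub>R f x)"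
    by (rule borel_integrable_compact) (auto intro: continuous_on_subset[OF assms(1)])
  moreover have "(\<lambda>x. indicator {-R..R} x *\<^sub>R f x) = f"
    using assms(2) by (auto simp: indicator_def fun_eq_iff)
  ultimately have "integrable lborel f" by simp
  then show ?thesis by (rule integral_lborel)
qed

text \<open>Continuity and compact support turn the gauge integral into a Lebesgue integral, for
  which the affine substitution holds with either sign of c.\<close>

lemma integral_UNIV_affine:
  fixes f :: "real \<Rightarrow> complex"
  assumes f: "continuous_on UNIV f" "\<And>x. x \<notin> {-R..R} \<Longrightarrow> f x = 0" and c: "c \<noteq> 0"
  shows "integral UNIV f = \<bar>c\<bar> *\<^sub>R integral UNIV (\<lambda>x. f (t + c * x))"
proof -
  have "integral UNIV (\<lambda>x. f (t + c * x)) = integral\<^sup>L lborel (\<lambda>x. f (t + c * x))"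
  proof (rule integral_eq_lborel)
    show "continuous_on UNIV (\<lambda>x. f (t + c * x))"
      by (intro continuous_on_compose2[OF f(1)] continuous_intros) auto
    fix x assume x: "x \<notin> {- ((\<bar>R\<bar> + \<bar>t\<bar>) / \<bar>c\<bar>)..(\<bar>R\<bar> + \<bar>t\<bar>) / \<bar>c\<bar>}"
    show "f (t + c * x) = 0"
    proof (rule f(2))
      have "(\<bar>R\<bar> + \<bar>t\<bar>) / \<bar>c\<bar> < \<bar>x\<bar>" using x by auto
      then have "\<bar>R\<bar> + \<bar>t\<bar> < \<bar>c * x\<bar>" using c by (simp add: divide_less_eq abs_mult mult.commute)
      then show "t + c * x \<notin> {-R..R}" by auto
    qed
  qed
  moreover have "integral UNIV f = integral\<^sup>L lborel f" by (rule integral_eq_lborel[OF f])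
  ultimately show ?thesis using lborel_integral_real_affine[OF c, of f t] by simp
qed

lemma continuous_on_integral:
  fixes f :: "'a::topological_space \<Rightarrow> 'b::euclidean_space \<Rightarrow> 'c::banach"
  assumes "continuous_on UNIV (\<lambda>z. f (fst z) (snd z))"
  shows "continuous_on UNIV (\<lambda>x. integral (cbox a b) (f x))"
  by (rule integral_continuous_on_param)
    (auto simp: case_prod_unfold intro: continuous_on_subset[OF assms])

lemma integral_cbox_prod:
  fixes f :: "real \<times> real \<Rightarrow> complex"
  assumes "continuous_on UNIV f"
  shows "integral (cbox (a, c) (b, d)) f = integral {a..b} (\<lambda>x. integral {c..d} (\<lambda>y. f (x, y)))"
    and "integral (cbox (a, c) (b, d)) f = integral {c..d} (\<lambda>y. integral {a..b} (\<lambda>x. f (x, y)))"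
proof -
  show 1: "integral (cbox (a, c) (b, d)) f = integral {a..b} (\<lambda>x. integral {c..d} (\<lambda>y. f (x, y)))"
    using integral_prod_continuous[OF continuous_on_subset[OF assms subset_UNIV], of a c b d] by simp
  have "continuous_on (cbox (a, c) (b, d)) (\<lambda>(x, y). f (x, y))"
    using continuous_on_subset[OF assms subset_UNIV] by (simp add: case_prod_eta)
  from integral_swap_continuous[OF this] 1
  show "integral (cbox (a, c) (b, d)) f = integral {c..d} (\<lambda>y. integral {a..b} (\<lambda>x. f (x, y)))"
    by simp
qed

lemma integral_dx_eq_0:
  fixes F :: "real \<times> real \<Rightarrow> complex"
  assumes F: "smooth F" and ab: "a \<le> b" and z: "\<And>t. F (a, t) = 0" "\<And>t. F (b, t) = 0"
  shows "integral (cbox (a, c) (b, d)) (dd (1, 0) F) = 0"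
proof -
  have "((\<lambda>x. dd (1, 0) F (x, t)) has_integral (F (b, t) - F (a, t))) {a..b}" for t
    by (rule fundamental_theorem_of_calculus[OF ab]) (rule has_vector_derivative_slice(1)[OF F])
  then have "integral {a..b} (\<lambda>x. dd (1, 0) F (x, t)) = 0" for t
    using z by (simp add: integral_unique)
  then show ?thesis
    by (subst integral_cbox_prod(2)[OF smooth_continuous[OF smooth_dd[OF F]]]) simp
qed

lemma integral_dt_eq:
  fixes F :: "real \<times> real \<Rightarrow> complex"
  assumes F: "smooth F" and cd: "c \<le> d" and z: "\<And>x. F (x, d) = 0"
  shows "integral (cbox (a, c) (b, d)) (dd (0, 1) F) = - integral {a..b} (\<lambda>x. F (x, c))"
proof -
  have "((\<lambda>t. dd (0, 1) F (x, t)) has_integral (F (x, d) - F (x, c))) {c..d}" for x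
    by (rule fundamental_theorem_of_calculus[OF cd]) (rule has_vector_derivative_slice(2)[OF F])
  then have "integral {c..d} (\<lambda>t. dd (0, 1) F (x, t)) = - F (x, c)" for x
    using z by (simp add: integral_unique)
  then show ?thesis
    by (subst integral_cbox_prod(1)[OF smooth_continuous[OF smooth_dd[OF F]]]) simp
qed

lemma continuous_bounded_on_box:
  fixes F :: "real \<times> real \<Rightarrow> complex"
  assumes "continuous_on UNIV F"
  obtains B where "B \<ge> 0" "\<And>z. z \<in> cbox a b \<Longrightarrow> norm (F z) \<le> B"
proof -
  have "compact (F ` cbox a b)"
    by (rule compact_continuous_image[OF continuous_on_subset[OF assms subset_UNIV] compact_cbox])
  then have "bounded (F ` cbox a b)" by (rule compact_imp_bounded)
  then obtain B where B: "B > 0" "\<forall>z \<in> F ` cbox a b. norm z \<le> B" unfolding bounded_pos by auto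
  show ?thesis by (rule that[of B]) (use B in auto)
qed

section \<open>Distributions supported in a half plane\<close>

text \<open>The coordinates are \<open>(x, \<xi>) = (x, t - x)\<close>; in them the front \<open>t = x\<close> is \<open>\<xi> = 0\<close>.\<close>

definition shear :: "real \<times> real \<Rightarrow> real \<times> real" where
  "shear z = (fst z, fst z + snd z)"

definition U :: "(real \<times> real \<Rightarrow> complex) \<Rightarrow> (real \<times> real \<Rightarrow> complex) \<Rightarrow> complex" where
  "U H \<phi> = integral (UNIV \<times> {0..}) (\<lambda>z. H z * \<phi> (shear z))"

lemma bounded_linear_shear: "bounded_linear shear"
  by (rule bounded_linearI_euclidean) (simp_all add: shear_def algebra_simps)

text \<open>From |x|, |t| < R follows |t - x| < 2 R, whence the factor 2 in the size of the
  box.\<close>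

lemma U_box:
  assumes "\<And>x t. \<phi> (x, t) \<noteq> 0 \<Longrightarrow> \<bar>x\<bar> < R \<and> \<bar>t\<bar> < R" "2 * R \<le> S"
  shows "U H \<phi> = integral (cbox (- S, 0) (S, S)) (\<lambda>z. H z * \<phi> (shear z))"
  unfolding U_def
proof (rule integral_restrict_support)
  show "cbox (- S, 0) (S, S) \<subseteq> UNIV \<times> {0..}" by (auto simp: cbox_Pair_eq)
  fix z :: "real \<times> real" assume z: "z \<in> UNIV \<times> {0..}" "z \<notin> cbox (- S, 0) (S, S)"
  have "\<phi> (shear z) = 0"
  proof (rule ccontr)
    assume "\<phi> (shear z) \<noteq> 0"
    then have "\<bar>fst z\<bar> < R" "\<bar>fst z + snd z\<bar> < R" unfolding shear_def using assms(1) by blast+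
    then show False using z assms(2) by (cases z) (auto simp: cbox_Pair_eq)
  qed
  then show "H z * \<phi> (shear z) = 0" by simp
qed

lemma continuous_on_shear: 
  assumes "continuous_on UNIV \<phi>"
  shows "continuous_on S (\<lambda>z. \<phi> (shear z))"
  unfolding shear_def by (intro continuous_on_compose2[OF assms] continuous_intros) auto

lemma norm_le_Sup_test2:
  assumes "test2 \<phi>"
  shows "norm (\<phi> z) \<le> Sup (range (\<lambda>z. norm (\<phi> z)))"
proof (rule cSup_upper)
  obtain R where R: "R > 0" "\<And>x t. \<phi> (x, t) \<noteq> 0 \<Longrightarrow> \<bar>x\<bar> < R \<and> \<bar>t\<bar> < R" by (rule test2_box[OF assms], rule that)
  obtain B where B: "B \<ge> 0" "\<And>z. z \<in> cbox (-R,-R) (R,R) \<Longrightarrow> norm (\<phi> z) \<le> B"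
    by (rule continuous_bounded_on_box[OF smooth_continuous[OF test2_smooth[OF assms]]], rule that)
  have "norm (\<phi> z) \<le> B" for z
  proof (cases "\<phi> z = 0")
    case False
    then show ?thesis using R(2)[of "fst z" "snd z"] by (intro B(2)) (cases z, auto simp: cbox_Pair_eq)
  qed (use B in simp)
  then show "bdd_above (range (\<lambda>z. norm (\<phi> z)))" unfolding bdd_above_def by blast
qed simp

text \<open>A locally bounded density has order 0: the estimate uses N = 0, where the sum has the
  single word [] and is the sup norm of \<phi>.\<close>

lemma dist2_U:
  assumes H: "continuous_on UNIV H"
  shows "dist2 (U H)"
  unfolding dist2_def
proof (intro conjI allI impI)
  fix \<phi> \<psi> a b assume *: "test2 \<phi> \<and> test2 \<psi>"
  obtain R where R: "R > 0" "\<And>x t. \<phi> (x, t) \<noteq> 0 \<Longrightarrow> \<bar>x\<bar> < R \<and> \<bar>t\<bar> < R"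
    by (rule test2_box[of \<phi>], use * in blast, rule that)
  obtain R' where R': "R' > 0" "\<And>x t. \<psi> (x, t) \<noteq> 0 \<Longrightarrow> \<bar>x\<bar> < R' \<and> \<bar>t\<bar> < R'"
    by (rule test2_box[of \<psi>], use * in blast, rule that)
  define M where "M = max R R'"
  have M: "\<phi> (x, t) \<noteq> 0 \<Longrightarrow> \<bar>x\<bar> < M \<and> \<bar>t\<bar> < M" "\<psi> (x, t) \<noteq> 0 \<Longrightarrow> \<bar>x\<bar> < M \<and> \<bar>t\<bar> < M" for x t
    using R(2)[of x t] R'(2)[of x t] by (auto simp: M_def)
  have M3: "a * \<phi> (x, t) + b * \<psi> (x, t) \<noteq> 0 \<Longrightarrow> \<bar>x\<bar> < M \<and> \<bar>t\<bar> < M" for x t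
    using M[of x t] by fastforce
  let ?B = "cbox (- (2 * M), 0) (2 * M, 2 * M)"
  have c: "continuous_on ?B (\<lambda>z. H z * \<phi> (shear z))" "continuous_on ?B (\<lambda>z. H z * \<psi> (shear z))"
    by (intro continuous_intros continuous_on_subset[OF H] continuous_on_shear smooth_continuous test2_smooth;
        use * in simp)+
  have "integral ?B (\<lambda>z. H z * (a * \<phi> (shear z) + b * \<psi> (shear z)))
      = integral ?B (\<lambda>z. a * (H z * \<phi> (shear z)) + b * (H z * \<psi> (shear z)))"
    by (simp add: algebra_simps)
  also have "\<dots> = a * integral ?B (\<lambda>z. H z * \<phi> (shear z)) + b * integral ?B (\<lambda>z. H z * \<psi> (shear z))"
    by (subst integral_add) (auto intro!: integrable_continuous continuous_intros c)
  finally show "U H (\<lambda>z. a * \<phi> z + b * \<psi> z) = a * U H \<phi> + b * U H \<psi>"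
    using U_box[where \<phi>="\<lambda>z. a * \<phi> z + b * \<psi> z", OF M3 order_refl] U_box[OF M(1) order_refl] U_box[OF M(2) order_refl] by simp
next
  fix K :: "(real \<times> real) set" assume K: "compact K"
  obtain R where R: "R > 0" "\<And>x t. (x, t) \<in> K \<Longrightarrow> \<bar>x\<bar> < R \<and> \<bar>t\<bar> < R"
    by (rule compact_subset_box[OF K], rule that)
  let ?B = "cbox (- (2 * R), 0) (2 * R, 2 * R)"
  obtain C where C: "C \<ge> 0" "\<And>z. z \<in> ?B \<Longrightarrow> norm (H z) \<le> C"
    by (rule continuous_bounded_on_box[OF H], rule that)
  have "norm (U H \<phi>) \<le> (C * measure lborel ?B) * (\<Sum>ds\<in>{ds::bool list. length ds \<le> 0}. Sup (range (\<lambda>z. norm (Dpart ds \<phi> z))))"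
    if \<phi>: "test2 \<phi> \<and> tsupport \<phi> \<subseteq> K" for \<phi>
  proof -
    let ?s = "Sup (range (\<lambda>z. norm (\<phi> z)))"
    have s: "norm (\<phi> z) \<le> ?s" for z using norm_le_Sup_test2 \<phi> by blast
    have s0: "0 \<le> ?s" using order_trans[OF norm_ge_zero s] .
    have eq: "U H \<phi> = integral ?B (\<lambda>z. H z * \<phi> (shear z))"
    proof (rule U_box)
      show "\<bar>x\<bar> < R \<and> \<bar>t\<bar> < R" if "\<phi> (x, t) \<noteq> 0" for x t
        using R(2)[of x t] in_tsupport[of \<phi> "(x, t)", OF that] \<phi> by blast
    qed simp
    have "norm (integral ?B (\<lambda>z. H z * \<phi> (shear z))) \<le> (C * ?s) * measure lborel ?B"
    proof (rule has_integral_bound[OF _ integrable_integral])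
      show "(\<lambda>z. H z * \<phi> (shear z)) integrable_on ?B"
        by (intro integrable_continuous continuous_intros continuous_on_subset[OF H] continuous_on_shear smooth_continuous test2_smooth)
          (use \<phi> in auto)
      show "norm (H z * \<phi> (shear z)) \<le> C * ?s" if "z \<in> ?B" for z
        unfolding norm_mult by (intro mult_mono C that s norm_ge_zero)
    qed (use C s0 in simp)
    moreover have "{ds::bool list. length ds \<le> 0} = {[]}" by auto
    ultimately show ?thesis unfolding eq by (simp add: Dpart_def mult_ac)
  qed
  then show "\<exists>C N. \<forall>\<phi>. test2 \<phi> \<and> tsupport \<phi> \<subseteq> K \<longrightarrow> norm (U H \<phi>)
      \<le> C * (\<Sum>ds\<in>{ds::bool list. length ds \<le> N}. Sup (range (\<lambda>z. norm (Dpart ds \<phi> z))))"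
    by (intro exI[of _ "C * measure lborel ?B"] exI[of _ 0]) blast
qed

section \<open>The wave front set of \<open>U H\<close>\<close>

lemma cis_has_vector_derivative: "(cis has_vector_derivative \<i> * cis x) (at x)"
proof -
  have "((\<lambda>x. complex_of_real (cos x) + \<i> * complex_of_real (sin x)) has_vector_derivative
      complex_of_real (- sin x) + \<i> * complex_of_real (cos x)) (at x)"
    by (intro has_vector_derivative_add has_vector_derivative_mult_right has_vector_derivative_of_real)
      (auto intro!: derivative_eq_intros)
  moreover have "(\<lambda>x. complex_of_real (cos x) + \<i> * complex_of_real (sin x)) = cis"
    by (simp add: fun_eq_iff complex_eq_iff)
  moreover have "complex_of_real (- sin x) + \<i> * complex_of_real (cos x) = \<i> * cis x"
    by (simp add: complex_eq_iff)
  ultimately show ?thesis by (simp only:)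
qed

lemma smooth_cis: "smooth cis"
proof -
  have "Ck k cis" for k
  proof (induction k)
    case 0
    show ?case using cis_has_vector_derivative
      by (auto intro!: continuous_at_imp_continuous_on has_vector_derivative_continuous)
  next
    case (Suc k)
    show ?case
      by (rule Ck_SucI_real[OF cis_has_vector_derivative])
        (intro Ck_bilinear[OF bounded_bilinear_mult] Ck_const Suc)
  qed
  then show ?thesis by (simp add: smooth_def)
qed

lemma dd_cis: "dd h cis x = of_real h * (\<i> * cis x)"
  using dd_eqI[OF cis_has_vector_derivative[unfolded has_vector_derivative_def], of h x]
  by (simp add: scaleR_conv_of_real)

definition wave :: "real \<Rightarrow> real \<Rightarrow> real \<times> real \<Rightarrow> complex" where
  "wave \<zeta> \<omega> z = cis (- (\<zeta> * fst z + \<omega> * snd z))"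

lemma bounded_linear_phase: "bounded_linear (\<lambda>z::real \<times> real. - (\<zeta> * fst z + \<omega> * snd z))"
  by (rule bounded_linearI_euclidean) (simp_all add: algebra_simps)

lemma smooth_wave: "smooth (wave \<zeta> \<omega>)"
  unfolding wave_def[abs_def] by (rule smooth_compose_linear[OF bounded_linear_phase smooth_cis])

lemma dd_wave: "dd (1, 0) (wave \<zeta> \<omega>) z = - \<i> * of_real \<zeta> * wave \<zeta> \<omega> z"
  using dd_compose_linear[OF bounded_linear_phase smooth_cis, of "(1, 0)" \<zeta> \<omega> z]
  by (simp add: wave_def[abs_def] dd_cis)

lemma norm_wave [simp]: "norm (wave \<zeta> \<omega> z) = 1"
  by (simp add: wave_def)

text \<open>N integrations by parts in x. This direction is tangent to the edge where the second
  coordinate is 0, so the cut along that edge produces no boundary term; the bound is uniform in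
  \<omega>.\<close>

lemma oscillatory_integral_decay:
  assumes "0 \<le> S" "smooth G" "\<And>x t. \<not> (\<bar>x\<bar> < S) \<Longrightarrow> G (x, t) = 0"
  shows "\<exists>C. \<forall>\<zeta> \<omega>. norm (of_real \<zeta> ^ N * integral (cbox (- S, 0) (S, S)) (\<lambda>z. G z * wave \<zeta> \<omega> z)) \<le> C"
  using assms(2,3)
proof (induction N arbitrary: G)
  case 0
  let ?B = "cbox (- S, 0) (S, S)"
  obtain C where C: "C \<ge> 0" "\<And>z. z \<in> ?B \<Longrightarrow> norm (G z) \<le> C"
    by (rule continuous_bounded_on_box[OF smooth_continuous[OF 0(1)]], rule that)
  have "norm (integral ?B (\<lambda>z. G z * wave \<zeta> \<omega> z)) \<le> C * measure lborel ?B" for \<zeta> \<omega>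
    by (rule has_integral_bound[OF C(1) integrable_integral])
      (auto intro!: integrable_continuous smooth_continuous smooth_mult smooth_wave 0 C simp: norm_mult)
  then show ?case by (intro exI[of _ "C * measure lborel ?B"]) simp
next
  case (Suc N)
  let ?B = "cbox (- S, 0) (S, S)"
  \<comment> \<open>On |x| = S itself the derivative vanishes by continuity from outside.\<close>
  have zero: "dd (1, 0) G (x, t) = 0" if x: "\<not> (\<bar>x\<bar> < S)" for x t
  proof -
    have "dd (1, 0) G (x, t) = 0" if "\<bar>x\<bar> > S" for x
    proof (rule dd_eq_0_if_const_on_open[of "{z. \<bar>fst z\<bar> > S}" _ _ 0])
      show "open {z::real \<times> real. S < \<bar>fst z\<bar>}" by (intro open_Collect_less continuous_intros)
      fix w :: "real \<times> real" assume "w \<in> {z. S < \<bar>fst z\<bar>}"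
      then show "G w = 0" using Suc.prems(2)[of "fst w" "snd w"] by simp
    qed (use that in simp)
    then have z: "dd (1, 0) G (x, t) = 0" if "x \<in> {S<..} \<union> {..<-S}" for x using that by auto
    have "x \<in> closure ({S<..} \<union> {..<-S})" using x by (auto simp: closure_Un closure_greaterThan closure_lessThan)
    with continuous_on_slices(1)[OF smooth_continuous[OF smooth_dd[OF Suc.prems(1)]]] z
    show ?thesis by (intro continuous_eq_const_closure[of "\<lambda>x. dd (1, 0) G (x, t)" "{S<..} \<union> {..<-S}" 0 x]) auto
  qed
  obtain C where C: "\<And>\<zeta> \<omega>. norm (of_real \<zeta> ^ N * integral ?B (\<lambda>z. dd (1, 0) G z * wave \<zeta> \<omega> z)) \<le> C"
    using Suc.IH[OF smooth_dd[OF Suc.prems(1)] zero] by auto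
  have "of_real \<zeta> * integral ?B (\<lambda>z. G z * wave \<zeta> \<omega> z)
      = - \<i> * integral ?B (\<lambda>z. dd (1, 0) G z * wave \<zeta> \<omega> z)" for \<zeta> \<omega>
  proof -
    let ?F = "\<lambda>z. G z * wave \<zeta> \<omega> z"
    have "integral ?B (dd (1, 0) ?F) = 0"
      by (rule integral_dx_eq_0) (use assms(1) Suc.prems in \<open>auto intro!: smooth_mult smooth_wave\<close>)
    moreover have "dd (1, 0) ?F = (\<lambda>z. - \<i> * of_real \<zeta> * (G z * wave \<zeta> \<omega> z) + dd (1, 0) G z * wave \<zeta> \<omega> z)"
      using Suc.prems(1) smooth_wave by (auto simp: dd_mult dd_wave algebra_simps)
    moreover have "integral ?B (\<lambda>z. - \<i> * of_real \<zeta> * (G z * wave \<zeta> \<omega> z) + dd (1, 0) G z * wave \<zeta> \<omega> z)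
        = - \<i> * of_real \<zeta> * integral ?B ?F + integral ?B (\<lambda>z. dd (1, 0) G z * wave \<zeta> \<omega> z)"
    proof (subst integral_add)
      show "(\<lambda>z. - \<i> * of_real \<zeta> * (G z * wave \<zeta> \<omega> z)) integrable_on ?B"
        "(\<lambda>z. dd (1, 0) G z * wave \<zeta> \<omega> z) integrable_on ?B"
        by (intro integrable_continuous smooth_continuous smooth_mult smooth_const smooth_dd smooth_wave Suc.prems)+
    qed simp
    ultimately have "\<i> * of_real \<zeta> * integral ?B ?F = integral ?B (\<lambda>z. dd (1, 0) G z * wave \<zeta> \<omega> z)"
      by simp
    then have "- \<i> * (\<i> * of_real \<zeta> * integral ?B ?F) = - \<i> * integral ?B (\<lambda>z. dd (1, 0) G z * wave \<zeta> \<omega> z)"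
      by (rule arg_cong)
    then show ?thesis by (simp add: mult.assoc[symmetric])
  qed
  then have "norm (of_real \<zeta> ^ Suc N * integral ?B (\<lambda>z. G z * wave \<zeta> \<omega> z))
      = norm (of_real \<zeta> ^ N * integral ?B (\<lambda>z. dd (1, 0) G z * wave \<zeta> \<omega> z))" for \<zeta> \<omega>
    by (simp only: power_Suc2 mult.assoc) (simp add: norm_mult)
  then show ?case using C by auto
qed

text \<open>In sheared coordinates the phase is (\<eta>_x + \<eta>_t) x + \<eta>_t (t - x).
  Integration in x gives rapid decay wherever |\<eta>_x + \<eta>_t| is comparable to the norm of
  \<eta>; only the conormals of the front, with \<eta>_x = - \<eta>_t, escape.\<close>

lemma WF_U:
  assumes H: "smooth H" and "(z, \<xi>) \<in> WF (U H)"
  shows "(snd \<xi>)\<^sup>2 = (fst \<xi>)\<^sup>2"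
proof (rule ccontr)
  assume ne: "(snd \<xi>)\<^sup>2 \<noteq> (fst \<xi>)\<^sup>2"
  define s where "s v = fst v + snd v" for v :: "real \<times> real"
  have s0: "s \<xi> \<noteq> 0"
  proof
    assume "s \<xi> = 0"
    then have "snd \<xi> = - fst \<xi>" by (simp add: s_def)
    then show False using ne by simp
  qed
  have \<xi>0: "norm \<xi> > 0" using assms(2) by (auto simp: WF_def)
  \<comment> \<open>c is the value of |s| on the unit vector in direction \<xi>. As |s v| \<le> 2
    |v|, unit vectors within c / 4 of it still have |s| \<ge> c / 2.\<close>
  define c where "c = \<bar>s \<xi>\<bar> / norm \<xi>"
  have c: "c > 0" using s0 \<xi>0 by (simp add: c_def)
  define b where "b r = complex_of_real (flat 1 r)" for r
  obtain x0 t0 where z: "z = (x0, t0)" by fastforce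
  define \<phi> where "\<phi> w = b (fst w - (x0 - 1)) * b ((x0 + 1) - fst w) * (b (snd w - (t0 - 1)) * b ((t0 + 1) - snd w))" for w
  have sb: "smooth (\<lambda>x. b (x - r))" "smooth (\<lambda>x. b (r - x))" for r
    unfolding b_def using smooth_of_real[OF smooth_affine_real[OF smooth_flat, of 1 1 "- r"]]
      smooth_of_real[OF smooth_affine_real[OF smooth_flat, of 1 "- 1" r]] by simp_all
  have s\<phi>: "smooth \<phi>"
    unfolding \<phi>_def[abs_def]
    by (intro smooth_mult smooth_fst[OF sb(1)] smooth_fst[OF sb(2)] smooth_snd[OF sb(1)] smooth_snd[OF sb(2)])
  have b0: "b r = 0 \<longleftrightarrow> r \<le> 0" for r
    using flat_1_pos[of r] flat_1_zero[of r] by (cases "r \<le> 0") (auto simp: b_def)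
  have \<phi>ne: "\<phi> (x, t) \<noteq> 0 \<Longrightarrow> x0 - 1 \<le> x \<and> x \<le> x0 + 1 \<and> t0 - 1 \<le> t \<and> t \<le> t0 + 1" for x t
    by (auto simp: \<phi>_def b0)
  have t\<phi>: "test2 \<phi>" by (rule test2I(1)[OF s\<phi> \<phi>ne])
  have \<phi>z: "\<phi> z \<noteq> 0" by (simp add: \<phi>_def z b0)
  obtain R where R: "R > 0" "\<And>x t. \<phi> (x, t) \<noteq> 0 \<Longrightarrow> \<bar>x\<bar> < R \<and> \<bar>t\<bar> < R" by (rule test2_box[OF t\<phi>], rule that)
  define S where "S = 2 * R"
  have S0: "0 \<le> S" using R(1) by (simp add: S_def)
  define G where "G w = H w * \<phi> (shear w)" for w
  have G: "smooth G"
    unfolding G_def[abs_def] by (intro smooth_mult H smooth_compose_linear[OF bounded_linear_shear s\<phi>])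
  have G0: "G (x, t) = 0" if "\<not> \<bar>x\<bar> < S" for x t
    using R(2)[of x "x + t"] that R(1) by (cases "\<phi> (x, x + t) = 0") (auto simp: G_def shear_def S_def)
  have UG: "U H (\<lambda>y. \<phi> y * cis (- (y \<bullet> \<eta>))) = integral (cbox (- S, 0) (S, S)) (\<lambda>w. G w * wave (s \<eta>) (snd \<eta>) w)" for \<eta>
  proof -
    have "U H (\<lambda>y. \<phi> y * cis (- (y \<bullet> \<eta>)))
       = integral (cbox (- S, 0) (S, S)) (\<lambda>w. H w * (\<phi> (shear w) * cis (- (shear w \<bullet> \<eta>))))"
      by (rule U_box[of _ R]) (use R in \<open>auto simp: S_def\<close>)
    moreover have "shear w \<bullet> \<eta> = s \<eta> * fst w + snd \<eta> * snd w" for w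
      by (cases \<eta>) (simp add: shear_def s_def algebra_simps)
    ultimately show ?thesis by (simp add: G_def wave_def mult.assoc)
  qed
  have "\<exists>C. \<forall>\<eta>. \<eta> \<noteq> 0 \<and> norm (\<eta> /\<^sub>R norm \<eta> - \<xi> /\<^sub>R norm \<xi>) < c / 4 \<longrightarrow>
        norm (U H (\<lambda>y. \<phi> y * cis (- (y \<bullet> \<eta>)))) \<le> C * (1 + norm \<eta>) powr (- real N)" for N
  proof -
    obtain C0 where C0: "\<And>\<zeta> \<omega>. norm (integral (cbox (- S, 0) (S, S)) (\<lambda>w. G w * wave \<zeta> \<omega> w)) \<le> C0"
      using oscillatory_integral_decay[OF S0 G G0, of 0] by auto
    obtain C1 where C1: "\<And>\<zeta> \<omega>. norm (of_real \<zeta> ^ N * integral (cbox (- S, 0) (S, S)) (\<lambda>w. G w * wave \<zeta> \<omega> w)) \<le> C1"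
      using oscillatory_integral_decay[OF S0 G G0, of N] by auto
    have "norm (U H (\<lambda>y. \<phi> y * cis (- (y \<bullet> \<eta>)))) \<le> (2 ^ N * (C0 + C1 / (c / 2) ^ N)) * (1 + norm \<eta>) powr (- real N)"
      if \<eta>: "\<eta> \<noteq> 0" "norm (\<eta> /\<^sub>R norm \<eta> - \<xi> /\<^sub>R norm \<xi>) < c / 4" for \<eta>
    proof -
      let ?I = "integral (cbox (- S, 0) (S, S)) (\<lambda>w. G w * wave (s \<eta>) (snd \<eta>) w)"
      have n: "norm \<eta> > 0" using \<eta> by simp
      let ?v = "\<eta> /\<^sub>R norm \<eta> - \<xi> /\<^sub>R norm \<xi>"
      have "\<bar>s ?v\<bar> \<le> 2 * norm ?v"
        using norm_fst_le[of "fst ?v" "snd ?v"] norm_snd_le[of "snd ?v" "fst ?v"] unfolding s_def by (simp del: fst_diff snd_diff)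
      moreover have "s ?v = s \<eta> / norm \<eta> - s \<xi> / norm \<xi>" by (simp add: s_def add_divide_distrib divide_inverse algebra_simps)
      ultimately have "\<bar>s \<xi> / norm \<xi>\<bar> - \<bar>s \<eta> / norm \<eta>\<bar> \<le> c / 2" using \<eta>(2) by linarith
      then have "c / 2 \<le> \<bar>s \<eta>\<bar> / norm \<eta>" using \<xi>0 n by (simp add: c_def abs_divide)
      then have low: "c / 2 * norm \<eta> \<le> \<bar>s \<eta>\<bar>" using n by (simp add: field_simps)
      have "(c / 2) ^ N * (norm \<eta> ^ N * norm ?I) = (c / 2 * norm \<eta>) ^ N * norm ?I"
        by (simp only: power_mult_distrib mult.assoc)
      also have "\<dots> \<le> \<bar>s \<eta>\<bar> ^ N * norm ?I" using low c by (intro mult_right_mono power_mono) auto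
      also have "\<dots> \<le> C1" using C1[of "s \<eta>" "snd \<eta>"] by (simp add: norm_mult norm_power)
      finally have b1: "norm \<eta> ^ N * norm ?I \<le> C1 / (c / 2) ^ N"
        using c by (simp add: pos_le_divide_eq mult.commute)
      \<comment> \<open>The N-th estimate controls large \<eta>, the 0-th one small \<eta>; (1 +
        r)^N \<le> 2^N (1 + r^N) combines them.\<close>
      have "(1 + norm \<eta>) ^ N \<le> (2 * max 1 (norm \<eta>)) ^ N" by (intro power_mono) auto
      also have "\<dots> = 2 ^ N * max 1 (norm \<eta> ^ N)"
        using n by (auto simp: power_mult_distrib max_def one_le_power power_le_one_iff)
          (meson le_cases power_le_one order_antisym one_le_power norm_ge_zero)+
      also have "\<dots> \<le> 2 ^ N * (1 + norm \<eta> ^ N)" by simp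
      finally have "(1 + norm \<eta>) ^ N * norm ?I \<le> 2 ^ N * (1 + norm \<eta> ^ N) * norm ?I"
        by (intro mult_right_mono) auto
      also have "\<dots> = 2 ^ N * (norm ?I + norm \<eta> ^ N * norm ?I)" by (simp add: algebra_simps)
      also have "\<dots> \<le> 2 ^ N * (C0 + C1 / (c / 2) ^ N)"
        using C0[of "s \<eta>" "snd \<eta>"] b1 by (intro mult_left_mono add_mono) auto
      finally have fin: "(1 + norm \<eta>) ^ N * norm ?I \<le> 2 ^ N * (C0 + C1 / (c / 2) ^ N)" .
      have pos: "1 + norm \<eta> > 0" "(1 + norm \<eta>) ^ N > 0" using n by (simp_all add: add_pos_pos)
      have pw: "(1 + norm \<eta>) powr (- real N) = inverse ((1 + norm \<eta>) ^ N)"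
        using pos(1) by (simp add: powr_minus powr_realpow)
      have "norm ?I \<le> (2 ^ N * (C0 + C1 / (c / 2) ^ N)) / (1 + norm \<eta>) ^ N"
        by (subst pos_le_divide_eq[OF pos(2)], subst mult.commute[of "norm ?I"], rule fin)
      then show ?thesis by (simp only: UG pw divide_inverse)
    qed
    then show ?thesis by blast
  qed
  moreover have "c / 4 > 0" using c by simp
  ultimately have "(z, \<xi>) \<notin> WF (U H)"
    unfolding WF_def using t\<phi> \<phi>z by blast
  then show False using assms(2) by simp
qed

section \<open>Integration by parts across the front, and the explicit solution\<close>

lemma dd_outside_tsupport:
  fixes f :: "'a::euclidean_space \<Rightarrow> complex"
  assumes "\<And>w. w \<notin> tsupport \<phi> \<Longrightarrow> f w = 0" "z \<notin> tsupport \<phi>"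
  shows "dd h f z = 0"
  by (rule dd_eq_0_if_const_on_open[of "- tsupport \<phi>" _ _ 0]) (use assms in \<open>auto simp: tsupport_def\<close>)

lemma zero_outside_tsupport: "z \<notin> tsupport \<phi> \<Longrightarrow> \<phi> z = 0"
  using in_tsupport by blast

lemma dd_zero_outside_tsupport:
  fixes \<phi> :: "'a::euclidean_space \<Rightarrow> complex"
  shows "z \<notin> tsupport \<phi> \<Longrightarrow> dd h \<phi> z = 0"
  by (rule dd_outside_tsupport[of \<phi> \<phi>]) (simp_all add: zero_outside_tsupport)

lemma dd_shear:
  assumes "smooth f"
  shows "dd (1, 0) (\<lambda>z. f (shear z)) z = dd (1, 0) f (shear z) + dd (0, 1) f (shear z)"
    "dd (0, 1) (\<lambda>z. f (shear z)) z = dd (0, 1) f (shear z)"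
  using dd_compose_linear[OF bounded_linear_shear assms, of "(1, 0)" z]
    dd_compose_linear[OF bounded_linear_shear assms, of "(0, 1)" z] dd_Pair[OF assms, of 1 1 "shear z"]
  by (simp_all add: shear_def)

lemma smooth_shear: "smooth f \<Longrightarrow> smooth (\<lambda>z. f (shear z))"
  by (rule smooth_compose_linear[OF bounded_linear_shear])

text \<open>In the coordinates (x, \<xi>) the derivative d_x of a test function becomes d_x -
  d_\<xi>. Integration by parts produces, besides the regular part, an integral along the edge \<xi>
  = 0: the delta layer that d_x u carries on the front.\<close>

lemma U_pdx:
  assumes H: "smooth H" and \<phi>: "test2 \<phi>" and R: "\<And>x t. (x, t) \<in> tsupport \<phi> \<Longrightarrow> \<bar>x\<bar> < R \<and> \<bar>t\<bar> < R"
    and R0: "R > 0" and S: "S = 2 * R"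
  shows "U H (pdx \<phi>) = integral {- S..S} (\<lambda>x. H (x, 0) * \<phi> (x, x)) - U (\<lambda>z. dd (1, 0) H z - dd (0, 1) H z) \<phi>"
proof -
  let ?B = "cbox (- S, 0) (S, S)"
  let ?P = "\<lambda>z. \<phi> (shear z)" and ?H' = "\<lambda>z. dd (1, 0) H z - dd (0, 1) H z"
  have s\<phi>: "smooth \<phi>" by (rule test2_smooth[OF \<phi>])
  have sP: "smooth ?P" by (rule smooth_shear[OF s\<phi>])
  have sHP: "smooth (\<lambda>z. H z * ?P z)" by (intro smooth_mult H sP)
  have ne: "\<phi> (x, t) \<noteq> 0 \<Longrightarrow> \<bar>x\<bar> < R \<and> \<bar>t\<bar> < R" for x t
    using R in_tsupport[of \<phi> "(x, t)"] by blast
  have ne': "dd (1, 0) \<phi> (x, t) \<noteq> 0 \<Longrightarrow> \<bar>x\<bar> < R \<and> \<bar>t\<bar> < R" for x t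
    using R dd_zero_outside_tsupport[of "(x, t)" \<phi> "(1, 0)"] by blast
  have P0: "?P (x, t) = 0" if "\<not> \<bar>x\<bar> < R \<or> \<not> \<bar>x + t\<bar> < R" for x t
    using ne[of x "x + t"] that by (auto simp: shear_def)
  have 1: "U H (pdx \<phi>) = integral ?B (\<lambda>z. H z * dd (1, 0) \<phi> (shear z))"
    unfolding pdx_smooth[OF s\<phi>] by (rule U_box[OF ne']) (simp_all add: S)
  have eq: "H z * dd (1, 0) \<phi> (shear z) = (dd (1, 0) (\<lambda>z. H z * ?P z) z - dd (0, 1) (\<lambda>z. H z * ?P z) z) - ?H' z * ?P z" for z
    by (simp add: dd_mult[OF H sP] dd_shear[OF s\<phi>] algebra_simps)
  have int: "dd h (\<lambda>z. H z * ?P z) integrable_on ?B" for h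
    by (intro integrable_continuous smooth_continuous smooth_dd sHP)
  have int': "(\<lambda>z. ?H' z * ?P z) integrable_on ?B"
    by (intro integrable_continuous smooth_continuous smooth_mult smooth_diff smooth_dd H sP)
  have "integral ?B (\<lambda>z. H z * dd (1, 0) \<phi> (shear z)) = integral ?B (dd (1, 0) (\<lambda>z. H z * ?P z))
      - integral ?B (dd (0, 1) (\<lambda>z. H z * ?P z)) - integral ?B (\<lambda>z. ?H' z * ?P z)"
    unfolding eq by (simp add: integral_diff int int' integrable_diff)
  moreover have "integral ?B (dd (1, 0) (\<lambda>z. H z * ?P z)) = 0"
    by (rule integral_dx_eq_0[OF sHP]) (use R0 S P0 in auto)
  moreover have "H (x, S) * ?P (x, S) = 0" for x
  proof -
    have "\<not> \<bar>x\<bar> < R \<or> \<not> \<bar>x + S\<bar> < R" using R0 S by linarith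
    then show ?thesis using P0 by simp
  qed
  then have "integral ?B (dd (0, 1) (\<lambda>z. H z * ?P z)) = - integral {-S..S} (\<lambda>x. H (x, 0) * ?P (x, 0))"
    using R0 S by (intro integral_dt_eq[OF sHP]) auto
  moreover have "U ?H' \<phi> = integral ?B (\<lambda>z. ?H' z * ?P z)"
    by (rule U_box[OF ne]) (simp_all add: S)
  ultimately show ?thesis by (simp add: 1 shear_def)
qed

text \<open>\<open>y\<close> in the coordinates (x, \<xi>), where \<eta> = t + x = 2 x +
  \<xi>.\<close>

definition yhat :: "(real \<times> real \<Rightarrow> complex) \<Rightarrow> real \<times> real \<Rightarrow> complex" where
  "yhat y z = y (snd z, 2 * fst z + snd z)"

lemma yhat_linear: "bounded_linear (\<lambda>z::real \<times> real. (snd z, 2 * fst z + snd z))"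
  by (rule bounded_linearI_euclidean) (simp_all add: algebra_simps)

lemma smooth_yhat: "smooth y \<Longrightarrow> smooth (yhat y)"
  unfolding yhat_def[abs_def] by (rule smooth_compose_linear[OF yhat_linear])

lemma dd_yhat:
  assumes "smooth y"
  shows "dd (1, 0) (yhat y) z = 2 * yhat (dd (0, 1) y) z"
    and "dd (0, 1) (yhat y) z = yhat (dd (1, 0) y) z + yhat (dd (0, 1) y) z"
proof -
  let ?w = "(snd z, 2 * fst z + snd z)"
  have "dd (1, 0) (yhat y) z = dd (0, 2) y ?w"
    using dd_compose_linear[OF yhat_linear assms, of "(1, 0)" z] by (simp add: yhat_def[abs_def])
  then show "dd (1, 0) (yhat y) z = 2 * yhat (dd (0, 1) y) z"
    using dd_Pair[OF assms, of 0 2 ?w] by (simp add: yhat_def scaleR_conv_of_real)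
  have "dd (0, 1) (yhat y) z = dd (1, 1) y ?w"
    using dd_compose_linear[OF yhat_linear assms, of "(0, 1)" z] by (simp add: yhat_def[abs_def])
  then show "dd (0, 1) (yhat y) z = yhat (dd (1, 0) y) z + yhat (dd (0, 1) y) z"
    using dd_Pair[OF assms, of 1 1 ?w] by (simp add: yhat_def)
qed

text \<open>In these coordinates d_t becomes d_\<xi> and the old d_x becomes d_x - d_\<xi>, so the
  wave operator is 2 d_\<xi> d_x - d_x^2.\<close>

lemma yhat_equation:
  assumes y: "goursat V y"
  shows "2 * dd (0, 1) (dd (1, 0) (yhat y)) z - dd (1, 0) (dd (1, 0) (yhat y)) z = - (V (fst z) * yhat y z)"
proof -
  note s = goursat_smooth[OF y]
  note s1 = smooth_dd[OF s]
  have d1: "dd (1, 0) (yhat y) = (\<lambda>z. 2 * yhat (dd (0, 1) y) z)"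
    using dd_yhat[OF s] by auto
  have m: "dd h (\<lambda>z. 2 * f z) z = 2 * dd h f z" if "smooth f" for f :: "real \<times> real \<Rightarrow> complex" and h
    using dd_mult[OF smooth_const that, of h 2 z] by simp
  have m12: "4 * yhat (dd (1, 0) (dd (0, 1) y)) z = - (V (fst z) * yhat y z)"
    using goursat_mixed[OF y, of "snd z" "2 * fst z + snd z"] by (simp add: yhat_def)
  show ?thesis
    unfolding d1 m12[symmetric] by (simp add: m dd_add smooth_yhat s1 dd_yhat algebra_simps)
qed

text \<open>The last equation is the Neumann condition (d_x - d_\<xi>) y = 0 at x = 0; the first two
  make the jump across the front compatible with the wave equation.\<close>

lemma yhat_front:
  assumes y: "goursat V y"
  shows "yhat y (x, 0) = 1" "dd (1, 0) (yhat y) (x, 0) = 0"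
    "dd (1, 0) (yhat y) (0, t) = dd (0, 1) (yhat y) (0, t)"
  using goursat_axis[OF y] goursat_axis_deriv[OF y] goursat_sym_deriv[OF y]
  by (simp_all add: dd_yhat goursat_smooth[OF y]) (simp_all add: yhat_def)

definition H0 :: "(real \<Rightarrow> real) \<Rightarrow> (real \<times> real \<Rightarrow> complex) \<Rightarrow> real \<times> real \<Rightarrow> complex" where
  "H0 A y z = inverse (sqA A (fst z)) * yhat y z"

lemma smooth_H0: "admissible A \<Longrightarrow> smooth y \<Longrightarrow> smooth (H0 A y)"
  unfolding H0_def[abs_def] by (intro smooth_mult smooth_yhat smooth_fst smooth_inverse smooth_sqA sqA_nonzero)

text \<open>Green's identity: the integrand is a divergence d_x F1 + d_\<xi> F2. F1 vanishes on the
  sides of the box. On the front y = 1 and y_x = 0 reduce F2 to d_x P, the derivative along the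
  front of a compactly supported function, with integral 0.\<close>

lemma wave_A_zero_U:
  assumes A: "admissible A" and y: "goursat (epot A) y"
  shows "wave_A_zero A (U (H0 A y))"
  unfolding wave_A_zero_def
proof (intro allI impI)
  fix \<phi> assume \<phi>: "test2 \<phi> \<and> tsupport \<phi> \<subseteq> {0<..} \<times> UNIV"
  then have t\<phi>: "test2 \<phi>" and s\<phi>: "smooth \<phi>" using test2_smooth by auto
  define \<Phi> where "\<Phi> z = inverse (sqA A (fst z)) * \<phi> z" for z
  have s\<Phi>: "smooth \<Phi>"
    unfolding \<Phi>_def[abs_def] by (intro smooth_mult smooth_fst smooth_inverse smooth_sqA A sqA_nonzero s\<phi>)
  have \<phi>\<Phi>: "\<phi> = (\<lambda>z. sqA A (fst z) * \<Phi> z)"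
    using sqA_nonzero[OF A] by (simp add: \<Phi>_def fun_eq_iff)
  define P where "P z = \<Phi> (shear z)" for z
  have sP: "smooth P" unfolding P_def[abs_def] by (rule smooth_shear[OF s\<Phi>])
  let ?y = "yhat y"
  have sy: "smooth ?y" by (rule smooth_yhat[OF goursat_smooth[OF y]])
  note sd = smooth_dd[OF sy] smooth_dd[OF sP] sP sy
  \<comment> \<open>F1 and F2 arise from moving 2 d_x d_\<xi> - d_x^2 from P to y, the mixed
    derivative once in each order. In this way F2, the flux through the front, has only derivatives
    tangent to the front.\<close>
  define F1 where "F1 z = ?y z * dd (0, 1) P z - ?y z * dd (1, 0) P z + (dd (1, 0) ?y z - dd (0, 1) ?y z) * P z" for z
  define F2 where "F2 z = ?y z * dd (1, 0) P z - dd (1, 0) ?y z * P z" for z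
  have sF: "smooth F1" "smooth F2"
    unfolding F1_def[abs_def] F2_def[abs_def] by (intro smooth_add smooth_diff smooth_mult sd)+
  have \<Phi>0: "\<Phi> w = 0" if "w \<notin> tsupport \<phi>" for w
    using zero_outside_tsupport[OF that] by (simp add: \<Phi>_def)
  have D\<Phi>0: "dd h \<Phi> w = 0" if "w \<notin> tsupport \<phi>" for w h
    by (rule dd_outside_tsupport[OF \<Phi>0 that])
  have DD\<Phi>0: "dd k (dd h \<Phi>) w = 0" if "w \<notin> tsupport \<phi>" for w h k
    by (rule dd_outside_tsupport[OF D\<Phi>0 that])
  have P1: "dd (1, 0) P = (\<lambda>z. dd (1, 0) \<Phi> (shear z) + dd (0, 1) \<Phi> (shear z))"
    and P2: "dd (0, 1) P = (\<lambda>z. dd (0, 1) \<Phi> (shear z))"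
    unfolding P_def[abs_def] using dd_shear[OF s\<Phi>] by auto
  have P0: "P z = 0" "dd (1, 0) P z = 0" "dd (0, 1) P z = 0" if "shear z \<notin> tsupport \<phi>" for z
    unfolding P1 P2 using \<Phi>0[OF that] D\<Phi>0[OF that] by (simp_all add: P_def)
  have "compact (tsupport \<phi>)" using t\<phi> by (simp add: test2_def)
  then obtain R where R: "R > 0" "\<And>x t. (x, t) \<in> tsupport \<phi> \<Longrightarrow> \<bar>x\<bar> < R \<and> \<bar>t\<bar> < R"
    using compact_subset_box[of "tsupport \<phi>"] by metis
  define S where "S = 2 * R"
  let ?B = "cbox (- S, 0) (S, S)"
  have nots: "shear (x, t) \<notin> tsupport \<phi>" if "\<not> \<bar>x\<bar> < R \<or> \<not> \<bar>x + t\<bar> < R" for x t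
    using that R(2)[of x "x + t"] by (auto simp: shear_def)
  have F0: "F1 z = 0" "F2 z = 0" if "shear z \<notin> tsupport \<phi>" for z
    using P0[OF that] by (simp_all add: F1_def F2_def)
  have key: "?y z * schr (pot A) \<Phi> (shear z) = dd (1, 0) F1 z + dd (0, 1) F2 z" for z
  proof -
    \<comment> \<open>\<open>pot\<close> and \<open>epot\<close> are known to agree for x \<ge> 0,
      and the support of the test function lies in x > 0.\<close>
    have V: "pot A (fst z) * P z = epot A (fst z) * P z"
    proof (cases "shear z \<in> tsupport \<phi>")
      case True
      then have "fst z > 0" using \<phi> by (auto simp: shear_def)
      obtain xm where "\<And>x. 0 \<le> x \<Longrightarrow> epot A x = pot A x" by (rule epot_near_0[OF A], rule that)
      then have "epot A (fst z) = pot A (fst z)" using \<open>fst z > 0\<close> by simp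
      then show ?thesis by simp
    qed (simp add: P0)
    have dP2: "dd (1, 0) (dd (0, 1) P) z = dd (1, 0) (dd (0, 1) \<Phi>) (shear z) + dd (0, 1) (dd (0, 1) \<Phi>) (shear z)"
      unfolding P2 by (rule dd_shear(1)[OF smooth_dd[OF s\<Phi>]])
    have dP1: "dd (1, 0) (dd (1, 0) P) z = dd (1, 0) (dd (1, 0) \<Phi>) (shear z) + dd (0, 1) (dd (1, 0) \<Phi>) (shear z)
        + (dd (1, 0) (dd (0, 1) \<Phi>) (shear z) + dd (0, 1) (dd (0, 1) \<Phi>) (shear z))"
      unfolding P1 by (simp add: dd_add smooth_shear smooth_dd s\<Phi> dd_shear)
    have dP12: "dd (0, 1) (dd (1, 0) P) z = dd (0, 1) (dd (1, 0) \<Phi>) (shear z) + dd (0, 1) (dd (0, 1) \<Phi>) (shear z)"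
      unfolding P1 by (simp add: dd_add smooth_shear smooth_dd s\<Phi> dd_shear)
    have fs: "fst (shear z) = fst z" by (simp add: shear_def)
    have "?y z * schr (pot A) \<Phi> (shear z) = ?y z * (dd (1, 0) (dd (0, 1) P) z + dd (0, 1) (dd (1, 0) P) z - dd (1, 0) (dd (1, 0) P) z)
        + ?y z * (pot A (fst z) * P z)"
      unfolding dP1 dP2 dP12 schr_def fs by (simp add: P_def algebra_simps)
    also have "\<dots> = ?y z * (dd (1, 0) (dd (0, 1) P) z + dd (0, 1) (dd (1, 0) P) z - dd (1, 0) (dd (1, 0) P) z)
        + (epot A (fst z) * ?y z) * P z"
      unfolding V by simp
    also have "epot A (fst z) * ?y z = dd (1, 0) (dd (1, 0) ?y) z - dd (0, 1) (dd (1, 0) ?y) z - dd (1, 0) (dd (0, 1) ?y) z"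
      using yhat_equation[OF y, of z] dd_commute[OF sy, of "fst z" "snd z"] by (simp add: algebra_simps)
    finally show ?thesis
      unfolding F1_def[abs_def] F2_def[abs_def]
      by (simp add: dd_add dd_diff dd_mult smooth_add smooth_diff smooth_mult sd algebra_simps)
  qed
  have "((\<lambda>x. dd (1, 0) P (x, 0)) has_integral P (S, 0) - P (- S, 0)) {-S..S}"
    by (rule fundamental_theorem_of_calculus) (use R(1) has_vector_derivative_slice(1)[OF sP] in \<open>auto simp: S_def\<close>)
  then have Z: "integral {-S..S} (\<lambda>x. dd (1, 0) P (x, 0)) = 0"
    using P0(1)[OF nots, of S 0] P0(1)[OF nots, of "- S" 0] R(1) by (simp add: integral_unique S_def)
  let ?\<theta> = "\<lambda>z. sqA A (fst z) * schr (pot A) \<Phi> z"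
  have "U (H0 A y) ?\<theta> = integral ?B (\<lambda>z. H0 A y z * ?\<theta> (shear z))"
  proof (rule U_box)
    show "\<bar>x\<bar> < R \<and> \<bar>t\<bar> < R" if "?\<theta> (x, t) \<noteq> 0" for x t
    proof (rule R(2), rule ccontr)
      assume "(x, t) \<notin> tsupport \<phi>"
      then have "?\<theta> (x, t) = 0" by (simp add: schr_def \<Phi>0 DD\<Phi>0)
      then show False using that by simp
    qed
  qed (simp add: S_def)
  also have "(\<lambda>z. H0 A y z * ?\<theta> (shear z)) = (\<lambda>z. dd (1, 0) F1 z + dd (0, 1) F2 z)"
  proof
    fix z
    have "H0 A y z * ?\<theta> (shear z) = ?y z * schr (pot A) \<Phi> (shear z)"
      using sqA_nonzero[OF A, of "fst z"] by (simp add: H0_def shear_def)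
    then show "H0 A y z * ?\<theta> (shear z) = dd (1, 0) F1 z + dd (0, 1) F2 z" by (simp only: key)
  qed
  also have "integral ?B (\<lambda>z. dd (1, 0) F1 z + dd (0, 1) F2 z) = integral ?B (dd (1, 0) F1) + integral ?B (dd (0, 1) F2)"
    by (intro integral_add integrable_continuous smooth_continuous smooth_dd sF)
  also have "integral ?B (dd (1, 0) F1) = 0"
    by (rule integral_dx_eq_0[OF sF(1)]) (use R(1) in \<open>auto intro!: F0 nots simp: S_def\<close>)
  also have "integral ?B (dd (0, 1) F2) = - integral {-S..S} (\<lambda>x. F2 (x, 0))"
    by (rule integral_dt_eq[OF sF(2)]) (use R(1) in \<open>auto intro!: F0 nots simp: S_def\<close>)
  also have "integral {-S..S} (\<lambda>x. F2 (x, 0)) = integral {-S..S} (\<lambda>x. dd (1, 0) P (x, 0))"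
    by (simp add: F2_def yhat_front[OF y])
  also note Z
  finally have "U (H0 A y) ?\<theta> = 0" by simp
  then show "U (H0 A y) (\<lambda>z. pdt (pdt \<phi>) z - pdx (\<lambda>w. complex_of_real (A (fst w)) *
                      pdx (\<lambda>w'. \<phi> w' / complex_of_real (A (fst w'))) w) z) = 0"
    using wave_operator_conj[OF A s\<Phi>] \<phi>\<Phi> by simp
qed

section \<open>Traces\<close>

lemma moll_eq_box:
  assumes \<psi>: "\<And>s. \<psi> s \<noteq> 0 \<Longrightarrow> \<bar>s\<bar> < R"
  shows "moll mol \<psi> eps (x, t) = integral (cbox (- R) R)
       (\<lambda>s. \<psi> s * mol (- x / eps, (s - t) / eps) / complex_of_real (eps\<^sup>2))"
  unfolding moll_def prod.case
  by (rule integral_restrict_support) (use \<psi> in \<open>force simp: abs_less_iff\<close>)+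

lemma smooth_moll:
  assumes mol: "smooth mol" and \<psi>: "smooth \<psi>" "\<And>s. \<psi> s \<noteq> 0 \<Longrightarrow> \<bar>s\<bar> < R"
  shows "smooth (moll mol \<psi> eps)"
proof -
  let ?L = "\<lambda>w::(real \<times> real) \<times> real. (- fst (fst w) / eps, (snd w - snd (fst w)) / eps)"
  have "bounded_linear ?L"
    by (rule bounded_linearI_euclidean) (simp_all add: add_divide_distrib diff_divide_distrib right_diff_distrib)
  then have "smooth (\<lambda>w. mol (?L w))" by (rule smooth_compose_linear[OF _ mol])
  then have "smooth (\<lambda>w. \<psi> (snd w) * mol (?L w) * inverse (complex_of_real (eps\<^sup>2)))"
    by (intro smooth_mult smooth_const smooth_compose_linear[OF bounded_linear_snd \<psi>(1)])
  from smooth_integral[OF this, of "- R" R]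
  have "smooth (\<lambda>z. integral (cbox (- R) R) (\<lambda>s. \<psi> s * mol (- fst z / eps, (s - snd z) / eps)
      * inverse (complex_of_real (eps\<^sup>2))))"
    by (simp only: fst_conv snd_conv)
  moreover have "moll mol \<psi> eps = (\<lambda>z. integral (cbox (- R) R)
      (\<lambda>s. \<psi> s * mol (- fst z / eps, (s - snd z) / eps) * inverse (complex_of_real (eps\<^sup>2))))"
  proof
    fix z
    show "moll mol \<psi> eps z = integral (cbox (- R) R)
      (\<lambda>s. \<psi> s * mol (- fst z / eps, (s - snd z) / eps) * inverse (complex_of_real (eps\<^sup>2)))"
      using moll_eq_box[OF \<psi>(2), where x="fst z" and t="snd z"] by (simp only: prod.collapse divide_inverse)
  qed
  ultimately show ?thesis by (simp only:)
qed

text \<open>For eps \<le> 1 all supports stay in one box, so the domains of integration below can be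
  chosen independent of eps.\<close>

lemma moll_nonzero:
  assumes eps: "0 < eps" "eps \<le> 1"
    and mol: "\<And>p q. mol (p, q) \<noteq> 0 \<Longrightarrow> \<bar>p\<bar> < R \<and> \<bar>q\<bar> < R"
    and \<psi>: "\<And>s. \<psi> s \<noteq> 0 \<Longrightarrow> \<bar>s\<bar> < R" and ne: "moll mol \<psi> eps (x, t) \<noteq> 0"
  shows "\<bar>x\<bar> < R \<and> \<bar>t\<bar> < 2 * R"
proof -
  have "\<exists>s. \<psi> s * mol (- x / eps, (s - t) / eps) / complex_of_real (eps\<^sup>2) \<noteq> 0"
  proof (rule ccontr)
    assume "\<not> ?thesis"
    then have z: "\<psi> s * mol (- x / eps, (s - t) / eps) / complex_of_real (eps\<^sup>2) = 0" for s by blast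
    have "moll mol \<psi> eps (x, t) = 0" unfolding moll_def prod.case z by simp
    then show False using ne by simp
  qed
  then obtain s where s: "\<psi> s \<noteq> 0" "mol (- x / eps, (s - t) / eps) \<noteq> 0" by auto
  have R: "R > 0" using \<psi>[OF s(1)] by linarith
  have "\<bar>- x / eps\<bar> < R" "\<bar>(s - t) / eps\<bar> < R" using mol[OF s(2)] by auto
  then have "\<bar>x\<bar> < R * eps" "\<bar>s - t\<bar> < R * eps" using eps(1) by (simp_all add: abs_divide pos_divide_less_eq)
  moreover have "R * eps \<le> R" using R eps by simp
  ultimately show ?thesis using \<psi>[OF s(1)] by linarith
qed

lemma test2_moll:
  assumes eps: "0 < eps" "eps \<le> 1" and mol: "smooth mol" "\<And>p q. mol (p, q) \<noteq> 0 \<Longrightarrow> \<bar>p\<bar> < R \<and> \<bar>q\<bar> < R"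
    and \<psi>: "smooth \<psi>" "\<And>s. \<psi> s \<noteq> 0 \<Longrightarrow> \<bar>s\<bar> < R"
  shows "test2 (moll mol \<psi> eps)" "tsupport (moll mol \<psi> eps) \<subseteq> {-R..R} \<times> {-(2*R)..2*R}"
proof -
  have *: "-R \<le> x \<and> x \<le> R \<and> -(2*R) \<le> t \<and> t \<le> 2*R" if "moll mol \<psi> eps (x, t) \<noteq> 0" for x t
    using moll_nonzero[OF eps mol(2) \<psi>(2) that] by (auto simp: abs_less_iff)
  show "test2 (moll mol \<psi> eps)" "tsupport (moll mol \<psi> eps) \<subseteq> {-R..R} \<times> {-(2*R)..2*R}"
    using test2I[OF smooth_moll[OF mol(1) \<psi>] *] by auto
qed

text \<open>At x = - eps p the substitution s = t - eps p + eps q absorbs one of the two factors 1 /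
  eps.\<close>

lemma moll_substitution:
  assumes eps: "0 < eps"
    and mol: "continuous_on UNIV mol" "\<And>p q. mol (p, q) \<noteq> 0 \<Longrightarrow> \<bar>p\<bar> < R \<and> \<bar>q\<bar> < R"
    and \<psi>: "continuous_on UNIV \<psi>" "\<And>s. \<psi> s \<noteq> 0 \<Longrightarrow> \<bar>s\<bar> < R"
  shows "moll mol \<psi> eps (- (eps * p), t - eps * p) =
    integral {-R..R} (\<lambda>q. \<psi> (t + eps * (q - p)) * mol (p, q)) / complex_of_real eps"
proof -
  let ?f = "\<lambda>s. \<psi> s * mol (p, (s - (t - eps * p)) / eps) / complex_of_real (eps\<^sup>2)"
  have "moll mol \<psi> eps (- (eps * p), t - eps * p) = integral UNIV ?f"
    using eps by (simp add: moll_def)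
  also have "\<dots> = \<bar>eps\<bar> *\<^sub>R integral UNIV (\<lambda>q. ?f ((t - eps * p) + eps * q))"
  proof (rule integral_UNIV_affine)
    show "continuous_on UNIV ?f"
      using eps by (intro continuous_intros \<psi>(1) continuous_on_compose2[OF mol(1)]) auto
    show "?f s = 0" if "s \<notin> {-R..R}" for s using \<psi>(2)[of s] that by force
  qed (use eps in simp)
  also have "(\<lambda>q. ?f ((t - eps * p) + eps * q)) = (\<lambda>q. inverse (complex_of_real (eps\<^sup>2)) * (\<psi> (t + eps * (q - p)) * mol (p, q)))"
    using eps by (auto simp: algebra_simps divide_inverse)
  also have "\<bar>eps\<bar> *\<^sub>R integral UNIV \<dots> = integral UNIV (\<lambda>q. \<psi> (t + eps * (q - p)) * mol (p, q)) / complex_of_real eps"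
    using eps by (simp add: scaleR_conv_of_real power2_eq_square divide_inverse)
  also have "integral UNIV (\<lambda>q. \<psi> (t + eps * (q - p)) * mol (p, q)) = integral {-R..R} (\<lambda>q. \<psi> (t + eps * (q - p)) * mol (p, q))"
    by (rule integral_restrict_support) (use mol(2) in \<open>force simp: abs_less_iff\<close>)+
  finally show ?thesis .
qed

text \<open>The rescaled pairing of \<open>G\<close> with a mollifier on the line \<open>t - x = \<xi>\<close>; it is continuous
  up to \<open>e = 0\<close>.\<close>

definition rescaled :: "real \<Rightarrow> (real \<Rightarrow> complex) \<Rightarrow> (real \<times> real \<Rightarrow> complex) \<Rightarrow> (real \<times> real \<Rightarrow> complex)
    \<Rightarrow> real \<times> real \<Rightarrow> complex" where
  "rescaled R \<psi> mol H v = integral (cbox (-R) R) (\<lambda>p. integral (cbox (-R) R)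
     (\<lambda>q. H (- (fst v * p), snd v) * (\<psi> (snd v + fst v * (q - p)) * mol (p, q))))"

lemma continuous_rescaled:
  assumes H: "continuous_on UNIV H" and \<psi>: "continuous_on UNIV \<psi>" and mol: "continuous_on UNIV mol"
  shows "continuous_on UNIV (rescaled R \<psi> mol H)"
proof -
  have "continuous_on UNIV (\<lambda>w::((real \<times> real) \<times> real) \<times> real. H (- (fst (fst (fst w)) * snd (fst w)), snd (fst (fst w)))
     * (\<psi> (snd (fst (fst w)) + fst (fst (fst w)) * (snd w - snd (fst w))) * mol (snd (fst w), snd w)))"
    by (intro continuous_intros continuous_on_compose2[OF H] continuous_on_compose2[OF \<psi>] continuous_on_compose2[OF mol]) auto
  from continuous_on_integral[OF this, of "-R" R]
  have "continuous_on UNIV (\<lambda>w::(real \<times> real) \<times> real. integral (cbox (-R) R) (\<lambda>q. H (- (fst (fst w) * snd w), snd (fst w))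
     * (\<psi> (snd (fst w) + fst (fst w) * (q - snd w)) * mol (snd w, q))))" by simp
  from continuous_on_integral[OF this, of "-R" R] show ?thesis
    unfolding rescaled_def[abs_def] by simp
qed

text \<open>The substitution x = - eps p absorbs the remaining factor 1 / eps, leaving an expression
  that makes sense at eps = 0.\<close>

lemma moll_line_integral:
  assumes eps: "0 < eps" "eps \<le> 1"
    and mol: "smooth mol" "\<And>p q. mol (p, q) \<noteq> 0 \<Longrightarrow> \<bar>p\<bar> < R \<and> \<bar>q\<bar> < R"
    and \<psi>: "smooth \<psi>" "\<And>s. \<psi> s \<noteq> 0 \<Longrightarrow> \<bar>s\<bar> < R"
    and H: "continuous_on UNIV H" and S: "R \<le> S"
  shows "integral {-S..S} (\<lambda>x. H (x, t) * moll mol \<psi> eps (x, x + t)) = rescaled R \<psi> mol H (eps, t)"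
proof -
  let ?g = "\<lambda>x. H (x, t) * moll mol \<psi> eps (x, x + t)"
  note c\<psi> = smooth_continuous[OF \<psi>(1)] and cmol = smooth_continuous[OF mol(1)]
  have g0: "?g x = 0" if "x \<notin> {-S..S}" for x
  proof -
    have "\<not> \<bar>x\<bar> < R" using that S by auto
    then have "moll mol \<psi> eps (x, x + t) = 0"
      using moll_nonzero[OF eps mol(2) \<psi>(2), where x=x and t="x + t"] by blast
    then show ?thesis by simp
  qed
  have "integral {-S..S} ?g = integral UNIV ?g"
    by (rule integral_restrict_support[symmetric]) (use g0 in auto)
  also have "\<dots> = \<bar>- eps\<bar> *\<^sub>R integral UNIV (\<lambda>p. ?g (0 + (- eps) * p))"
  proof (rule integral_UNIV_affine[OF _ g0])
    show "continuous_on UNIV ?g"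
      by (intro continuous_intros continuous_on_compose2[OF H]
          continuous_on_compose2[OF smooth_continuous[OF smooth_moll[OF mol(1) \<psi>], of UNIV]]) auto
  qed (use eps in auto)
  also have "(\<lambda>p. ?g (0 + (- eps) * p)) = (\<lambda>p. inverse (complex_of_real eps) *
      integral {-R..R} (\<lambda>q. H (- (eps * p), t) * (\<psi> (t + eps * (q - p)) * mol (p, q))))"
    using moll_substitution[OF eps(1) cmol mol(2) c\<psi> \<psi>(2), of _ t]
    by (auto simp: divide_inverse)
  also have "\<bar>- eps\<bar> *\<^sub>R integral UNIV \<dots> = integral UNIV (\<lambda>p. integral {-R..R} (\<lambda>q. H (- (eps * p), t) * (\<psi> (t + eps * (q - p)) * mol (p, q))))"
    using eps by (simp add: scaleR_conv_of_real)
  also have "\<dots> = integral {-R..R} (\<lambda>p. integral {-R..R} (\<lambda>q. H (- (eps * p), t) * (\<psi> (t + eps * (q - p)) * mol (p, q))))"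
  proof (rule integral_restrict_support)
    fix p assume p: "p \<in> UNIV" "p \<notin> {-R..R}"
    have "\<not> \<bar>p\<bar> < R" using p by auto
    then have "mol (p, q) = 0" for q using mol(2)[of p q] by blast
    then show "integral {-R..R} (\<lambda>q. H (- (eps * p), t) * (\<psi> (t + eps * (q - p)) * mol (p, q))) = 0" by simp
  qed simp
  finally show ?thesis by (simp add: rescaled_def)
qed

lemma rescaled_0:
  assumes mol: "continuous_on UNIV mol" "\<And>p q. mol (p, q) \<noteq> 0 \<Longrightarrow> \<bar>p\<bar> < R \<and> \<bar>q\<bar> < R" and one: "integral UNIV mol = 1"
  shows "rescaled R \<psi> mol H (0, t) = H (0, t) * \<psi> t"
proof -
  have "1 = integral (cbox (-R, -R) (R, R)) mol"
    unfolding one[symmetric]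
  proof (rule integral_restrict_support)
    fix z :: "real \<times> real" assume "z \<notin> cbox (-R, -R) (R, R)"
    then show "mol z = 0" using mol(2)[of "fst z" "snd z"] by (cases z) (force simp: cbox_Pair_eq)
  qed simp
  also have "\<dots> = integral {-R..R} (\<lambda>p. integral {-R..R} (\<lambda>q. mol (p, q)))"
    by (rule integral_cbox_prod(1)[OF mol(1)])
  finally show ?thesis by (simp add: rescaled_def mult.assoc[symmetric])
qed

lemma tendsto_at_right_0:
  fixes f :: "real \<Rightarrow> complex"
  assumes "continuous_on UNIV f" "\<And>e. 0 < e \<Longrightarrow> e \<le> 1 \<Longrightarrow> g e = f e"
  shows "(g \<longlongrightarrow> f 0) (at_right 0)"
proof -
  have "(f \<longlongrightarrow> f 0) (at_right 0)"
    using assms(1) by (simp add: continuous_on_eq_continuous_at isCont_def filterlim_at_split)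
  moreover have "\<forall>\<^sub>F e in at_right 0. f e = g e"
    using assms(2) by (auto simp: eventually_at_right_field intro!: exI[of _ 1])
  ultimately show ?thesis by (rule Lim_transform_eventually)
qed

lemma mol_psi_box:
  assumes "test2 mol" "test1 \<psi>"
  obtains R where "R > 0" "\<And>p q. mol (p, q) \<noteq> 0 \<Longrightarrow> \<bar>p\<bar> < R \<and> \<bar>q\<bar> < R" "\<And>s. \<psi> s \<noteq> 0 \<Longrightarrow> \<bar>s\<bar> < R"
proof -
  obtain R1 where R1: "R1 > 0" "\<And>p q. mol (p, q) \<noteq> 0 \<Longrightarrow> \<bar>p\<bar> < R1 \<and> \<bar>q\<bar> < R1"
    by (rule test2_box[OF assms(1)], rule that)
  obtain R2 where R2: "R2 > 0" "\<And>s. \<psi> s \<noteq> 0 \<Longrightarrow> \<bar>s\<bar> < R2"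
    by (rule test1_box[OF assms(2)], rule that)
  show ?thesis
  proof (rule that[of "max R1 R2"])
    show "\<bar>p\<bar> < max R1 R2 \<and> \<bar>q\<bar> < max R1 R2" if "mol (p, q) \<noteq> 0" for p q
      using R1(2)[OF that] by auto
    show "\<bar>s\<bar> < max R1 R2" if "\<psi> s \<noteq> 0" for s using R2(2)[OF that] by auto
  qed (use R1 in auto)
qed

lemma U_moll_tendsto:
  assumes H: "continuous_on UNIV H" and mol: "test2 mol" "integral UNIV mol = 1" and \<psi>: "test1 \<psi>"
  shows "((\<lambda>eps. U H (moll mol \<psi> eps)) \<longlongrightarrow> integral {0..} (\<lambda>t. H (0, t) * \<psi> t)) (at_right 0)"
proof -
  obtain R where R: "R > 0" "\<And>p q. mol (p, q) \<noteq> 0 \<Longrightarrow> \<bar>p\<bar> < R \<and> \<bar>q\<bar> < R" "\<And>s. \<psi> s \<noteq> 0 \<Longrightarrow> \<bar>s\<bar> < R"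
    by (rule mol_psi_box[OF mol(1) \<psi>], rule that)
  note smol = test2_smooth[OF mol(1)] and s\<psi> = test1_smooth[OF \<psi>]
  note cr = continuous_rescaled[OF H smooth_continuous[OF s\<psi>] smooth_continuous[OF smol], of R]
  \<comment> \<open>The mollified test functions live in |x|, |t| < 2 R, and \<open>U_box\<close>
    doubles this.\<close>
  let ?S = "4 * R"
  let ?f = "\<lambda>e. integral (cbox 0 ?S) (\<lambda>t. rescaled R \<psi> mol H (e, t))"
  have cf: "continuous_on UNIV ?f"
    by (rule continuous_on_integral) (simp add: cr)
  have eq: "U H (moll mol \<psi> e) = ?f e" if e: "0 < e" "e \<le> 1" for e
  proof -
    have sm: "smooth (moll mol \<psi> e)" by (rule smooth_moll[OF smol s\<psi> R(3)])
    have "U H (moll mol \<psi> e) = integral (cbox (- ?S, 0) (?S, ?S)) (\<lambda>z. H z * moll mol \<psi> e (shear z))"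
    proof (rule U_box[of _ "2 * R"])
      show "\<bar>x\<bar> < 2 * R \<and> \<bar>t\<bar> < 2 * R" if "moll mol \<psi> e (x, t) \<noteq> 0" for x t
        using moll_nonzero[OF e R(2,3) that] R(1) by auto
    qed simp
    also have "\<dots> = integral {0..?S} (\<lambda>t. integral {-?S..?S} (\<lambda>x. H (x, t) * moll mol \<psi> e (x, x + t)))"
      by (subst integral_cbox_prod(2))
        (intro continuous_intros H continuous_on_shear smooth_continuous sm, simp add: shear_def)
    also have "\<dots> = ?f e"
      using R(1) by (simp add: moll_line_integral[OF e smol R(2) s\<psi> R(3) H])
    finally show ?thesis .
  qed
  have "?f 0 = integral {0..?S} (\<lambda>t. H (0, t) * \<psi> t)"
    by (simp add: rescaled_0[OF smooth_continuous[OF smol] R(2) mol(2)])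
  also have "\<dots> = integral {0..} (\<lambda>t. H (0, t) * \<psi> t)"
  proof (rule integral_restrict_support[symmetric])
    fix t assume "t \<in> {0..}" "t \<notin> {0..?S}"
    then show "H (0, t) * \<psi> t = 0" using R(3)[of t] R(1) by force
  qed auto
  finally show ?thesis using tendsto_at_right_0[OF cf eq] by simp
qed

text \<open>\<open>U_pdx\<close> splits d_x u into the layer on the front, whose mollification tends
  to H(0, 0) \<psi>(0) = \<psi>(0), and a regular part whose trace vanishes by the Neumann
  condition.\<close>

lemma U_pdx_moll_tendsto:
  assumes H: "smooth H" and mol: "test2 mol" "integral UNIV mol = 1" and \<psi>: "test1 \<psi>"
    and one: "H (0, 0) = 1" and neumann: "\<And>t. dd (1, 0) H (0, t) = dd (0, 1) H (0, t)"
  shows "((\<lambda>eps. - U H (pdx (moll mol \<psi> eps))) \<longlongrightarrow> - \<psi> 0) (at_right 0)"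
proof -
  obtain R where R: "R > 0" "\<And>p q. mol (p, q) \<noteq> 0 \<Longrightarrow> \<bar>p\<bar> < R \<and> \<bar>q\<bar> < R" "\<And>s. \<psi> s \<noteq> 0 \<Longrightarrow> \<bar>s\<bar> < R"
    by (rule mol_psi_box[OF mol(1) \<psi>], rule that)
  note smol = test2_smooth[OF mol(1)] and s\<psi> = test1_smooth[OF \<psi>]
  note cH = smooth_continuous[OF H]
  \<comment> \<open>\<open>3 * R\<close> because the supports lie in closed boxes of half widths R
    and 2 R, while \<open>U_pdx\<close> asks for strict bounds.\<close>
  let ?H' = "\<lambda>z. dd (1, 0) H z - dd (0, 1) H z" and ?S = "2 * (3 * R)"
  let ?f = "\<lambda>e. rescaled R \<psi> mol H (e, 0)"
  have cf: "continuous_on UNIV ?f"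
    by (rule continuous_on_slices(1)[OF continuous_rescaled[OF cH smooth_continuous[OF s\<psi>] smooth_continuous[OF smol]]])
  have eq: "integral {-?S..?S} (\<lambda>x. H (x, 0) * moll mol \<psi> e (x, x)) = ?f e" if e: "0 < e" "e \<le> 1" for e
    using moll_line_integral[OF e smol R(2) s\<psi> R(3) cH, of ?S 0] R(1) by simp
  have 1: "((\<lambda>e. integral {-?S..?S} (\<lambda>x. H (x, 0) * moll mol \<psi> e (x, x))) \<longlongrightarrow> ?f 0) (at_right 0)"
    by (rule tendsto_at_right_0[OF cf eq])
  have f0: "?f 0 = \<psi> 0"
    using rescaled_0[OF smooth_continuous[OF smol] R(2) mol(2), of \<psi> H 0] one by simp
  have "((\<lambda>e. U ?H' (moll mol \<psi> e)) \<longlongrightarrow> integral {0..} (\<lambda>t. ?H' (0, t) * \<psi> t)) (at_right 0)"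
    by (rule U_moll_tendsto[OF smooth_continuous mol \<psi>]) (intro smooth_diff smooth_dd H)
  then have 2: "((\<lambda>e. U ?H' (moll mol \<psi> e)) \<longlongrightarrow> 0) (at_right 0)"
    by (simp add: neumann)
  have "((\<lambda>e. - (integral {-?S..?S} (\<lambda>x. H (x, 0) * moll mol \<psi> e (x, x)) - U ?H' (moll mol \<psi> e))) \<longlongrightarrow> - (\<psi> 0 - 0)) (at_right 0)"
    using 1 2 unfolding f0 by (intro tendsto_intros)
  moreover have "- (integral {-?S..?S} (\<lambda>x. H (x, 0) * moll mol \<psi> e (x, x)) - U ?H' (moll mol \<psi> e)) = - U H (pdx (moll mol \<psi> e))"
    if e: "0 < e" "e \<le> 1" for e
  proof -
    have "U H (pdx (moll mol \<psi> e)) = integral {-?S..?S} (\<lambda>x. H (x, 0) * moll mol \<psi> e (x, x)) - U ?H' (moll mol \<psi> e)"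
    proof (rule U_pdx[OF H test2_moll(1)[OF e smol R(2) s\<psi> R(3)], of "3 * R"])
      show "\<bar>x\<bar> < 3 * R \<and> \<bar>t\<bar> < 3 * R" if "(x, t) \<in> tsupport (moll mol \<psi> e)" for x t
        using subsetD[OF test2_moll(2)[OF e smol R(2) s\<psi> R(3)] that] R(1) by auto
    qed (use R(1) in auto)
    then show ?thesis by simp
  qed
  then have "\<forall>\<^sub>F e in at_right 0. - (integral {-?S..?S} (\<lambda>x. H (x, 0) * moll mol \<psi> e (x, x)) - U ?H' (moll mol \<psi> e)) = - U H (pdx (moll mol \<psi> e))"
    by (auto simp: eventually_at_right_field intro!: exI[of _ 1])
  ultimately show ?thesis using Lim_transform_eventually by fastforce
qed

text \<open>A = 1 near x = 0, so the factor 1 / sqrt A is invisible in the boundary values.\<close>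

lemma H0_boundary:
  assumes A: "admissible A" and y: "goursat V y"
  shows "H0 A y (0, t) = y (t, t)" "H0 A y (0, 0) = 1" "dd (1, 0) (H0 A y) (0, t) = dd (0, 1) (H0 A y) (0, t)"
proof -
  obtain xm where xm: "0 < xm" "\<And>x. x < xm \<Longrightarrow> A x = 1" by (rule epot_near_0[OF A], rule that)
  have a: "inverse (sqA A x) = 1" if "x < xm" for x using xm(2)[OF that] by (simp add: sqA_def)
  show "H0 A y (0, t) = y (t, t)" "H0 A y (0, 0) = 1"
    using a[of 0] xm(1) goursat_axis[OF y] by (simp_all add: H0_def yhat_def)
  have s: "smooth (\<lambda>z::real \<times> real. inverse (sqA A (fst z)))" "smooth (yhat y)"
    by (intro smooth_fst smooth_inverse smooth_sqA sqA_nonzero smooth_yhat A goursat_smooth[OF y])+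
  have "dd h (\<lambda>z::real \<times> real. inverse (sqA A (fst z))) (0, t) = 0" for h
  proof (rule dd_eq_0_if_const_on_open[of "{z. fst z < xm}" _ _ 1])
    show "open {z::real \<times> real. fst z < xm}" by (intro open_Collect_less continuous_intros)
  qed (use a xm in auto)
  then show "dd (1, 0) (H0 A y) (0, t) = dd (0, 1) (H0 A y) (0, t)"
    unfolding H0_def[abs_def] by (simp add: dd_mult[OF s] yhat_front[OF y])
qed

lemma NtD_minus_delta:
  assumes A: "admissible A" and y: "goursat (epot A) y"
  shows "NtD A (\<lambda>\<psi>. - \<psi> 0) (\<lambda>\<psi>. integral {0..} (\<lambda>t. y (t, t) * \<psi> t))"
  unfolding NtD_def
\<comment> \<open>t0 = -1, with t1 = 0 below: the datum sits at t = 0, and within x > 0 the solution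
  lives in t \<ge> x > 0.\<close>
proof (rule exI[of _ "U (H0 A y)"], rule exI[of _ "-1"], intro conjI)
  have sH: "smooth (H0 A y)" by (rule smooth_H0[OF A goursat_smooth[OF y]])
  show "\<exists>t1>-1. \<forall>\<psi>. test1 \<psi> \<and> tsupport \<psi> \<subseteq> {..<t1} \<longrightarrow> - \<psi> 0 = (0::complex)"
    using in_tsupport by (intro exI[of _ 0]) force
  show "dist2 (U (H0 A y))" by (rule dist2_U[OF smooth_continuous[OF sH]])
  show "\<forall>(z, \<xi>) \<in> WF (U (H0 A y)). (snd \<xi>)\<^sup>2 = (fst \<xi>)\<^sup>2" using WF_U[OF sH] by auto
  show "wave_A_zero A (U (H0 A y))" by (rule wave_A_zero_U[OF A y])
  show "vanishes_on (U (H0 A y)) ({0<..} \<times> {..<-1})"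
    unfolding vanishes_on_def
  proof (intro allI impI)
    fix \<phi> assume \<phi>: "test2 \<phi> \<and> tsupport \<phi> \<subseteq> {0<..} \<times> {..<-1}"
    have Z: "\<phi> (shear z) = 0" if "z \<in> UNIV \<times> {0..}" for z
    proof (rule ccontr)
      assume "\<phi> (shear z) \<noteq> 0"
      then have "shear z \<in> {0<..} \<times> {..<-1}" using \<phi> in_tsupport by blast
      then show False using that by (auto simp: shear_def)
    qed
    have "U (H0 A y) \<phi> = integral (UNIV \<times> {0..}) (\<lambda>z::real \<times> real. 0)"
      unfolding U_def by (rule integral_cong) (simp add: Z)
    then show "U (H0 A y) \<phi> = 0" by simp
  qed
  show "is_trace (\<lambda>\<phi>. - U (H0 A y) (pdx \<phi>)) (\<lambda>\<psi>. - \<psi> 0)"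
    unfolding is_trace_def using U_pdx_moll_tendsto[OF sH _ _ _ H0_boundary(2,3)[OF A y]] by blast
  show "is_trace (U (H0 A y)) (\<lambda>\<psi>. integral {0..} (\<lambda>t. y (t, t) * \<psi> t))"
    unfolding is_trace_def using U_moll_tendsto[OF smooth_continuous[OF sH]] by (simp add: H0_boundary[OF A y])
qed

lemma cdist1_minus_delta: "cdist1 (\<lambda>\<psi>. - \<psi> 0)"
  unfolding cdist1_def dist1_def
proof (intro conjI allI impI)
  show "- (a * \<phi> 0 + b * \<psi> 0) = a * - \<phi> 0 + b * - \<psi> 0" for \<phi> \<psi> :: "real \<Rightarrow> complex" and a b
    by simp
  fix K :: "real set"
  have "norm (- \<phi> 0) \<le> 1 * (\<Sum>k\<le>0. Sup (range (\<lambda>x. norm ((vd ^^ k) \<phi> x))))" if t: "test1 \<phi>" for \<phi> :: "real \<Rightarrow> complex"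
  proof -
    obtain R where R: "R > 0" "\<And>s. \<phi> s \<noteq> 0 \<Longrightarrow> \<bar>s\<bar> < R" by (rule test1_box[OF t], rule that)
    have "bounded (\<phi> ` {-R..R})"
      by (intro compact_imp_bounded compact_continuous_image smooth_continuous test1_smooth t compact_Icc)
    then obtain B where B: "B > 0" "\<forall>z \<in> \<phi> ` {-R..R}. norm z \<le> B" unfolding bounded_pos by auto
    have "norm (\<phi> x) \<le> B" for x
      using B R(2)[of x] by (cases "\<phi> x = 0") (auto simp: abs_less_iff)
    then have "bdd_above (range (\<lambda>x. norm (\<phi> x)))" unfolding bdd_above_def by blast
    then have "norm (\<phi> 0) \<le> Sup (range (\<lambda>x. norm (\<phi> x)))" by (intro cSup_upper) auto
    then show ?thesis by simp
  qed
  then show "\<exists>C N. \<forall>\<phi>. test1 \<phi> \<and> tsupport \<phi> \<subseteq> K \<longrightarrow>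
        norm (- \<phi> 0 :: complex) \<le> C * (\<Sum>k\<le>N. Sup (range (\<lambda>x. norm ((vd ^^ k) \<phi> x))))" by blast
  show "\<exists>K. compact K \<and> (\<forall>\<psi>. test1 \<psi> \<and> tsupport \<psi> \<inter> K = {} \<longrightarrow> - \<psi> (0::real) = (0::complex))"
    using in_tsupport by (intro exI[of _ "{0}"]) force
qed

section \<open>Solutions of the dual problem\<close>

lemma dd_zero_pair: "smooth f \<Longrightarrow> dd (0::real, 0::real) f x = 0"
  using dd_zero_dir[of f x] by (simp add: zero_prod_def)

lemma smooth_integral_Icc:
  fixes f :: "'a::euclidean_space \<times> real \<Rightarrow> complex"
  assumes "smooth f"
  shows "smooth (\<lambda>x. integral {a..b} (\<lambda>s. f (x, s)))"
    "dd h (\<lambda>x. integral {a..b} (\<lambda>s. f (x, s))) x = integral {a..b} (\<lambda>s. dd (h, 0) f (x, s))"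
  using smooth_integral[OF assms, of a b] dd_integral[OF assms, of h a b x] by simp_all

text \<open>Weighted time translates of a kernel. An s-derivative falls on \<psi> and an
  x-derivative on k; integration by parts in \<tau> trades the former for a \<tau>-derivative of
  k.\<close>

definition PI :: "real \<Rightarrow> (real \<Rightarrow> complex) \<Rightarrow> (real \<times> real \<Rightarrow> complex) \<Rightarrow> real \<times> real \<Rightarrow> complex" where
  "PI L \<psi> k w = integral {0..L} (\<lambda>\<tau>. \<psi> (fst w + \<tau>) * k (snd w, \<tau>))"

lemma PI_kernel:
  fixes \<psi> :: "real \<Rightarrow> complex" and k :: "real \<times> real \<Rightarrow> complex"
  assumes \<psi>: "smooth \<psi>" and k: "smooth k"
  defines "F \<equiv> \<lambda>v::(real \<times> real) \<times> real. \<psi> (fst (fst v) + snd v) * k (snd (fst v), snd v)"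
  shows "smooth F" "dd ((1, 0), 0) F (w, \<tau>) = dd 1 \<psi> (fst w + \<tau>) * k (snd w, \<tau>)"
    "dd ((0, 1), 0) F (w, \<tau>) = \<psi> (fst w + \<tau>) * dd (1, 0) k (snd w, \<tau>)"
proof -
  have l1: "bounded_linear (\<lambda>v::(real \<times> real) \<times> real. fst (fst v) + snd v)"
    and l2: "bounded_linear (\<lambda>v::(real \<times> real) \<times> real. (snd (fst v), snd v))"
    by (rule bounded_linearI_euclidean; simp add: algebra_simps)+
  note s = smooth_compose_linear[OF l1 \<psi>] smooth_compose_linear[OF l2 k]
  show "smooth F" unfolding F_def by (rule smooth_mult[OF s])
  show "dd ((1, 0), 0) F (w, \<tau>) = dd 1 \<psi> (fst w + \<tau>) * k (snd w, \<tau>)"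
    "dd ((0, 1), 0) F (w, \<tau>) = \<psi> (fst w + \<tau>) * dd (1, 0) k (snd w, \<tau>)"
    unfolding F_def
    by (simp_all add: dd_mult[OF s] dd_compose_linear[OF l1 \<psi>] dd_compose_linear[OF l2 k] dd_zero_pair[OF k] \<psi>)
qed

lemma smooth_PI: "smooth \<psi> \<Longrightarrow> smooth k \<Longrightarrow> smooth (PI L \<psi> k)"
  unfolding PI_def[abs_def] using smooth_integral_Icc(1)[OF PI_kernel(1)] by simp

lemma dd_PI:
  assumes "smooth \<psi>" "smooth k"
  shows "dd (1, 0) (PI L \<psi> k) = PI L (dd 1 \<psi>) k" "dd (0, 1) (PI L \<psi> k) = PI L \<psi> (dd (1, 0) k)"
  unfolding PI_def[abs_def]
  using smooth_integral_Icc(2)[OF PI_kernel(1)[OF assms], of _ 0 L] PI_kernel(2,3)[OF assms]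
  by (simp_all add: fun_eq_iff)

lemma PI_integrable:
  fixes \<psi> :: "real \<Rightarrow> complex" and k :: "real \<times> real \<Rightarrow> complex"
  assumes "smooth \<psi>" "smooth k"
  shows "(\<lambda>\<tau>. \<psi> (s + \<tau>) * k (x, \<tau>)) integrable_on {0..L}"
  by (intro integrable_continuous_interval continuous_intros
      continuous_on_compose2[OF smooth_continuous[OF assms(1), of UNIV]]
      continuous_on_compose2[OF smooth_continuous[OF assms(2), of UNIV]]) auto

lemma PI_by_parts:
  assumes \<psi>: "smooth \<psi>" and k: "smooth k" and L: "0 \<le> L"
  shows "PI L (dd 1 \<psi>) k (s, x) + PI L \<psi> (dd (0, 1) k) (s, x) = \<psi> (s + L) * k (x, L) - \<psi> s * k (x, 0)"
proof -
  have D\<psi>: "((\<lambda>\<tau>. \<psi> (s + \<tau>)) has_vector_derivative dd 1 \<psi> (s + \<tau>)) (at \<tau> within {0..L})" for \<tau>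
    using smooth_line_derivative[OF \<psi>, of s 1] by simp
  have "((\<lambda>\<tau>. \<psi> (s + \<tau>) * k (x, \<tau>)) has_vector_derivative
      \<psi> (s + \<tau>) * dd (0, 1) k (x, \<tau>) + dd 1 \<psi> (s + \<tau>) * k (x, \<tau>)) (at \<tau> within {0..L})" for \<tau>
    by (rule has_vector_derivative_mult[OF D\<psi> has_vector_derivative_slice(2)[OF k]])
  then have "((\<lambda>\<tau>. \<psi> (s + \<tau>) * dd (0, 1) k (x, \<tau>) + dd 1 \<psi> (s + \<tau>) * k (x, \<tau>)) has_integral
      \<psi> (s + L) * k (x, L) - \<psi> (s + 0) * k (x, 0)) {0..L}"
    by (intro fundamental_theorem_of_calculus L)
  then have J: "integral {0..L} (\<lambda>\<tau>. \<psi> (s + \<tau>) * dd (0, 1) k (x, \<tau>) + dd 1 \<psi> (s + \<tau>) * k (x, \<tau>))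
      = \<psi> (s + L) * k (x, L) - \<psi> s * k (x, 0)"
    by (simp add: integral_unique)
  have "PI L (dd 1 \<psi>) k (s, x) + PI L \<psi> (dd (0, 1) k) (s, x) = PI L \<psi> (dd (0, 1) k) (s, x) + PI L (dd 1 \<psi>) k (s, x)"
    by (rule add.commute)
  also have "\<dots> = integral {0..L} (\<lambda>\<tau>. \<psi> (s + \<tau>) * dd (0, 1) k (x, \<tau>) + dd 1 \<psi> (s + \<tau>) * k (x, \<tau>))"
    unfolding PI_def fst_conv snd_conv
    by (rule integral_add[symmetric, OF PI_integrable[OF \<psi> smooth_dd[OF k]] PI_integrable[OF smooth_dd[OF \<psi>] k]])
  also note J
  finally show ?thesis .
qed

text \<open>In the coordinates \<open>(s, x) = (t + x, x)\<close>; \<open>L\<close> truncates an integral over \<open>{0..}\<close>.\<close>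
definition Zfun :: "real \<Rightarrow> (real \<Rightarrow> complex) \<Rightarrow> (real \<times> real \<Rightarrow> complex) \<Rightarrow> real \<times> real \<Rightarrow> complex" where
  "Zfun L \<psi> y = PI L \<psi> (yhat y)"

lemma smooth_Zfun: "smooth \<psi> \<Longrightarrow> smooth y \<Longrightarrow> smooth (Zfun L \<psi> y)"
  unfolding Zfun_def by (intro smooth_PI smooth_yhat)

text \<open>Z_sx is the integral of \<psi>' k_x, hence minus that of \<psi> k_(x \<tau>): the
  boundary terms vanish since \<psi>(s + L) = 0 and k_x = 0 on the front. The equation of k =
  \<open>yhat y\<close> then gives that of Z.\<close>

lemma Zfun_equation:
  assumes y: "goursat V y" and \<psi>: "smooth \<psi>" and L: "0 \<le> L" and s: "\<psi> (s + L) = 0"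
  shows "dd (0, 1) (dd (1, 0) (Zfun L \<psi> y)) (s, x) = dd (1, 0) (dd (0, 1) (Zfun L \<psi> y)) (s, x)"
    "2 * dd (0, 1) (dd (1, 0) (Zfun L \<psi> y)) (s, x) + dd (0, 1) (dd (0, 1) (Zfun L \<psi> y)) (s, x) = V x * Zfun L \<psi> y (s, x)"
proof -
  let ?k = "yhat y"
  have k: "smooth ?k" by (rule smooth_yhat[OF goursat_smooth[OF y]])
  note sm = \<psi> k smooth_dd[OF \<psi>] smooth_dd[OF k]
  have 1: "dd (0, 1) (dd (1, 0) (Zfun L \<psi> y)) = PI L (dd 1 \<psi>) (dd (1, 0) ?k)"
    "dd (1, 0) (dd (0, 1) (Zfun L \<psi> y)) = PI L (dd 1 \<psi>) (dd (1, 0) ?k)"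
    "dd (0, 1) (dd (0, 1) (Zfun L \<psi> y)) = PI L \<psi> (dd (1, 0) (dd (1, 0) ?k))"
    unfolding Zfun_def by (simp_all add: dd_PI sm)
  then show "dd (0, 1) (dd (1, 0) (Zfun L \<psi> y)) (s, x) = dd (1, 0) (dd (0, 1) (Zfun L \<psi> y)) (s, x)" by simp
  have 2: "PI L (dd 1 \<psi>) (dd (1, 0) ?k) (s, x) = - PI L \<psi> (dd (0, 1) (dd (1, 0) ?k)) (s, x)"
    using PI_by_parts[OF \<psi> smooth_dd[OF k, of "(1, 0)"] L, of s x] s yhat_front(2)[OF y, of x]
    by (simp add: eq_neg_iff_add_eq_0)
  have i: "(\<lambda>\<tau>. \<psi> (s + \<tau>) * f (x, \<tau>)) integrable_on {0..L}" if "smooth f" for f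
    by (rule PI_integrable[OF \<psi> that])
  have "PI L \<psi> (dd (1, 0) (dd (1, 0) ?k)) (s, x) - 2 * PI L \<psi> (dd (0, 1) (dd (1, 0) ?k)) (s, x)
     = integral {0..L} (\<lambda>\<tau>. \<psi> (s + \<tau>) * dd (1, 0) (dd (1, 0) ?k) (x, \<tau>))
      - integral {0..L} (\<lambda>\<tau>. 2 * (\<psi> (s + \<tau>) * dd (0, 1) (dd (1, 0) ?k) (x, \<tau>)))"
    by (simp add: PI_def)
  also have "\<dots> = integral {0..L} (\<lambda>\<tau>. \<psi> (s + \<tau>) * dd (1, 0) (dd (1, 0) ?k) (x, \<tau>)
      - 2 * (\<psi> (s + \<tau>) * dd (0, 1) (dd (1, 0) ?k) (x, \<tau>)))"
    by (intro integral_diff[symmetric] integrable_on_mult_right i smooth_dd k)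
  also have "\<dots> = integral {0..L} (\<lambda>\<tau>. V x * (\<psi> (s + \<tau>) * ?k (x, \<tau>)))"
  proof (rule integral_cong)
    fix \<tau>
    have "dd (1, 0) (dd (1, 0) ?k) (x, \<tau>) = 2 * dd (0, 1) (dd (1, 0) ?k) (x, \<tau>) + V x * ?k (x, \<tau>)"
      using yhat_equation[OF y, of "(x, \<tau>)"] by (simp add: algebra_simps)
    then show "\<psi> (s + \<tau>) * dd (1, 0) (dd (1, 0) ?k) (x, \<tau>) - 2 * (\<psi> (s + \<tau>) * dd (0, 1) (dd (1, 0) ?k) (x, \<tau>))
        = V x * (\<psi> (s + \<tau>) * ?k (x, \<tau>))"
      by (simp add: algebra_simps)
  qed
  also have "\<dots> = V x * Zfun L \<psi> y (s, x)" by (simp add: Zfun_def PI_def)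
  finally show "2 * dd (0, 1) (dd (1, 0) (Zfun L \<psi> y)) (s, x) + dd (0, 1) (dd (0, 1) (Zfun L \<psi> y)) (s, x)
      = V x * Zfun L \<psi> y (s, x)"
    unfolding 1 2 by simp
qed

text \<open>Z_s + Z_x is the x-derivative of Z(t + x, x), so Z has Neumann datum -\<psi>. It is the
  boundary term at \<tau> = 0, where k = 1.\<close>

lemma Zfun_axis:
  assumes y: "goursat V y" and \<psi>: "smooth \<psi>" and L: "0 \<le> L" and s: "\<psi> (s + L) = 0"
  shows "dd (0, 1) (Zfun L \<psi> y) (s, 0) = - \<psi> s - dd (1, 0) (Zfun L \<psi> y) (s, 0)"
proof -
  let ?k = "yhat y"
  have k: "smooth ?k" by (rule smooth_yhat[OF goursat_smooth[OF y]])
  have "PI L \<psi> (dd (1, 0) ?k) (s, 0) = PI L \<psi> (dd (0, 1) ?k) (s, 0)"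
    by (simp add: PI_def yhat_front(3)[OF y])
  moreover have "PI L (dd 1 \<psi>) ?k (s, 0) + PI L \<psi> (dd (0, 1) ?k) (s, 0) = - \<psi> s"
    using PI_by_parts[OF \<psi> k L, of s 0] s yhat_front(1)[OF y, of 0] by simp
  ultimately show ?thesis unfolding Zfun_def by (simp add: dd_PI \<psi> k algebra_simps)
qed

text \<open>Where \<open>V\<close> vanishes, \<open>(2 \<partial>\<^sub>s + \<partial>\<^sub>x) Z\<close> depends only on \<open>s\<close>, which gives d'Alembert's formula.\<close>
lemma Zfun_dAlembert:
  assumes y: "goursat V y" and \<psi>: "smooth \<psi>" and L: "0 \<le> L" and s: "\<And>s. s0 \<le> s \<Longrightarrow> \<psi> (s + L) = 0"
    and V: "\<And>x. \<bar>x\<bar> < xm \<Longrightarrow> V x = 0" and x: "0 \<le> x" "x < xm" and \<sigma>: "s0 \<le> \<sigma>"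
  defines "c \<equiv> \<lambda>s. 2 * dd (1, 0) (Zfun L \<psi> y) (s, 0) + dd (0, 1) (Zfun L \<psi> y) (s, 0)"
  shows "Zfun L \<psi> y (\<sigma> + 2 * x, x) = Zfun L \<psi> y (\<sigma>, 0) + (oi c (\<sigma> + 2 * x) - oi c \<sigma>) / 2"
proof -
  let ?Z = "Zfun L \<psi> y"
  have Z: "smooth ?Z" by (rule smooth_Zfun[OF \<psi> goursat_smooth[OF y]])
  have cc: "continuous_on UNIV c"
    unfolding c_def by (intro continuous_intros continuous_on_slices(1) smooth_continuous smooth_dd Z)
  have 1: "2 * dd (1, 0) ?Z (r, x') + dd (0, 1) ?Z (r, x') = c r" if "0 \<le> x'" "x' < xm" "s0 \<le> r" for r x'
  proof -
    let ?g = "\<lambda>x'. 2 * dd (1, 0) ?Z (r, x') + dd (0, 1) ?Z (r, x')"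
    have "(?g has_vector_derivative 0) (at v within {0..x'})" if v: "v \<in> {0..x'}" for v
    proof -
      have "(?g has_vector_derivative 2 * dd (0, 1) (dd (1, 0) ?Z) (r, v) + dd (0, 1) (dd (0, 1) ?Z) (r, v)) (at v within {0..x'})"
        by (intro has_vector_derivative_add has_vector_derivative_mult_right has_vector_derivative_slice(2) smooth_dd Z)
      moreover have "V v = 0" using V v \<open>x' < xm\<close> by auto
      ultimately show ?thesis using Zfun_equation(2)[OF y \<psi> L s[OF \<open>s0 \<le> r\<close>], of v] by simp
    qed
    then obtain d where "\<And>v. v \<in> {0..x'} \<Longrightarrow> ?g v = d"
      using has_vector_derivative_zero_constant[of "{0..x'}" ?g] by auto
    then have "?g x' = ?g 0" using \<open>0 \<le> x'\<close> by simp
    then show ?thesis by (simp add: c_def)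
  qed
  \<comment> \<open>The line (\<sigma> + 2 r, r) is t - x = \<sigma>, and 2 d_s + d_x equals d_t +
    d_x, the derivative along it. The argument t + x moves at speed 2 in r, hence the division by
    2.\<close>
  let ?h = "\<lambda>r. ?Z (\<sigma> + 2 * r, r) - oi c (\<sigma> + 2 * r) / 2"
  have "(?h has_vector_derivative 0) (at r within {0..x})" if r: "r \<in> {0..x}" for r
  proof -
    have "((\<lambda>r. ?Z ((\<sigma>, 0) + r *\<^sub>R (2, 1))) has_vector_derivative dd (2, 1) ?Z ((\<sigma>, 0) + r *\<^sub>R (2, 1))) (at r within {0..x})"
      by (rule smooth_line_derivative[OF Z])
    then have "((\<lambda>r. ?Z (\<sigma> + 2 * r, r)) has_vector_derivative c (\<sigma> + 2 * r)) (at r within {0..x})"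
      using 1[of r "\<sigma> + 2 * r"] r x \<sigma> by (simp add: dd_Pair[OF Z, of 2 1] scaleR_conv_of_real mult.commute)
    moreover have "((\<lambda>r. oi c (\<sigma> + 2 * r)) has_vector_derivative 2 *\<^sub>R c (\<sigma> + 2 * r)) (at r within {0..x})"
    proof -
      have "((\<lambda>r. \<sigma> + 2 * r) has_vector_derivative 2) (at r within {0..x})"
        by (auto intro!: derivative_eq_intros)
      from vector_diff_chain_within[OF this oi_has_vector_derivative[OF cc]] show ?thesis by (simp add: o_def)
    qed
    ultimately have "(?h has_vector_derivative c (\<sigma> + 2 * r) - (2 *\<^sub>R c (\<sigma> + 2 * r)) / 2) (at r within {0..x})"
      by (intro has_vector_derivative_diff has_vector_derivative_divide)
    then show ?thesis by (simp add: scaleR_conv_of_real)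
  qed
  then obtain d where d: "\<And>v. v \<in> {0..x} \<Longrightarrow> ?h v = d"
    using has_vector_derivative_zero_constant[of "{0..x}" ?h] by auto
  have "?h x = ?h 0" using d[of x] d[of 0] x by simp
  then show ?thesis by (simp add: algebra_simps diff_divide_distrib)
qed

section \<open>Mollification along a direction\<close>

text \<open>The average is one-sided: only points z - r v with 0 \<le> r \<le> e enter, so with v
  pointing in time an equation valid from some time on stays valid from e later on.\<close>

definition tmoll :: "real \<Rightarrow> 'a::euclidean_space \<Rightarrow> ('a \<Rightarrow> complex) \<Rightarrow> 'a \<Rightarrow> complex" where
  "tmoll e v F z = integral {0..1} (\<lambda>q. bump q * F (z - (e * q) *\<^sub>R v))"

lemma tmoll_kernel:
  fixes F :: "'a::euclidean_space \<Rightarrow> complex"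
  assumes F: "smooth F"
  shows "smooth (\<lambda>w::'a \<times> real. bump (snd w) * F (fst w - (e * snd w) *\<^sub>R v))"
    "dd (h, 0) (\<lambda>w::'a \<times> real. bump (snd w) * F (fst w - (e * snd w) *\<^sub>R v)) w = bump (snd w) * dd h F (fst w - (e * snd w) *\<^sub>R v)"
proof -
  have l: "bounded_linear (\<lambda>w::'a \<times> real. fst w - (e * snd w) *\<^sub>R v)"
    by (rule bounded_linearI_euclidean) (simp_all add: algebra_simps)
  have s: "smooth (\<lambda>w::'a \<times> real. bump (snd w))" "smooth (\<lambda>w::'a \<times> real. F (fst w - (e * snd w) *\<^sub>R v))"
    by (rule smooth_compose_linear[OF bounded_linear_snd smooth_bump] smooth_compose_linear[OF l F])+
  show "smooth (\<lambda>w::'a \<times> real. bump (snd w) * F (fst w - (e * snd w) *\<^sub>R v))" by (rule smooth_mult[OF s])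
  show "dd (h, 0) (\<lambda>w::'a \<times> real. bump (snd w) * F (fst w - (e * snd w) *\<^sub>R v)) w = bump (snd w) * dd h F (fst w - (e * snd w) *\<^sub>R v)"
    by (simp add: dd_mult[OF s] dd_compose_linear[OF l F] dd_compose_linear[OF bounded_linear_snd smooth_bump] smooth_bump)
qed

lemma smooth_tmoll: "smooth F \<Longrightarrow> smooth (tmoll e v F)"
  unfolding tmoll_def[abs_def] using smooth_integral_Icc(1)[OF tmoll_kernel(1)] by simp

lemma dd_tmoll: "smooth F \<Longrightarrow> dd h (tmoll e v F) = tmoll e v (dd h F)"
  unfolding tmoll_def[abs_def]
  using smooth_integral_Icc(2)[OF tmoll_kernel(1), of F h 0 1 e v] tmoll_kernel(2)[of F h e v]
  by (simp add: fun_eq_iff)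

lemma tmoll_cong:
  assumes "\<And>q. 0 \<le> q \<Longrightarrow> q \<le> 1 \<Longrightarrow> F (z - (e * q) *\<^sub>R v) = G (w - (e * q) *\<^sub>R v')"
  shows "tmoll e v F z = tmoll e v' G w"
  unfolding tmoll_def by (rule integral_cong) (use assms in simp)

lemma tmoll_integrable:
  assumes "smooth F"
  shows "(\<lambda>q. bump q * F (z - (e * q) *\<^sub>R v)) integrable_on {0..1}"
  by (intro integrable_continuous_interval continuous_intros smooth_continuous[OF smooth_bump]
      continuous_on_compose2[OF smooth_continuous[OF assms, of UNIV]]) auto

lemma tmoll_add:
  assumes "smooth F" "smooth G"
  shows "tmoll e v (\<lambda>z. F z + G z) z = tmoll e v F z + tmoll e v G z"
  unfolding tmoll_def distrib_left by (intro integral_add tmoll_integrable assms)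

lemma tmoll_diff:
  assumes "smooth F" "smooth G"
  shows "tmoll e v (\<lambda>z. F z - G z) z = tmoll e v F z - tmoll e v G z"
  unfolding tmoll_def right_diff_distrib by (intro integral_diff tmoll_integrable assms)

text \<open>V does not depend on time, so averaging in time commutes with the operator.\<close>

lemma schr_tmoll:
  assumes F: "smooth F" and z: "\<And>q. 0 \<le> q \<Longrightarrow> q \<le> 1 \<Longrightarrow> schr V F (x, t - e * q) = 0"
  shows "schr V (tmoll e (0, 1) F) (x, t) = 0"
proof -
  let ?m = "tmoll e (0, 1)"
  have "schr V (?m F) (x, t) = ?m (\<lambda>w. dd (0, 1) (dd (0, 1) F) w - dd (1, 0) (dd (1, 0) F) w) (x, t) + V x * ?m F (x, t)"
    unfolding schr_def by (simp add: dd_tmoll F smooth_dd tmoll_diff)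
  also have "V x * ?m F (x, t) = ?m (\<lambda>w. V x * F w) (x, t)"
    unfolding tmoll_def by (simp only: mult.left_commute[of _ "V x"] integral_mult_right)
  also have "?m (\<lambda>w. dd (0, 1) (dd (0, 1) F) w - dd (1, 0) (dd (1, 0) F) w) (x, t) + \<dots>
      = ?m (\<lambda>w. dd (0, 1) (dd (0, 1) F) w - dd (1, 0) (dd (1, 0) F) w + V x * F w) (x, t)"
    by (intro tmoll_add[symmetric] smooth_diff smooth_mult smooth_dd smooth_const F)
  also have "\<dots> = integral {0..1} (\<lambda>q::real. 0)"
    unfolding tmoll_def by (rule integral_cong) (use z in \<open>simp add: schr_def\<close>)
  finally show ?thesis by simp
qed

lemma tmoll_eq_convolution:
  assumes a: "smooth a" "\<And>s. a s \<noteq> 0 \<Longrightarrow> \<bar>s\<bar> < R" and e: "0 < e"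
  shows "integral UNIV (\<lambda>s. a s * bump ((\<sigma> - s) / e)) = complex_of_real e * tmoll e 1 a \<sigma>"
proof -
  let ?f = "\<lambda>s. a s * bump ((\<sigma> - s) / e)"
  have "integral UNIV ?f = \<bar>- e\<bar> *\<^sub>R integral UNIV (\<lambda>q. ?f (\<sigma> + (- e) * q))"
  proof (rule integral_UNIV_affine)
    show "continuous_on UNIV ?f"
      using e by (intro continuous_intros smooth_continuous[OF a(1)] continuous_on_compose2[OF smooth_continuous[OF smooth_bump, of UNIV]]) auto
    show "?f s = 0" if "s \<notin> {-R..R}" for s using a(2)[of s] that by force
  qed (use e in simp)
  also have "(\<lambda>q. ?f (\<sigma> + (- e) * q)) = (\<lambda>q. bump q * a (\<sigma> - (e * q) *\<^sub>R 1))"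
    using e by (simp add: fun_eq_iff)
  also have "integral UNIV \<dots> = integral {0..1} \<dots>"
    by (rule integral_restrict_support) (auto simp: bump_0)
  finally show ?thesis using e by (simp add: tmoll_def scaleR_conv_of_real)
qed

section \<open>Sheared mollifiers\<close>

text \<open>At p = - x / e and q = (s - t) / e the factors become bump (x / e - 1) and bump ((t - sg
  x - s) / e). The mollified test function is thus a function of x supported in e \<le> x \<le> 2 e,
  times one of t - sg x: a travelling wave, to the right or to the left according to
  \<open>sg\<close>.\<close>

definition molm :: "real \<Rightarrow> real \<times> real \<Rightarrow> complex" where
  "molm sg z = bump (- fst z - 1) * bump (sg * fst z - snd z)"

lemma smooth_bump_affine: "smooth (\<lambda>x. bump (c * x + d))"
  by (rule smooth_affine_real[OF smooth_bump])

lemma smooth_molm: "smooth (molm sg)"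
proof -
  have l: "bounded_linear (\<lambda>z::real \<times> real. sg * fst z - snd z)"
    by (rule bounded_linearI_euclidean) (simp_all add: algebra_simps)
  have "smooth (\<lambda>x. bump (- x - 1))" using smooth_bump_affine[of "-1" "-1"] by simp
  from smooth_fst[OF this] show ?thesis
    unfolding molm_def[abs_def] by (intro smooth_mult smooth_compose_linear[OF l smooth_bump])
qed

lemma molm_nonzero:
  assumes "sg \<in> {1, -1}" "molm sg (p, q) \<noteq> 0"
  shows "-2 \<le> p \<and> p \<le> -1 \<and> -3 \<le> q \<and> q \<le> 2"
proof -
  have "- p - 1 \<in> {0..1}" "sg * p - q \<in> {0..1}"
    using assms(2) bump_0[of "- p - 1"] bump_0[of "sg * p - q"] by (auto simp: molm_def simp del: atLeastAtMost_iff)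
  then show ?thesis using assms(1) by auto
qed

lemma test2_molm: "sg \<in> {1, -1} \<Longrightarrow> test2 (molm sg)"
  by (rule test2I(1)[OF smooth_molm, of _ "-2" "-1" "-3" 2]) (use molm_nonzero in blast)

lemma integral_bump_reflect:
  assumes "a \<le> c - 1" "c \<le> b"
  shows "integral {a..b} (\<lambda>q. bump (c - q)) = 1"
proof -
  have "integral {a..b} (\<lambda>q. bump (c - q)) = integral UNIV (\<lambda>q. bump (c - q))"
    by (rule integral_restrict_support[symmetric]) (use assms in \<open>auto intro!: bump_0\<close>)
  moreover have "integral UNIV bump = \<bar>- 1\<bar> *\<^sub>R integral UNIV (\<lambda>q. bump (c + (- 1) * q))"
    by (rule integral_UNIV_affine[of _ 1]) (auto intro!: bump_0 smooth_continuous smooth_bump)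
  moreover have "integral UNIV bump = integral {0..1} bump"
    by (rule integral_restrict_support) (auto simp: bump_0)
  ultimately show ?thesis by (simp add: integral_bump)
qed

lemma integral_molm:
  assumes sg: "sg \<in> {1, -1}"
  shows "integral UNIV (molm sg) = 1"
proof -
  have "integral UNIV (molm sg) = integral (cbox (-3, -3) (3, 3)) (molm sg)"
  proof (rule integral_restrict_support)
    fix z :: "real \<times> real" assume "z \<notin> cbox (-3, -3) (3, 3)"
    then show "molm sg z = 0" using molm_nonzero[OF sg, of "fst z" "snd z"] by (cases z) (force simp: cbox_Pair_eq)
  qed simp
  also have "\<dots> = integral {-3..3} (\<lambda>p. integral {-3..3} (\<lambda>q. molm sg (p, q)))"
    by (rule integral_cbox_prod(1)[OF smooth_continuous[OF smooth_molm]])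
  also have "(\<lambda>p. integral {-3..3} (\<lambda>q. molm sg (p, q))) = (\<lambda>p. bump (- 1 - p))"
  proof
    fix p
    have "integral {-3..3} (\<lambda>q. molm sg (p, q)) = bump (- p - 1) * integral {-3..3} (\<lambda>q. bump (sg * p - q))"
      by (simp only: molm_def fst_conv snd_conv integral_mult_right)
    also have "bump (- p - 1) * integral {-3..3} (\<lambda>q. bump (sg * p - q)) = bump (- p - 1)"
    proof (cases "- p - 1 \<in> {0..1}")
      case True
      then have "integral {-3..3} (\<lambda>q. bump (sg * p - q)) = 1"
        using sg by (intro integral_bump_reflect) auto
      then show ?thesis by simp
    qed (simp add: bump_0)
    also have "bump (- p - 1) = bump (- 1 - p)" by (rule arg_cong[of _ _ bump]) simp
    finally show "integral {-3..3} (\<lambda>q. molm sg (p, q)) = bump (- 1 - p)" .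
  qed
  also have "integral {-3..3} \<dots> = 1" by (rule integral_bump_reflect) auto
  finally show ?thesis .
qed

definition kcut :: "real \<Rightarrow> real \<Rightarrow> complex" where
  "kcut e x = bump (x / e - 1) / complex_of_real e"

lemma moll_molm:
  assumes a: "smooth a" "\<And>s. a s \<noteq> 0 \<Longrightarrow> \<bar>s\<bar> < R" and e: "0 < e"
  shows "moll (molm sg) a e (x, t) = kcut e x * tmoll e 1 a (t - sg * x)"
proof -
  have "moll (molm sg) a e (x, t) = integral UNIV (\<lambda>s. (bump (x / e - 1) / complex_of_real (e\<^sup>2)) * (a s * bump (((t - sg * x) - s) / e)))"
    unfolding moll_def prod.case
  proof (rule arg_cong[of _ _ "integral UNIV"], rule ext)
    fix s
    have "sg * (- x / e) - (s - t) / e = ((t - sg * x) - s) / e" using e by (simp add: field_simps)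
    then show "a s * molm sg (- x / e, (s - t) / e) / complex_of_real (e\<^sup>2)
        = (bump (x / e - 1) / complex_of_real (e\<^sup>2)) * (a s * bump (((t - sg * x) - s) / e))"
      by (simp add: molm_def)
  qed
  then show ?thesis
    using tmoll_eq_convolution[OF a e, of "t - sg * x"] e by (simp add: kcut_def power2_eq_square)
qed

text \<open>For e > 0 it rises from 0 to 1 on the interval from e to 2 e, and its derivative is
  \<open>kcut e\<close>, the x-factor of the mollified test functions.\<close>

definition ecut :: "real \<Rightarrow> real \<Rightarrow> complex" where
  "ecut e x = complex_of_real (step (x / e - 1))"

lemma smooth_kcut: "smooth (kcut e)"
proof -
  have "smooth (\<lambda>x. bump ((1 / e) * x + (- 1)) * inverse (complex_of_real e))"
    by (intro smooth_mult smooth_bump_affine smooth_const)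
  then show ?thesis by (simp add: kcut_def[abs_def] divide_inverse mult.commute)
qed

lemma smooth_ecut: "smooth (ecut e)"
  using smooth_of_real[OF smooth_affine_real[OF smooth_step, of "1 / e" "- 1"]] by (simp add: ecut_def[abs_def])

lemma dd_of_real:
  fixes f :: "'a::euclidean_space \<Rightarrow> real"
  assumes "smooth f"
  shows "dd h (\<lambda>x. complex_of_real (f x)) x = complex_of_real (dd h f x)"
  by (rule dd_eqI) (rule bounded_linear.has_derivative[OF bounded_linear_of_real smooth_has_derivative[OF assms]])

lemma dd_ecut: "dd 1 (ecut e) x = kcut e x"
proof -
  have "ecut e = (\<lambda>x. complex_of_real (step ((1 / e) * x + (- 1))))" by (simp add: ecut_def[abs_def])
  then have "dd 1 (ecut e) x = complex_of_real (dd 1 (\<lambda>x. step ((1 / e) * x + (- 1))) x)"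
    using dd_of_real[OF smooth_affine_real[OF smooth_step, of "1 / e" "- 1"]] by simp
  also have "dd 1 (\<lambda>x. step ((1 / e) * x + (- 1))) x = dd (1 / e) step ((1 / e) * x + (- 1))"
    using dd_affine[OF bounded_linear_real_mult smooth_step, of 1 "1 / e" "- 1" x] by simp
  also have "\<dots> = (1 / e) * dd 1 step (x / e - 1)"
    using dd_scale_dir[OF smooth_step, of "1 / e" 1 "x / e - 1"] by simp
  finally show ?thesis by (simp add: kcut_def bump_def)
qed

lemma kcut_0:
  assumes "0 < e" "x < e \<or> 2 * e < x"
  shows "kcut e x = 0" "dd 1 (kcut e) x = 0"
proof -
  have *: "kcut e x = 0" if "x < e \<or> 2 * e < x" for x
    using that assms(1) bump_0[of "x / e - 1"] by (auto simp: kcut_def field_simps)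
  then show "kcut e x = 0" using assms(2) .
  have "open ({..<e} \<union> {2 * e<..})" by (intro open_Un open_lessThan open_greaterThan)
  then show "dd 1 (kcut e) x = 0"
    by (rule dd_eq_0_if_const_on_open[of _ _ _ 0]) (use * assms(2) in auto)
qed

lemma ecut_0: "0 < e \<Longrightarrow> x \<le> e \<Longrightarrow> ecut e x = 0"
  by (simp add: ecut_def step_0 field_simps)

lemma dd_cong_open:
  assumes "smooth g" "open S" "x \<in> S" "\<And>y. y \<in> S \<Longrightarrow> f y = g y"
  shows "dd h f x = dd h g x"
proof -
  have "(f has_derivative (\<lambda>h. dd h g x)) (at x)"
    by (rule has_derivative_transform_within_open[OF smooth_has_derivative[OF assms(1)] assms(2,3)])
      (simp add: assms(4))
  then show ?thesis by (rule dd_eqI)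
qed

lemma schr_cong_open:
  assumes g: "smooth g" and S: "open S" "z \<in> S" "\<And>w. w \<in> S \<Longrightarrow> f w = g w"
  shows "schr V f z = schr V g z"
proof -
  have "dd h f w = dd h g w" if "w \<in> S" for h w by (rule dd_cong_open[OF g S(1) that S(3)])
  then have "dd k (dd h f) z = dd k (dd h g) z" for h k
    by (intro dd_cong_open[OF smooth_dd[OF g] S(1,2)])
  then show ?thesis by (simp add: schr_def S(3)[OF S(2)])
qed

lemma smooth_schr: "smooth V \<Longrightarrow> smooth F \<Longrightarrow> smooth (schr V F)"
  unfolding schr_def[abs_def] by (intro smooth_add smooth_diff smooth_mult smooth_dd smooth_fst)

section \<open>Closure properties of test functions and distributions\<close>

lemma test2_supported_in:
  assumes f: "smooth f" and \<phi>: "test2 \<phi>" and 0: "\<And>z. z \<notin> tsupport \<phi> \<Longrightarrow> f z = 0"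
  shows "test2 f"
proof -
  have "{z. f z \<noteq> 0} \<subseteq> tsupport \<phi>" using 0 by auto
  moreover have "closed (tsupport \<phi>)" by (simp add: tsupport_def)
  ultimately have *: "tsupport f \<subseteq> tsupport \<phi>" unfolding tsupport_def[of f] by (rule closure_minimal)
  have "compact (tsupport \<phi>)" using \<phi> by (simp add: test2_def)
  then have "compact (tsupport f)"
    using compact_Int_closed[of "tsupport \<phi>" "tsupport f"] * by (simp add: tsupport_def inf_absorb2)
  then show ?thesis using f by (simp add: test2_def smooth2_iff_smooth)
qed

lemma test2_dd: "test2 \<phi> \<Longrightarrow> test2 (dd h \<phi>)"
  by (rule test2_supported_in[OF smooth_dd[OF test2_smooth] _ dd_zero_outside_tsupport])

lemma test2_pdx: "test2 \<phi> \<Longrightarrow> test2 (pdx \<phi>)"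
  using test2_dd[of \<phi> "(1, 0)"] by (simp add: pdx_smooth test2_smooth)

lemma test2_linear:
  assumes "test2 \<phi>" "test2 \<psi>"
  shows "test2 (\<lambda>z. a * \<phi> z + b * \<psi> z)"
proof -
  obtain R where R: "R > 0" "\<And>x t. \<phi> (x, t) \<noteq> 0 \<Longrightarrow> \<bar>x\<bar> < R \<and> \<bar>t\<bar> < R" by (rule test2_box[OF assms(1)], rule that)
  obtain R' where R': "R' > 0" "\<And>x t. \<psi> (x, t) \<noteq> 0 \<Longrightarrow> \<bar>x\<bar> < R' \<and> \<bar>t\<bar> < R'" by (rule test2_box[OF assms(2)], rule that)
  define M where "M = max R R'"
  have s: "smooth (\<lambda>z. a * \<phi> z + b * \<psi> z)"
    using assms by (intro smooth_add smooth_mult smooth_const test2_smooth)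
  show ?thesis
  proof (rule test2I(1)[OF s, of "-M" M "-M" M])
    fix x t assume "a * \<phi> (x, t) + b * \<psi> (x, t) \<noteq> 0"
    then have "\<phi> (x, t) \<noteq> 0 \<or> \<psi> (x, t) \<noteq> 0" by auto
    then show "-M \<le> x \<and> x \<le> M \<and> -M \<le> t \<and> t \<le> M"
      using R(2)[of x t] R'(2)[of x t] by (auto simp: M_def)
  qed
qed

lemma dist2_linear:
  assumes "dist2 u" "test2 \<phi>" "test2 \<psi>"
  shows "u (\<lambda>z. a * \<phi> z + b * \<psi> z) = a * u \<phi> + b * u \<psi>"
  using assms unfolding dist2_def by blast

lemma test2_add: "test2 \<phi> \<Longrightarrow> test2 \<psi> \<Longrightarrow> test2 (\<lambda>z. \<phi> z + \<psi> z)"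
  and test2_diff: "test2 \<phi> \<Longrightarrow> test2 \<psi> \<Longrightarrow> test2 (\<lambda>z. \<phi> z - \<psi> z)"
  using test2_linear[of \<phi> \<psi> 1 1] test2_linear[of \<phi> \<psi> 1 "-1"] by simp_all

lemma dist2_add: "dist2 u \<Longrightarrow> test2 \<phi> \<Longrightarrow> test2 \<psi> \<Longrightarrow> u (\<lambda>z. \<phi> z + \<psi> z) = u \<phi> + u \<psi>"
  and dist2_diff: "dist2 u \<Longrightarrow> test2 \<phi> \<Longrightarrow> test2 \<psi> \<Longrightarrow> u (\<lambda>z. \<phi> z - \<psi> z) = u \<phi> - u \<psi>"
  using dist2_linear[of u \<phi> \<psi> 1 1] dist2_linear[of u \<phi> \<psi> 1 "-1"] by simp_all

lemma test2_moll_molm: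
  assumes a: "test1 a" and e: "0 < e" "e \<le> 1" and sg: "sg \<in> {1, -1}"
  shows "test2 (moll (molm sg) a e)"
proof -
  obtain R where R: "R > 0" "\<And>p q. molm sg (p, q) \<noteq> 0 \<Longrightarrow> \<bar>p\<bar> < R \<and> \<bar>q\<bar> < R" "\<And>s. a s \<noteq> 0 \<Longrightarrow> \<bar>s\<bar> < R"
    by (rule mol_psi_box[OF test2_molm[OF sg] a], rule that)
  show ?thesis by (rule test2_moll(1)[OF e smooth_molm R(2) test1_smooth[OF a] R(3)])
qed

lemma test1_dd:
  assumes "test1 a"
  shows "test1 (dd 1 a)"
proof -
  obtain R where R: "R > 0" "\<And>s. a s \<noteq> 0 \<Longrightarrow> \<bar>s\<bar> < R" by (rule test1_box[OF assms], rule that)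
  show ?thesis
  proof (rule test1I[OF smooth_dd[OF test1_smooth[OF assms]], of _ "-R" R])
    fix t assume t: "dd 1 a t \<noteq> 0"
    show "-R \<le> t \<and> t \<le> R"
    proof (rule ccontr)
      assume "\<not> ?thesis"
      then have "t \<in> - {-R..R}" by auto
      then have "dd 1 a t = 0"
        by (rule dd_eq_0_if_const_on_open[rotated, of _ _ _ 0]) (use R(2) in force)+
      then show False using t by simp
    qed
  qed
qed

text \<open>Let F = a_e(t - x) + b_e(t + x) with averaged a and b, and \<kappa> =
  \<open>kcut e\<close>. The right side is \<kappa>' F + 2 \<kappa> F_x, the commutator of d_x^2
  with the cutoff \<open>ecut e\<close> applied to F. The terms with \<open>dd 1 a\<close> and
  \<open>dd 1 b\<close> raise the coefficient of F_x from 1 to 2.\<close>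

lemma moll_combination:
  assumes a: "test1 a" and b: "test1 b" and e: "0 < e"
  shows "(pdx (moll (molm 1) a e) (x, t) - moll (molm 1) (dd 1 a) e (x, t))
      + (pdx (moll (molm (-1)) b e) (x, t) + moll (molm (-1)) (dd 1 b) e (x, t))
    = dd 1 (kcut e) x * (tmoll e 1 a (t - x) + tmoll e 1 b (t + x))
      + 2 * kcut e x * (tmoll e 1 (dd 1 b) (t + x) - tmoll e 1 (dd 1 a) (t - x))"
proof -
  have m: "moll (molm sg) f e = (\<lambda>z. kcut e (fst z) * tmoll e 1 f (snd z - sg * fst z))" if f: "test1 f" for f sg
  proof -
    obtain R where R: "R > 0" "\<And>s. f s \<noteq> 0 \<Longrightarrow> \<bar>s\<bar> < R" by (rule test1_box[OF f], rule that)
    show ?thesis using moll_molm[OF test1_smooth[OF f] R(2) e, of sg] by (auto simp: fun_eq_iff)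
  qed
  have p: "pdx (moll (molm sg) f e) (x, t) = dd 1 (kcut e) x * tmoll e 1 f (t - sg * x) - sg * kcut e x * tmoll e 1 (dd 1 f) (t - sg * x)"
    if f: "test1 f" for f sg
  proof -
    have l: "bounded_linear (\<lambda>z::real \<times> real. snd z - sg * fst z)"
      by (rule bounded_linearI_euclidean) (simp_all add: algebra_simps)
    note sf = smooth_tmoll[OF test1_smooth[OF f], of e 1]
    have sk: "smooth (\<lambda>z::real \<times> real. kcut e (fst z))" by (rule smooth_fst[OF smooth_kcut])
    note s = sk smooth_compose_linear[OF l sf]
    have "pdx (moll (molm sg) f e) (x, t) = dd (1, 0) (\<lambda>z. kcut e (fst z) * tmoll e 1 f (snd z - sg * fst z)) (x, t)"
      unfolding m[OF f] by (simp add: pdx_smooth[OF smooth_mult[OF s]])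
    also have "\<dots> = kcut e x * dd (- sg) (tmoll e 1 f) (t - sg * x) + dd 1 (kcut e) x * tmoll e 1 f (t - sg * x)"
      by (simp add: dd_mult[OF s] dd_fst smooth_kcut dd_compose_linear[OF l sf])
    also have "dd (- sg) (tmoll e 1 f) (t - sg * x) = - sg * tmoll e 1 (dd 1 f) (t - sg * x)"
      using dd_scale_dir[OF sf, of "- sg" 1 "t - sg * x"] dd_tmoll[OF test1_smooth[OF f], of 1 e 1] by (simp add: scaleR_conv_of_real)
    finally show ?thesis by (simp add: algebra_simps)
  qed
  show ?thesis
    by (simp add: p[OF a] p[OF b] m[OF test1_dd[OF a]] m[OF test1_dd[OF b]] algebra_simps)
qed

section \<open>Uniqueness for the forward problem by duality\<close>

text \<open>With t' = t + x + \<tau> the integral in Z is that of \<psi>(t') u0(x, t' - t), where u0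
  is the fundamental solution without its factor 1 / sqrt A. So this is the backward solution that
  vanishes for large t + x and has Neumann datum \<psi>; the sign turns -\<delta> into
  \<delta>.\<close>

definition dualY :: "real \<Rightarrow> (real \<Rightarrow> complex) \<Rightarrow> (real \<times> real \<Rightarrow> complex) \<Rightarrow> real \<times> real \<Rightarrow> complex" where
  "dualY L \<psi> y z = - Zfun L \<psi> y (fst z + snd z, fst z)"

lemma dualY_linear: "bounded_linear (\<lambda>z::real \<times> real. (fst z + snd z, fst z))"
  by (rule bounded_linearI_euclidean) (simp_all add: algebra_simps)

lemma smooth_dualY: "smooth \<psi> \<Longrightarrow> smooth y \<Longrightarrow> smooth (dualY L \<psi> y)"
  unfolding dualY_def[abs_def] by (intro smooth_minus smooth_compose_linear[OF dualY_linear] smooth_Zfun)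

lemma dd_uminus: "smooth f \<Longrightarrow> dd h (\<lambda>x. - f x) x = - dd h f x"
  by (rule dd_eqI) (rule has_derivative_minus[OF smooth_has_derivative])

text \<open>In the coordinates (s, x) the second derivatives in s cancel, and d_t^2 - d_x^2 becomes
  - 2 d_s d_x - d_x^2.\<close>

lemma dualY_equation:
  assumes y: "goursat V y" and \<psi>: "smooth \<psi>" and L: "0 \<le> L" and s: "\<psi> (x + t + L) = 0"
  shows "schr V (dualY L \<psi> y) (x, t) = 0"
proof -
  let ?l = "\<lambda>z::real \<times> real. (fst z + snd z, fst z)" and ?Z = "Zfun L \<psi> y"
  have Z: "smooth ?Z" by (rule smooth_Zfun[OF \<psi> goursat_smooth[OF y]])
  have d: "dd (1, 0) (\<lambda>z. f (?l z)) z = dd (1, 0) f (?l z) + dd (0, 1) f (?l z)"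
    "dd (0, 1) (\<lambda>z. f (?l z)) z = dd (1, 0) f (?l z)" if "smooth f" for f :: "real \<times> real \<Rightarrow> complex" and z
    using dd_compose_linear[OF dualY_linear that, of "(1, 0)" z] dd_compose_linear[OF dualY_linear that, of "(0, 1)" z]
      dd_Pair[OF that, of 1 1 "?l z"] by simp_all
  have sl: "smooth (\<lambda>z. f (?l z))" if "smooth f" for f :: "real \<times> real \<Rightarrow> complex"
    by (rule smooth_compose_linear[OF dualY_linear that])
  have 1: "dd (1, 0) (dualY L \<psi> y) = (\<lambda>z. - dd (1, 0) ?Z (?l z) - dd (0, 1) ?Z (?l z))"
    and 2: "dd (0, 1) (dualY L \<psi> y) = (\<lambda>z. - dd (1, 0) ?Z (?l z))"
    unfolding dualY_def[abs_def] by (auto simp: dd_uminus sl Z d)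
  have E1: "dd (1, 0) (dd (1, 0) (dualY L \<psi> y)) (x, t) = - (dd (1, 0) (dd (1, 0) ?Z) (x + t, x) + dd (0, 1) (dd (1, 0) ?Z) (x + t, x)
      + (dd (1, 0) (dd (0, 1) ?Z) (x + t, x) + dd (0, 1) (dd (0, 1) ?Z) (x + t, x)))"
    unfolding 1 by (simp add: dd_uminus dd_diff sl smooth_minus smooth_dd Z d)
  have E2: "dd (0, 1) (dd (0, 1) (dualY L \<psi> y)) (x, t) = - dd (1, 0) (dd (1, 0) ?Z) (x + t, x)"
    unfolding 2 by (simp add: dd_uminus sl smooth_dd Z d)
  have "schr V (dualY L \<psi> y) (x, t) = dd (0, 1) (dd (1, 0) ?Z) (x + t, x) + dd (1, 0) (dd (0, 1) ?Z) (x + t, x)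
      + dd (0, 1) (dd (0, 1) ?Z) (x + t, x) - V x * ?Z (x + t, x)"
    unfolding schr_def E1 E2 by (simp add: dualY_def)
  also have "\<dots> = 0"
    unfolding Zfun_equation(2)[OF y \<psi> L s, of x, symmetric] Zfun_equation(1)[OF y \<psi> L s, of x] by simp
  finally show ?thesis .
qed

definition tcut :: "real \<Rightarrow> real \<Rightarrow> complex" where
  "tcut T t = complex_of_real (step (t - T))"

lemma smooth_tcut: "smooth (tcut T)"
  using smooth_of_real[OF smooth_affine_real[OF smooth_step, of 1 "- T"]] by (simp add: tcut_def[abs_def])

lemma tcut_0: "t \<le> T \<Longrightarrow> tcut T t = 0" and tcut_1: "T + 1 \<le> t \<Longrightarrow> tcut T t = 1"
  by (simp_all add: tcut_def step_0 step_1)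

text \<open>The cut-off dual solution solves the equation up to \<open>t \<le> T - 1\<close>, where \<open>u\<close> vanishes, and up to the
  terms with derivatives of \<open>ecut e\<close>, which are exactly mollifications of its Cauchy data.\<close>
lemma dual_pairing:
  assumes A: "admissible A" and u: "dist2 u" "wave_A_zero A u" "vanishes_on u ({0<..} \<times> {..<t0})" and T: "T \<le> t0"
    and Y: "smooth Y" and Y0: "\<And>x t. B \<le> x + t \<Longrightarrow> Y (x, t) = 0"
    and eq: "\<And>x t. 0 \<le> x \<Longrightarrow> T - 2 \<le> t \<Longrightarrow> schr (epot A) Y (x, t) = 0"
    and a: "test1 a" and b: "test1 b" and xm: "0 < xm" "xm \<le> 1" "\<And>x. x < xm \<Longrightarrow> A x = 1" "\<And>x. 0 \<le> x \<Longrightarrow> epot A x = pot A x"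
    and dA: "\<And>x t. 0 \<le> x \<Longrightarrow> x < xm \<Longrightarrow> T - 2 \<le> t \<Longrightarrow> Y (x, t) = a (t - x) + b (t + x)"
    and e: "0 < e" "e \<le> 1" "2 * e < xm"
  shows "(u (pdx (moll (molm 1) a e)) - u (moll (molm 1) (dd 1 a) e))
      + (u (pdx (moll (molm (-1)) b e)) + u (moll (molm (-1)) (dd 1 b) e)) = 0"
proof -
  \<comment> \<open>The test functions of the traces contain a and b averaged at scale e; averaging
    Y in time in the same way makes the match exact.\<close>
  define Ye where "Ye = tmoll e (0, 1) Y"
  have sYe: "smooth Ye" unfolding Ye_def by (rule smooth_tmoll[OF Y])
  have Ye0: "Ye (x, t) = 0" if "B + 1 \<le> x + t" for x t
  proof -
    have "Ye (x, t) = tmoll e (0::real \<times> real) (\<lambda>z. 0) (0::real \<times> real)"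
      unfolding Ye_def
    proof (rule tmoll_cong)
      fix q :: real assume q: "0 \<le> q" "q \<le> 1"
      have "e * q \<le> 1" using q e mult_mono[of e 1 q 1] by simp
      then show "Y ((x, t) - (e * q) *\<^sub>R (0, 1)) = 0" using Y0[of x "t - e * q"] that by simp
    qed
    then show ?thesis by (simp add: tmoll_def)
  qed
  define \<Phi>1 where "\<Phi>1 z = ecut e (fst z) * Ye z" for z
  \<comment> \<open>\<open>ecut\<close> keeps the support in x > 0 and \<open>tcut\<close> removes
    the past; for large t + x the function vanishes by itself. So \<Phi> is a test function, and in
    x \<ge> 0 from T - 1 on only \<open>ecut\<close> disturbs the equation.\<close>
  define \<Phi> where "\<Phi> z = tcut (T - 2) (snd z) * \<Phi>1 z" for z
  have se: "smooth (\<lambda>z::real \<times> real. ecut e (fst z))" "smooth (\<lambda>z::real \<times> real. kcut e (fst z))"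
    by (rule smooth_fst[OF smooth_ecut] smooth_fst[OF smooth_kcut])+
  have s\<Phi>1: "smooth \<Phi>1" unfolding \<Phi>1_def[abs_def] by (intro smooth_mult se sYe)
  have s\<Phi>: "smooth \<Phi>" unfolding \<Phi>_def[abs_def] by (intro smooth_mult smooth_snd smooth_tcut s\<Phi>1)
  have \<Phi>ne: "e \<le> x \<and> x \<le> B + 3 - T \<and> T - 2 \<le> t \<and> t \<le> B + 1" if "\<Phi> (x, t) \<noteq> 0" for x t
  proof -
    have "ecut e x \<noteq> 0" "tcut (T - 2) t \<noteq> 0" "Ye (x, t) \<noteq> 0" using that by (auto simp: \<Phi>_def \<Phi>1_def)
    then have "\<not> x \<le> e" "\<not> t \<le> T - 2" "\<not> B + 1 \<le> x + t"
      using ecut_0[OF e(1), of x] tcut_0[of t "T - 2"] Ye0[of x t] by blast+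
    then show ?thesis using e by auto
  qed
  note t\<Phi> = test2I[OF s\<Phi> \<Phi>ne]
  define \<phi> where "\<phi> z = sqA A (fst z) * \<Phi> z" for z
  have s\<phi>: "smooth \<phi>" unfolding \<phi>_def[abs_def] by (intro smooth_mult smooth_fst smooth_sqA A s\<Phi>)
  have \<phi>ne: "e \<le> x \<and> x \<le> B + 3 - T \<and> T - 2 \<le> t \<and> t \<le> B + 1" if "\<phi> (x, t) \<noteq> 0" for x t
    using \<Phi>ne[of x t] that by (auto simp: \<phi>_def)
  note t\<phi> = test2I[OF s\<phi> \<phi>ne]
  have "tsupport \<phi> \<subseteq> {0<..} \<times> UNIV" using t\<phi>(2) e(1) by fastforce
  with t\<phi>(1) u(2) have "u (\<lambda>z. pdt (pdt \<phi>) z - pdx (\<lambda>w. complex_of_real (A (fst w)) *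
                      pdx (\<lambda>w'. \<phi> w' / complex_of_real (A (fst w'))) w) z) = 0"
    unfolding wave_A_zero_def by blast
  moreover define W where "W z = sqA A (fst z) * schr (pot A) \<Phi> z" for z
  ultimately have uW: "u W = 0"
    using wave_operator_conj[OF A s\<Phi>] unfolding \<phi>_def[abs_def] W_def[abs_def] by simp
  have W0: "W z = 0" if z: "z \<notin> tsupport \<Phi>" for z
  proof -
    have "dd h (dd k \<Phi>) z = 0" for h k
      by (rule dd_outside_tsupport[OF dd_zero_outside_tsupport z])
    then show ?thesis using zero_outside_tsupport[OF z] by (simp add: W_def schr_def)
  qed
  have sW: "smooth W"
    unfolding W_def[abs_def] by (intro smooth_mult smooth_fst smooth_sqA smooth_schr smooth_pot A s\<Phi>)
  have tW: "test2 W" by (rule test2_supported_in[OF sW t\<Phi>(1) W0])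
  let ?m1 = "moll (molm 1) a e" and ?m2 = "moll (molm 1) (dd 1 a) e"
    and ?m3 = "moll (molm (-1)) b e" and ?m4 = "moll (molm (-1)) (dd 1 b) e"
  have tm: "test2 (pdx ?m1)" "test2 ?m2" "test2 (pdx ?m3)" "test2 ?m4"
    by (intro test2_pdx test2_moll_molm[OF _ e(1,2)] test1_dd a b; simp)+
  define M where "M z = (pdx ?m1 z - ?m2 z) + (pdx ?m3 z + ?m4 z)" for z
  have tM: "test2 M" unfolding M_def[abs_def] by (intro test2_add test2_diff tm)
  have uM: "u M = (u (pdx ?m1) - u ?m2) + (u (pdx ?m3) + u ?m4)"
    unfolding M_def[abs_def]
    by (simp add: dist2_add[OF u(1)] dist2_diff[OF u(1)] test2_add test2_diff tm)
  have M: "M (x, t) = dd 1 (kcut e) x * (tmoll e 1 a (t - x) + tmoll e 1 b (t + x))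
      + 2 * kcut e x * (tmoll e 1 (dd 1 b) (t + x) - tmoll e 1 (dd 1 a) (t - x))" for x t
    unfolding M_def by (rule moll_combination[OF a b e(1)])
  \<comment> \<open>The margins fit: \<open>tcut (T - 2)\<close> is 1 from T - 1 on, and averaging
    looks back by at most e \<le> 1, hence to times after T - 2, where \<open>eq\<close> and
    \<open>dA\<close> hold.\<close>
  have E0: "W (x, t) + M (x, t) = 0" if x: "e \<le> x" and t: "T - 1 < t" for x t
  proof -
    have eqe: "e * q \<le> 1" if "0 \<le> q" "q \<le> 1" for q using that e mult_mono[of e 1 q 1] by simp
    have op: "open {z::real \<times> real. T - 1 < snd z}" by (intro open_Collect_less continuous_intros)
    have "schr (pot A) \<Phi> (x, t) = schr (pot A) \<Phi>1 (x, t)"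
      by (rule schr_cong_open[OF s\<Phi>1 op]) (use t in \<open>auto simp: \<Phi>_def tcut_1\<close>)
    also have "\<dots> = ecut e x * schr (pot A) Ye (x, t) - (2 * kcut e x * dd (1, 0) Ye (x, t) + dd 1 (kcut e) x * Ye (x, t))"
    proof -
      have "dd (1, 0) \<Phi>1 = (\<lambda>z. ecut e (fst z) * dd (1, 0) Ye z + kcut e (fst z) * Ye z)"
        "dd (0, 1) \<Phi>1 = (\<lambda>z. ecut e (fst z) * dd (0, 1) Ye z)"
        unfolding \<Phi>1_def[abs_def] using dd_zero_dir[OF smooth_ecut]
        by (auto simp: dd_mult se sYe dd_fst smooth_ecut dd_ecut)
      moreover note sd = smooth_dd[OF sYe]
      ultimately show ?thesis
        unfolding schr_def using dd_zero_dir[OF smooth_ecut]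
        by (simp add: dd_add dd_mult se sYe sd smooth_mult dd_fst smooth_ecut smooth_kcut dd_ecut)
          (simp add: \<Phi>1_def algebra_simps)
    qed
    also have "schr (pot A) Ye (x, t) = 0"
      unfolding Ye_def
    proof (rule schr_tmoll[OF Y])
      fix q :: real assume q: "0 \<le> q" "q \<le> 1"
      have "schr (epot A) Y (x, t - e * q) = 0" using eq[of x "t - e * q"] eqe[OF q] x e(1) t by simp
      then show "schr (pot A) Y (x, t - e * q) = 0" using xm(4)[of x] x e(1) by (simp add: schr_def)
    qed
    finally have S: "schr (pot A) \<Phi> (x, t) = ecut e x * 0
        - (2 * kcut e x * dd (1, 0) Ye (x, t) + dd 1 (kcut e) x * Ye (x, t))" .
    have W: "W (x, t) = - (sqA A x * (2 * kcut e x * dd (1, 0) Ye (x, t) + dd 1 (kcut e) x * Ye (x, t)))"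
      unfolding W_def fst_conv S by (simp only: mult_zero_right diff_0 mult_minus_right)
    \<comment> \<open>From xm > 2 e on the cutoff is constant and both terms vanish; below xm, A = 1
      and d'Alembert's form make W the negative of the commutator M.\<close>
    show ?thesis
    proof (cases "x < xm")
      case False
      then have "kcut e x = 0" "dd 1 (kcut e) x = 0" using kcut_0[OF e(1), of x] e(3) by auto
      then show ?thesis by (simp add: W M)
    next
      case True
      have ls: "bounded_linear (\<lambda>z::real \<times> real. snd z - fst z)" "bounded_linear (\<lambda>z::real \<times> real. snd z + fst z)"
        by (rule bounded_linearI_euclidean; simp add: algebra_simps)+
      note sa = test1_smooth[OF a] and sb = test1_smooth[OF b]
      let ?ta = "tmoll e 1 a" and ?tb = "tmoll e 1 b"
      note sta = smooth_tmoll[OF sa, of e 1] and stb = smooth_tmoll[OF sb, of e 1]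
      let ?Yt = "\<lambda>z::real \<times> real. ?ta (snd z - fst z) + ?tb (snd z + fst z)"
      have sYt: "smooth ?Yt"
        by (intro smooth_add smooth_compose_linear[OF ls(1) sta] smooth_compose_linear[OF ls(2) stb])
      let ?O = "{z::real \<times> real. 0 < fst z \<and> fst z < xm \<and> T - 1 < snd z}"
      have op: "open ?O" by (intro open_Collect_conj open_Collect_less continuous_intros)
      have YO: "Ye z = ?Yt z" if "z \<in> ?O" for z
      proof -
        let ?F = "\<lambda>z::real \<times> real. a (snd z - fst z)" and ?G = "\<lambda>z::real \<times> real. b (snd z + fst z)"
        have sFG: "smooth ?F" "smooth ?G"
          by (rule smooth_compose_linear[OF ls(1) sa] smooth_compose_linear[OF ls(2) sb])+
        have "Ye z = tmoll e (0, 1) (\<lambda>z. ?F z + ?G z) z"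
          unfolding Ye_def
        proof (rule tmoll_cong)
          fix q :: real assume q: "0 \<le> q" "q \<le> 1"
          show "Y (z - (e * q) *\<^sub>R (0, 1)) = ?F (z - (e * q) *\<^sub>R (0, 1)) + ?G (z - (e * q) *\<^sub>R (0, 1))"
            using dA[of "fst z" "snd z - e * q"] eqe[OF q] that by (cases z) simp
        qed
        also have "\<dots> = tmoll e (0, 1) ?F z + tmoll e (0, 1) ?G z" by (rule tmoll_add[OF sFG])
        also have "tmoll e (0, 1) ?F z = ?ta (snd z - fst z)" by (rule tmoll_cong) (simp add: algebra_simps)
        also have "tmoll e (0, 1) ?G z = ?tb (snd z + fst z)" by (rule tmoll_cong) (simp add: algebra_simps)
        finally show ?thesis .
      qed
      have zO: "(x, t) \<in> ?O" using True x e(1) t by simp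
      have "dd (1, 0) Ye (x, t) = dd (1, 0) ?Yt (x, t)" by (rule dd_cong_open[OF sYt op zO YO])
      also have "\<dots> = dd (- 1) ?ta (t - x) + dd 1 ?tb (t + x)"
        by (simp add: dd_add smooth_compose_linear[OF ls(1) sta] smooth_compose_linear[OF ls(2) stb]
            dd_compose_linear[OF ls(1) sta] dd_compose_linear[OF ls(2) stb])
      also have "dd (- 1) ?ta (t - x) = - dd 1 ?ta (t - x)" using dd_scale_dir[OF sta, of "-1" 1 "t - x"] by simp
      finally have X1: "dd (1, 0) Ye (x, t) = tmoll e 1 (dd 1 b) (t + x) - tmoll e 1 (dd 1 a) (t - x)"
        by (simp add: dd_tmoll sa sb)
      have X2: "Ye (x, t) = ?ta (t - x) + ?tb (t + x)" using YO[OF zO] by simp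
      have X3: "sqA A x = 1" using xm(3)[OF True] by (simp add: sqA_def)
      show ?thesis unfolding W M X1 X2 X3 by (simp add: algebra_simps)
    qed
  qed
  have E1: "W (x, t) + M (x, t) = 0" if x: "x < e" for x t
  proof -
    have "(x, t) \<notin> tsupport \<Phi>" using t\<Phi>(2) x by auto
    moreover have "M (x, t) = 0" using kcut_0[OF e(1), of x] x by (simp add: M)
    ultimately show ?thesis using W0 by simp
  qed
  have tE: "test2 (\<lambda>z. W z + M z)" by (rule test2_add[OF tW tM])
  \<comment> \<open>What survives lies in x \<ge> e and t \<le> T - 1 < t0, where u
    vanishes.\<close>
  have "tsupport (\<lambda>z. W z + M z) \<subseteq> {e..} \<times> {..T - 1}"
    unfolding tsupport_def
  proof (rule closure_minimal)
    show "{z. W z + M z \<noteq> 0} \<subseteq> {e..} \<times> {..T - 1}"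
    proof
      fix z assume z: "z \<in> {z. W z + M z \<noteq> 0}"
      then have "\<not> fst z < e" using E1[of "fst z" "snd z"] by auto
      moreover from this have "\<not> T - 1 < snd z" using z E0[of "fst z" "snd z"] by auto
      ultimately show "z \<in> {e..} \<times> {..T - 1}" by (cases z) auto
    qed
    show "closed ({e..} \<times> {..T - 1})" by (intro closed_Times closed_atLeast closed_atMost)
  qed
  then have "tsupport (\<lambda>z. W z + M z) \<subseteq> {0<..} \<times> {..<t0}" using e(1) T by fastforce
  then have "u (\<lambda>z. W z + M z) = 0" using u(3) tE unfolding vanishes_on_def by blast
  then have "u M = 0" using dist2_add[OF u(1) tW tM] uW by simp
  then show ?thesis using uM by simp
qed

lemma test1_pairing_diff:
  fixes p :: "real \<Rightarrow> complex"
  assumes p: "continuous_on UNIV p" and f: "test1 f" and g: "test1 g"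
  shows "integral {0..} (\<lambda>t. p t * f t) - integral {0..} (\<lambda>t. p t * g t) = integral {0..} (\<lambda>t. p t * (f t - g t))"
proof -
  obtain R1 where R1: "R1 > 0" "\<And>s. f s \<noteq> 0 \<Longrightarrow> \<bar>s\<bar> < R1" by (rule test1_box[OF f], rule that)
  obtain R2 where R2: "R2 > 0" "\<And>s. g s \<noteq> 0 \<Longrightarrow> \<bar>s\<bar> < R2" by (rule test1_box[OF g], rule that)
  define R where "R = max R1 R2"
  have 0: "f s = 0" "g s = 0" if "s \<in> {0..}" "s \<notin> {0..R}" for s
  proof -
    have "\<not> \<bar>s\<bar> < R1" "\<not> \<bar>s\<bar> < R2" using that by (auto simp: R_def)
    then show "f s = 0" "g s = 0" using R1(2)[of s] R2(2)[of s] by blast+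
  qed
  have r: "integral {0..} (\<lambda>t. p t * h t) = integral {0..R} (\<lambda>t. p t * h t)"
    if "\<And>s. s \<in> {0..} \<Longrightarrow> s \<notin> {0..R} \<Longrightarrow> h s = 0" for h
    by (rule integral_restrict_support) (use that in auto)
  have i: "(\<lambda>t. p t * h t) integrable_on {0..R}" if "test1 h" for h
    by (intro integrable_continuous_interval continuous_intros continuous_on_subset[OF p subset_UNIV]
        smooth_continuous test1_smooth that)
  have "integral {0..} (\<lambda>t. p t * (f t - g t)) = integral {0..R} (\<lambda>t. p t * f t - p t * g t)"
    by (subst r) (auto simp: 0 right_diff_distrib)
  also have "\<dots> = integral {0..R} (\<lambda>t. p t * f t) - integral {0..R} (\<lambda>t. p t * g t)"
    by (rule integral_diff[OF i[OF f] i[OF g]])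
  also have "\<dots> = integral {0..} (\<lambda>t. p t * f t) - integral {0..} (\<lambda>t. p t * g t)"
    using r[of f] r[of g] 0 by simp
  finally show ?thesis by simp
qed

text \<open>Near x = 0 the dual solution is Y = a(t - x) + b(t + x), with b' - a' = \<psi> for t
  \<ge> 0. Letting e tend to 0 in \<open>dual_pairing\<close> gives a(0) + b(0) + g(b' - a') = 0,
  where g is the pairing with p. Thus g(\<psi>) = -Y(0, 0), and by construction -Y(0, 0) is the
  pairing of \<psi> with y(t, t).\<close>

lemma forward_uniqueness:
  assumes A: "admissible A" and y: "goursat (epot A) y" and p: "continuous_on UNIV p"
    and N: "NtD A (\<lambda>\<psi>. - \<psi> 0) (\<lambda>\<psi>. integral {0..} (\<lambda>t. p t * \<psi> t))" and \<psi>: "test1 \<psi>"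
  shows "integral {0..} (\<lambda>t. p t * \<psi> t) = integral {0..} (\<lambda>t. y (t, t) * \<psi> t)"
proof -
  let ?g = "\<lambda>\<psi>. integral {0..} (\<lambda>t. p t * \<psi> t)"
  obtain u t0 where u: "dist2 u" "wave_A_zero A u" "vanishes_on u ({0<..} \<times> {..<t0})"
    and trf: "is_trace (\<lambda>\<phi>. - u (pdx \<phi>)) (\<lambda>\<psi>. - \<psi> 0)" and trg: "is_trace u ?g"
    using N unfolding NtD_def by blast
  define T where "T = min t0 (- 1)"
  have T: "T \<le> t0" "T \<le> -1" by (auto simp: T_def)
  note s\<psi> = test1_smooth[OF \<psi>] and sy = goursat_smooth[OF y]
  obtain B where B: "B > 0" "\<And>s. \<psi> s \<noteq> 0 \<Longrightarrow> \<bar>s\<bar> < B" by (rule test1_box[OF \<psi>], rule that)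
  have \<psi>0: "\<psi> s = 0" if "B \<le> s" for s using B(2)[of s] that by (cases "\<psi> s = 0") auto
  \<comment> \<open>Ensures \<psi>(s + L) = 0 for all s \<ge> T - 20; the 20 is a generous margin
    for the time shifts below.\<close>
  define L where "L = B - T + 20"
  have L: "0 \<le> L" "B \<le> L" using B(1) T by (auto simp: L_def)
  have sL: "\<psi> (s + L) = 0" if "T - 20 \<le> s" for s using that by (intro \<psi>0) (simp add: L_def)
  obtain xm' where xm': "0 < xm'" "\<And>x. x < xm' \<Longrightarrow> A x = 1" "\<And>x. \<bar>x\<bar> < xm' \<Longrightarrow> epot A x = 0"
      "\<And>x. 0 \<le> x \<Longrightarrow> epot A x = pot A x"
    by (rule epot_near_0[OF A], rule that)
  define xm where "xm = min xm' 1"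
  have xm: "0 < xm" "xm \<le> 1" "\<And>x. x < xm \<Longrightarrow> A x = 1" "\<And>x. \<bar>x\<bar> < xm \<Longrightarrow> epot A x = 0"
    using xm' by (auto simp: xm_def)
  let ?Z = "Zfun L \<psi> y"
  have Z: "smooth ?Z" by (rule smooth_Zfun[OF s\<psi> sy])
  have Z0: "?Z (s, x) = 0" if "B \<le> s" for s x
  proof -
    have "?Z (s, x) = integral {0..L} (\<lambda>\<tau>. 0)"
      unfolding Zfun_def PI_def by (rule integral_cong) (use that in \<open>simp add: \<psi>0\<close>)
    then show ?thesis by simp
  qed
  define c where "c s = 2 * dd (1, 0) ?Z (s, 0) + dd (0, 1) ?Z (s, 0)" for s
  have sc: "smooth c"
    unfolding c_def[abs_def] by (intro smooth_add smooth_mult smooth_const smooth_slice_left smooth_dd Z)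
  have c0: "c s = 0" if "B < s" for s
  proof -
    have "dd h ?Z (s, 0) = 0" for h
    proof (rule dd_eq_0_if_const_on_open[of "{z. B < fst z}" _ _ 0])
      show "open {z::real \<times> real. B < fst z}" by (intro open_Collect_less continuous_intros)
      fix w :: "real \<times> real" assume "w \<in> {z. B < fst z}"
      then show "?Z w = 0" using Z0[of "fst w" "snd w"] by simp
    qed (use that in simp)
    then show ?thesis by (simp add: c_def)
  qed
  \<comment> \<open>The primitive of c that vanishes at B + 1, hence at all later times.
    d'Alembert's formula involves only its differences, so the constant is free; this choice leaves
    a0 and b0 without a tail at late times.\<close>
  define C where "C s = oi c s - oi c (B + 1)" for s
  have sC: "smooth C" unfolding C_def[abs_def] by (intro smooth_diff smooth_oi sc smooth_const)
  have dC: "dd 1 C s = c s" for s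
  proof -
    have "(C has_vector_derivative c s) (at s)"
      unfolding C_def[abs_def]
      using has_vector_derivative_diff[OF oi_has_vector_derivative[OF smooth_continuous[OF sc], of s UNIV]
          has_vector_derivative_const[of "oi c (B + 1)"]] by simp
    then show ?thesis using vector_derivative_unique_at[OF smooth_has_vector_derivative[OF sC]] by blast
  qed
  have C0: "C s = 0" if s: "B + 1 \<le> s" for s
  proof -
    have "(C has_vector_derivative 0) (at r within {B + 1..s})" if "r \<in> {B + 1..s}" for r
      using smooth_has_vector_derivative[OF sC, of r] c0[of r] that by (simp add: dC)
    then obtain d where d: "\<And>r. r \<in> {B + 1..s} \<Longrightarrow> C r = d"
      using has_vector_derivative_zero_constant[of "{B + 1..s}" C] by auto
    have "C s = C (B + 1)" using d[of s] d[of "B + 1"] s by simp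
    then show ?thesis by (simp add: C_def)
  qed
  define a0 where "a0 s = C s / 2 - ?Z (s, 0)" for s
  define b0 where "b0 s = - (C s / 2)" for s
  have sZ0: "smooth (\<lambda>s. ?Z (s, 0))" by (rule smooth_slice_left[OF Z])
  have sC2: "smooth (\<lambda>s. C s / 2)" by (rule smooth_linear_image[OF bounded_linear_divide sC])
  have s0: "smooth a0" "smooth b0"
    unfolding a0_def[abs_def] b0_def[abs_def] by (intro smooth_diff smooth_minus sC2 sZ0)+
  have dC2: "dd 1 (\<lambda>s. C s / 2) s = c s / 2" for s
    using dd_eqI[OF bounded_linear.has_derivative[OF bounded_linear_divide smooth_has_derivative[OF sC]]] by (simp add: dC)
  have dab: "dd 1 b0 s - dd 1 a0 s = \<psi> s" if s: "0 \<le> s" for s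
  proof -
    have "dd 1 (\<lambda>s. ?Z (s, 0)) s = dd (1, 0) ?Z (s, 0)" by (rule dd_slice_left[OF Z])
    then have "dd 1 b0 s - dd 1 a0 s = dd (1, 0) ?Z (s, 0) - c s"
      unfolding a0_def[abs_def] b0_def[abs_def] by (simp add: dd_diff dd_uminus sC2 sZ0 dC2)
    also have "\<dots> = \<psi> s"
      using Zfun_axis[OF y s\<psi> L(1) sL, of s] s T by (simp add: c_def)
    finally show ?thesis .
  qed
  \<comment> \<open>Cut off in the past to obtain test functions. Nothing changes from T - 4 on, and
    for t \<ge> T - 2 and 0 \<le> x < xm \<le> 1 both t - x and t + x exceed T - 4.\<close>
  define a where "a s = tcut (T - 5) s * a0 s" for s
  define b where "b s = tcut (T - 5) s * b0 s" for s
  have sab: "smooth a" "smooth b" unfolding a_def[abs_def] b_def[abs_def] by (intro smooth_mult smooth_tcut s0)+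
  have a_eq: "a s = a0 s" "b s = b0 s" if "T - 4 \<le> s" for s using that by (simp_all add: a_def b_def tcut_1)
  have ta: "test1 a" and tb: "test1 b"
  proof -
    have *: "T - 5 \<le> s \<and> s \<le> B + 1" if "a s \<noteq> 0 \<or> b s \<noteq> 0" for s
    proof (rule ccontr)
      assume "\<not> ?thesis"
      then consider "s \<le> T - 5" | "B + 1 \<le> s" by linarith
      then have "a s = 0 \<and> b s = 0"
        by cases (auto simp: a_def b_def tcut_0 a0_def b0_def C0 Z0)
      then show False using that by simp
    qed
    show "test1 a" by (rule test1I[OF sab(1), of "T - 5" "B + 1"]) (use * in blast)
    show "test1 b" by (rule test1I[OF sab(2), of "T - 5" "B + 1"]) (use * in blast)
  qed
  have ddab: "dd 1 b s - dd 1 a s = \<psi> s" if s: "0 \<le> s" for s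
  proof -
    have "dd 1 a s = dd 1 a0 s" "dd 1 b s = dd 1 b0 s"
      by (rule dd_cong_open[of _ "{T - 4<..}"]; use s T s0 a_eq in auto)+
    then show ?thesis using dab[OF s] by simp
  qed
  have Y0: "dualY L \<psi> y (x, t) = 0" if "B \<le> x + t" for x t
    using Z0[OF that, of x] by (simp add: dualY_def)
  have eq: "schr (epot A) (dualY L \<psi> y) (x, t) = 0" if "0 \<le> x" "T - 2 \<le> t" for x t
    by (rule dualY_equation[OF y s\<psi> L(1)]) (use sL[of "x + t"] that in simp)
  have dA: "dualY L \<psi> y (x, t) = a (t - x) + b (t + x)" if x: "0 \<le> x" "x < xm" and t: "T - 2 \<le> t" for x t
  proof -
    have \<sigma>: "T - 20 \<le> t - x" using x t xm(2) by simp
    have ZZ: "?Z (x + t, x) = ?Z (t - x, 0) + (oi c (t + x) - oi c (t - x)) / 2"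
      using Zfun_dAlembert[OF y s\<psi> L(1) sL xm(4) x \<sigma>] by (simp add: c_def[abs_def] add.commute)
    have aa: "a (t - x) = a0 (t - x)" "b (t + x) = b0 (t + x)"
      using a_eq[of "t - x"] a_eq[of "t + x"] x t xm(2) by auto
    show ?thesis
      unfolding dualY_def fst_conv snd_conv ZZ aa a0_def b0_def C_def by (simp add: diff_divide_distrib)
  qed
  let ?P = "\<lambda>sg f e. u (pdx (moll (molm sg) f e))" and ?Q = "\<lambda>sg f e. u (moll (molm sg) f e)"
  have z: "(?P 1 a e - ?Q 1 (dd 1 a) e) + (?P (-1) b e + ?Q (-1) (dd 1 b) e) = 0"
    if e: "0 < e" "e \<le> 1" "2 * e < xm" for e
    by (rule dual_pairing[OF A u T(1) smooth_dualY[OF s\<psi> sy] Y0 eq ta tb xm(1,2,3) xm'(4) dA e])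
  have lp: "((\<lambda>e. ?P sg f e) \<longlongrightarrow> f 0) (at_right 0)" if sg: "sg \<in> {1, -1}" and f: "test1 f" for sg f
  proof -
    have "((\<lambda>e. - ?P sg f e) \<longlongrightarrow> - f 0) (at_right 0)"
      using trf test2_molm[OF sg] integral_molm[OF sg] f unfolding is_trace_def by blast
    then show ?thesis by (simp add: tendsto_minus_cancel_left[symmetric])
  qed
  have lq: "((\<lambda>e. ?Q sg f e) \<longlongrightarrow> ?g f) (at_right 0)" if sg: "sg \<in> {1, -1}" and f: "test1 f" for sg f
    using trg test2_molm[OF sg] integral_molm[OF sg] f unfolding is_trace_def by blast
  have "((\<lambda>e. (?P 1 a e - ?Q 1 (dd 1 a) e) + (?P (-1) b e + ?Q (-1) (dd 1 b) e)) \<longlongrightarrow>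
      (a 0 - ?g (dd 1 a)) + (b 0 + ?g (dd 1 b))) (at_right 0)"
    by (intro tendsto_intros lp lq ta tb test1_dd) auto
  moreover have "\<forall>\<^sub>F e in at_right 0. (?P 1 a e - ?Q 1 (dd 1 a) e) + (?P (-1) b e + ?Q (-1) (dd 1 b) e) = 0"
    using z xm(1) xm(2) by (auto simp: eventually_at_right_field intro!: exI[of _ "xm / 2"])
  then have "((\<lambda>e. (?P 1 a e - ?Q 1 (dd 1 a) e) + (?P (-1) b e + ?Q (-1) (dd 1 b) e)) \<longlongrightarrow> 0) (at_right 0)"
    by (rule tendsto_eventually)
  ultimately have "(a 0 - ?g (dd 1 a)) + (b 0 + ?g (dd 1 b)) = 0"
    using tendsto_unique[OF trivial_limit_at_right_real] by blast
  then have "?g (dd 1 b) - ?g (dd 1 a) = - (a 0 + b 0)" by (simp add: algebra_simps)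
  moreover have "?g (dd 1 b) - ?g (dd 1 a) = integral {0..} (\<lambda>t. p t * (dd 1 b t - dd 1 a t))"
    by (rule test1_pairing_diff[OF p test1_dd[OF tb] test1_dd[OF ta]])
  moreover have "integral {0..} (\<lambda>t. p t * (dd 1 b t - dd 1 a t)) = ?g \<psi>"
    by (rule integral_cong) (simp add: ddab)
  moreover have "- (a 0 + b 0) = ?Z (0, 0)" using a_eq[of 0] T by (simp add: a0_def b0_def)
  moreover have "?Z (0, 0) = integral {0..L} (\<lambda>t. y (t, t) * \<psi> t)"
    by (simp add: Zfun_def PI_def yhat_def mult.commute)
  moreover have "integral {0..} (\<lambda>t. y (t, t) * \<psi> t) = integral {0..L} (\<lambda>t. y (t, t) * \<psi> t)"
    by (rule integral_restrict_support) (use L \<psi>0 in auto)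
  ultimately show ?thesis by simp
qed

text \<open>Tested with \<beta> times the conjugate of p1 - p2, where \<beta> \<ge> 0 is supported
  in [0, 2 t] and positive at t, the difference of the two sides is the integral of \<beta> |p1 -
  p2|^2.\<close>

lemma pairing_determines:
  fixes p1 p2 :: "real \<Rightarrow> complex"
  assumes p: "smooth p1" "smooth p2"
    and eq: "\<And>\<psi>. test1 \<psi> \<Longrightarrow> integral {0..} (\<lambda>t. p1 t * \<psi> t) = integral {0..} (\<lambda>t. p2 t * \<psi> t)"
    and t: "0 < t"
  shows "p1 t = p2 t"
proof -
  define d where "d s = p1 s - p2 s" for s
  have sd: "smooth d" unfolding d_def[abs_def] by (intro smooth_diff p)
  define \<beta> where "\<beta> s = flat 1 s * flat 1 (2 * t - s)" for s
  have s\<beta>: "smooth \<beta>"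
    unfolding \<beta>_def[abs_def] using smooth_affine_real[OF smooth_flat, of 1 "- 1" "2 * t"]
    by (intro smooth_mult smooth_flat) simp
  have \<beta>0: "\<beta> s = 0" if "s \<notin> {0..2 * t}" for s using that by (auto simp: \<beta>_def flat_1_zero)
  define \<psi> where "\<psi> s = complex_of_real (\<beta> s) * cnj (d s)" for s
  have t\<psi>: "test1 \<psi>"
  proof (rule test1I[of _ 0 "2 * t"])
    show "smooth \<psi>"
      unfolding \<psi>_def[abs_def] by (intro smooth_mult smooth_of_real s\<beta> smooth_linear_image[OF bounded_linear_cnj sd])
    show "0 \<le> s \<and> s \<le> 2 * t" if "\<psi> s \<noteq> 0" for s
      using \<beta>0[of s] that by (auto simp: \<psi>_def)
  qed
  have r: "integral {0..} (\<lambda>t. q t * \<psi> t) = integral {0..2 * t} (\<lambda>t. q t * \<psi> t)" for q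
    by (rule integral_restrict_support) (use \<beta>0 in \<open>auto simp: \<psi>_def\<close>)
  have i: "(\<lambda>t. q t * \<psi> t) integrable_on {0..2 * t}" if "smooth q" for q
    by (intro integrable_continuous_interval continuous_intros smooth_continuous that test1_smooth t\<psi>)
  let ?f = "\<lambda>s. \<beta> s * (norm (d s))\<^sup>2"
  have cf: "continuous_on {0..2 * t} ?f"
    by (intro continuous_intros smooth_continuous s\<beta> sd)
  have "0 = integral {0..2 * t} (\<lambda>s. p1 s * \<psi> s) - integral {0..2 * t} (\<lambda>s. p2 s * \<psi> s)"
    using eq[OF t\<psi>] by (simp add: r)
  also have "\<dots> = integral {0..2 * t} (\<lambda>s. p1 s * \<psi> s - p2 s * \<psi> s)"
    by (rule integral_diff[symmetric, OF i[OF p(1)] i[OF p(2)]])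
  also have "(\<lambda>s. p1 s * \<psi> s - p2 s * \<psi> s) = (\<lambda>s. complex_of_real (?f s))"
  proof
    fix s
    have "p1 s * \<psi> s - p2 s * \<psi> s = complex_of_real (\<beta> s) * (d s * cnj (d s))"
      by (simp add: \<psi>_def d_def algebra_simps)
    then show "p1 s * \<psi> s - p2 s * \<psi> s = complex_of_real (?f s)"
      by (simp add: complex_norm_square[symmetric])
  qed
  also have "integral {0..2 * t} (\<lambda>s. complex_of_real (?f s)) = complex_of_real (integral {0..2 * t} ?f)"
    using integral_linear[OF integrable_continuous_interval[OF cf] bounded_linear_of_real] by (simp add: o_def)
  finally have "integral {0..2 * t} ?f = 0" by simp
  moreover have "?f s \<ge> 0" for s by (simp add: \<beta>_def flat_1_nonneg)
  ultimately have "?f t = 0" using integral_eq_0_iff[of 0 "2 * t" ?f] cf t by simp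
  moreover have "\<beta> t > 0" unfolding \<beta>_def using t by (intro mult_pos_pos flat_1_pos) auto
  ultimately show ?thesis by (simp add: d_def)
qed

section \<open>The trace determines the potential\<close>

text \<open>The time derivative in characteristic coordinates, d_t = d_\<xi> + d_\<eta>.\<close>

definition dtime :: "(real \<times> real \<Rightarrow> complex) \<Rightarrow> real \<times> real \<Rightarrow> complex" where
  "dtime y z = dd (1, 0) y z + dd (0, 1) y z"

lemma smooth_dtime: "smooth y \<Longrightarrow> smooth (dtime y)"
  unfolding dtime_def[abs_def] by (intro smooth_add smooth_dd)

text \<open>The potential depends only on \<eta> - \<xi> = 2 x, so d_t annihilates it and preserves
  the equation.\<close>

lemma goursat_dtime:
  assumes y: "goursat V y" and V: "smooth V"
  shows "dd (1, 0) (dd (0, 1) (dtime y)) (\<xi>, \<eta>) = - (V ((\<eta> - \<xi>) / 2) * dtime y (\<xi>, \<eta>)) / 4"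
proof -
  note s = goursat_smooth[OF y] and s1 = smooth_dd[OF goursat_smooth[OF y]]
  let ?K = "\<lambda>z::real \<times> real. V ((snd z - fst z) / 2)"
  let ?m = "dd (1, 0) (dd (0, 1) y)"
  have l: "bounded_linear (\<lambda>z::real \<times> real. (snd z - fst z) / 2)"
    by (rule bounded_linearI_euclidean) (simp_all add: algebra_simps add_divide_distrib diff_divide_distrib)
  have K: "smooth ?K" by (rule smooth_compose_linear[OF l V])
  have dK: "dd (1, 0) ?K z + dd (0, 1) ?K z = 0" for z
    using dd_scale_dir[OF V, of "- 1" "1 / 2"] by (simp add: dd_compose_linear[OF l V])
  have m: "?m = (\<lambda>z. (- (1 / 4)) * (?K z * y z))"
    using goursat_mixed[OF y] by (auto simp: fun_eq_iff)
  have c: "dd (0, 1) (dd (1, 0) y) = ?m" using dd_commute[OF s] by (auto simp: fun_eq_iff)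
  have "dd (0, 1) (dtime y) = (\<lambda>z. ?m z + dd (0, 1) (dd (0, 1) y) z)"
    unfolding dtime_def[abs_def] c[symmetric] by (auto simp: dd_add s1)
  then have "dd (1, 0) (dd (0, 1) (dtime y)) (\<xi>, \<eta>) = dd (1, 0) ?m (\<xi>, \<eta>) + dd (1, 0) (dd (0, 1) (dd (0, 1) y)) (\<xi>, \<eta>)"
    by (simp add: dd_add smooth_dd s)
  also have "dd (1, 0) (dd (0, 1) (dd (0, 1) y)) (\<xi>, \<eta>) = dd (0, 1) ?m (\<xi>, \<eta>)"
    by (rule dd_commute[OF s1])
  also have "dd (1, 0) ?m (\<xi>, \<eta>) + dd (0, 1) ?m (\<xi>, \<eta>)
      = - (1 / 4) * (?K (\<xi>, \<eta>) * dtime y (\<xi>, \<eta>) + (dd (1, 0) ?K (\<xi>, \<eta>) + dd (0, 1) ?K (\<xi>, \<eta>)) * y (\<xi>, \<eta>))"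
  proof -
    have dm: "dd h ?m z = - (1 / 4) * (?K z * dd h y z + dd h ?K z * y z)" for h z
      unfolding m
      by (simp only: dd_mult[OF smooth_const smooth_mult[OF K s]] dd_mult[OF K s] dd_const mult_zero_left add_0_right)
    show ?thesis unfolding dm by (simp add: dtime_def algebra_simps)
  qed
  finally show ?thesis unfolding dK by simp
qed

lemma dtime_sym:
  assumes y: "goursat V y"
  shows "dtime y (\<xi>, \<eta>) = dtime y (\<eta>, \<xi>)" "dd (1, 0) (dtime y) (\<tau>, \<tau>) = dd (0, 1) (dtime y) (\<tau>, \<tau>)"
proof -
  show 1: "dtime y (\<xi>, \<eta>) = dtime y (\<eta>, \<xi>)" for \<xi> \<eta>
    using goursat_sym_deriv[OF y, of \<xi> \<eta>] goursat_sym_deriv[OF y, of \<eta> \<xi>] by (simp add: dtime_def)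
  have e: "dtime y = (\<lambda>z. dtime y (snd z, fst z))" using 1 by (auto simp: fun_eq_iff)
  have "dd (1, 0) (dtime y) (\<tau>, \<tau>) = dd (1, 0) (\<lambda>z. dtime y (snd z, fst z)) (\<tau>, \<tau>)"
    by (rule arg_cong[OF e])
  also have "\<dots> = dd (0, 1) (dtime y) (\<tau>, \<tau>)"
    using dd_compose_linear[OF bounded_linear_swap smooth_dtime[OF goursat_smooth[OF y]], of "(1, 0)" "(\<tau>, \<tau>)"] by simp
  finally show "dd (1, 0) (dtime y) (\<tau>, \<tau>) = dd (0, 1) (dtime y) (\<tau>, \<tau>)" .
qed

text \<open>At t = 0 the derivative is the limit of its values from the right.\<close>

lemma zero_on_halfline:
  fixes f :: "real \<Rightarrow> complex"
  assumes f: "smooth f" and 0: "\<And>t. 0 \<le> t \<Longrightarrow> f t = 0" and t: "0 \<le> t"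
  shows "dd 1 f t = 0"
proof (rule continuous_eq_const_closure[OF smooth_continuous[OF smooth_dd[OF f]], of "{0<..}"])
  show "dd 1 f x = 0" if "x \<in> {0<..}" for x
    by (rule dd_eq_0_if_const_on_open[of "{0<..}" _ _ 0]) (use that 0 in auto)
  show "t \<in> closure {0<..}" using t by simp
qed

lemma dd_diagonal:
  fixes f :: "real \<times> real \<Rightarrow> complex"
  assumes "smooth f"
  shows "smooth (\<lambda>t. f (t, t))" "dd 1 (\<lambda>t. f (t, t)) t = dd (1, 0) f (t, t) + dd (0, 1) f (t, t)"
proof -
  have l: "bounded_linear (\<lambda>t::real. (t, t))" by (intro bounded_linear_Pair bounded_linear_ident)
  show "smooth (\<lambda>t. f (t, t))" by (rule smooth_compose_linear[OF l assms])
  show "dd 1 (\<lambda>t. f (t, t)) t = dd (1, 0) f (t, t) + dd (0, 1) f (t, t)"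
    using dd_compose_linear[OF l assms, of 1 t] dd_Pair[OF assms, of 1 1 "(t, t)"] by simp
qed

lemma increment_bound:
  fixes f :: "real \<Rightarrow> complex"
  assumes "a \<le> b" "\<And>x. (f has_vector_derivative f' x) (at x)" "\<And>x. (\<phi> has_real_derivative \<phi>' x) (at x)"
    "\<And>x. a \<le> x \<Longrightarrow> x \<le> b \<Longrightarrow> norm (f' x) \<le> \<phi>' x"
  shows "norm (f b - f a) \<le> \<phi> b - \<phi> a"
proof (cases "a < b")
  case True
  show ?thesis
  proof (rule differentiable_bound_general[OF True])
    show "continuous_on {a..b} f"
      using assms(2) has_vector_derivative_continuous by (blast intro: continuous_at_imp_continuous_on)
    show "continuous_on {a..b} \<phi>"
      using assms(3) DERIV_isCont by (blast intro: continuous_at_imp_continuous_on)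
    show "(\<phi> has_vector_derivative \<phi>' x) (at x)" for x
      using assms(3)[of x] by (simp add: has_real_derivative_iff_has_vector_derivative)
  qed (use assms in auto)
next
  case False
  then show ?thesis using assms(1) by simp
qed

lemma power_fact_derivative:
  "((\<lambda>s. - (C * (\<eta> - s) ^ Suc n / fact (Suc n))) has_real_derivative C * (\<eta> - s) ^ n / fact n) (at (s::real))"
proof -
  have "((\<lambda>s. (\<eta> - s) ^ Suc n) has_real_derivative real (Suc n) * (\<eta> - s) ^ n * (- 1)) (at s)"
  proof -
    have "((\<lambda>s. \<eta> - s) has_real_derivative - 1) (at s)" by (auto intro!: derivative_eq_intros)
    from DERIV_power[OF this, of "Suc n"] show ?thesis by simp
  qed
  from DERIV_cmult[OF this, of "- (C / fact (Suc n))"]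
  have "((\<lambda>s. - (C / fact (Suc n)) * (\<eta> - s) ^ Suc n) has_real_derivative
      - (C / fact (Suc n)) * (real (Suc n) * (\<eta> - s) ^ n * (- 1))) (at s)" .
  moreover have "- (C / fact (Suc n)) * (real (Suc n) * (\<eta> - s) ^ n * (- 1)) = C * (\<eta> - s) ^ n / fact n"
    by (simp add: fact_Suc field_simps del: of_nat_Suc)
  moreover have "(\<lambda>s. - (C / fact (Suc n)) * (\<eta> - s) ^ Suc n) = (\<lambda>s. - (C * (\<eta> - s) ^ Suc n / fact (Suc n)))"
    by (simp del: fact_Suc power_Suc)
  ultimately show ?thesis by (simp only:)
qed

text \<open>q = d_t (y1 - y2) and D, which is V1 - V2 in the variable d = 2 x, satisfy q_(\<xi>
  \<eta>) = - (V1 q + D d_t y2) / 4 with q = q_\<eta> = 0 on the diagonal, and D(d) = -4 q_\<eta>(0,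
  d). Integrating from the diagonal bounds q and D by integrals of themselves over smaller \<eta> -
  \<xi>; iteration gains 1 / n!.\<close>

lemma potential_unique:
  assumes y1: "goursat V1 y1" and y2: "goursat V2 y2" and V: "smooth V1" "smooth V2"
    and tr: "\<And>t. 0 \<le> t \<Longrightarrow> y1 (t, t) = y2 (t, t)" and x: "0 \<le> x"
  shows "V1 x = V2 x"
proof -
  note s1 = goursat_smooth[OF y1] and s2 = goursat_smooth[OF y2]
  define q where "q z = dtime y1 z - dtime y2 z" for z
  define D where "D d = V1 (d / 2) - V2 (d / 2)" for d
  define T where "T = 2 * x"
  have T: "0 \<le> T" using x by (simp add: T_def)
  have sq: "smooth q" unfolding q_def[abs_def] by (intro smooth_diff smooth_dtime s1 s2)
  have dq: "dd h q z = dd h (dtime y1) z - dd h (dtime y2) z" for h z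
    unfolding q_def[abs_def] by (rule dd_diff[OF smooth_dtime[OF s1] smooth_dtime[OF s2]])
  have sd: "smooth (\<lambda>t. y1 (t, t) - y2 (t, t))" by (intro smooth_diff dd_diagonal(1) s1 s2)
  have q0: "q (t, t) = 0" if "0 \<le> t" for t
  proof -
    have "dd 1 (\<lambda>t. y1 (t, t) - y2 (t, t)) t = 0" by (rule zero_on_halfline[OF sd _ that]) (simp add: tr)
    then show ?thesis using dd_diagonal[OF s1] dd_diagonal[OF s2] by (simp add: dd_diff q_def dtime_def)
  qed
  \<comment> \<open>q = 0 along the diagonal makes the sum of the two partial derivatives vanish,
    and the symmetry of q makes them equal.\<close>
  have qt0: "dd (0, 1) q (t, t) = 0" if "0 \<le> t" for t
  proof -
    have "dd 1 (\<lambda>t. q (t, t)) t = 0" by (rule zero_on_halfline[OF dd_diagonal(1)[OF sq] q0 that])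
    then have "dd (1, 0) q (t, t) + dd (0, 1) q (t, t) = 0" using dd_diagonal(2)[OF sq] by simp
    moreover have "dd (1, 0) q (t, t) = dd (0, 1) q (t, t)"
      unfolding dq using dtime_sym(2)[OF y1] dtime_sym(2)[OF y2] by simp
    ultimately show ?thesis by simp
  qed
  have "dd (0, 1) q = (\<lambda>z. dd (0, 1) (dtime y1) z - dd (0, 1) (dtime y2) z)" using dq by auto
  then have q12: "dd (1, 0) (dd (0, 1) q) (\<xi>, \<eta>) = - (V1 ((\<eta> - \<xi>) / 2) * q (\<xi>, \<eta>) + D (\<eta> - \<xi>) * dtime y2 (\<xi>, \<eta>)) / 4" for \<xi> \<eta>
    using goursat_dtime[OF y1 V(1), of \<xi> \<eta>] goursat_dtime[OF y2 V(2), of \<xi> \<eta>]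
    by (simp add: dd_diff smooth_dd smooth_dtime s1 s2) (simp add: q_def D_def field_simps)
  \<comment> \<open>On \<xi> = 0 one has y_\<eta> = 0, so d_t y = y_\<xi>, whose \<eta>-derivative
    is - V / 4 because y = 1 there: the front reads off the potential.\<close>
  have DV: "D d = - 4 * dd (0, 1) q (0, d)" for d
  proof -
    have dt: "dd (0, 1) (dtime y) (0, d) = - V (d / 2) / 4" if y: "goursat V y" for V y
    proof (rule dd_dir_eqI(2)[OF smooth_dtime[OF goursat_smooth[OF y]]])
      note s = goursat_smooth[OF y]
      have "((\<lambda>s. dd (1, 0) y (0, s)) has_vector_derivative dd (0, 1) (dd (1, 0) y) (0, d)) (at d)"
        by (rule has_vector_derivative_slice(2)[OF smooth_dd[OF s]])
      moreover have "dd (0, 1) (dd (1, 0) y) (0, d) = - V (d / 2) / 4"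
        using dd_commute[OF s, of 0 d] goursat_mixed[OF y, of 0 d] goursat_axis[OF y] by simp
      moreover have "(\<lambda>s. dtime y (0, s)) = (\<lambda>s. dd (1, 0) y (0, s))"
        using goursat_axis_deriv(1)[OF y] by (simp add: dtime_def)
      ultimately show "((\<lambda>s. dtime y (0, s)) has_vector_derivative - V (d / 2) / 4) (at d)" by simp
    qed
    show ?thesis unfolding dq dt[OF y1] dt[OF y2] by (simp add: D_def)
  qed
  let ?B = "cbox (0, 0) (T, T)"
  obtain M1 where M1: "M1 \<ge> 0" "\<And>z. z \<in> ?B \<Longrightarrow> norm (V1 ((snd z - fst z) / 2)) \<le> M1"
  proof (rule continuous_bounded_on_box[of "\<lambda>z::real \<times> real. V1 ((snd z - fst z) / 2)" "(0, 0)" "(T, T)"])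
    show "continuous_on UNIV (\<lambda>z::real \<times> real. V1 ((snd z - fst z) / 2))"
      by (intro continuous_on_compose2[OF smooth_continuous[OF V(1), of UNIV]] continuous_intros) auto
  qed (rule that)
  obtain M2 where M2: "M2 \<ge> 0" "\<And>z. z \<in> ?B \<Longrightarrow> norm (dtime y2 z) \<le> M2"
    by (rule continuous_bounded_on_box[OF smooth_continuous[OF smooth_dtime[OF s2]]], rule that)
  obtain K where K: "K \<ge> 0" "\<And>z. z \<in> ?B \<Longrightarrow> norm (q z) \<le> K"
    by (rule continuous_bounded_on_box[OF smooth_continuous[OF sq]], rule that)
  obtain K' where K': "K' \<ge> 0" "\<And>z. z \<in> ?B \<Longrightarrow> norm (dd (0, 1) q z) \<le> K'"
    by (rule continuous_bounded_on_box[OF smooth_continuous[OF smooth_dd[OF sq]]], rule that)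
  \<comment> \<open>One iteration costs M T / 4 for q and M for D; C = M (1 + T) dominates both. N
    dominates q through K, and D through 4 K', at the start of the induction.\<close>
  define M where "M = M1 + M2"
  define C where "C = M * (1 + T)"
  define N where "N = K + 4 * K'"
  have M0: "0 \<le> M" "0 \<le> C" "0 \<le> N" using M1 M2 K K' T by (simp_all add: M_def C_def N_def)
  have "\<forall>\<xi> \<eta>. 0 \<le> \<xi> \<and> \<xi> \<le> \<eta> \<and> \<eta> \<le> T \<longrightarrow> norm (q (\<xi>, \<eta>)) \<le> N * (C * (\<eta> - \<xi>)) ^ n / fact n
      \<and> norm (D (\<eta> - \<xi>)) \<le> N * (C * (\<eta> - \<xi>)) ^ n / fact n" for n
  proof (induction n)
    case 0
    show ?case
    proof (intro allI impI conjI)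
      fix \<xi> \<eta> assume h: "0 \<le> \<xi> \<and> \<xi> \<le> \<eta> \<and> \<eta> \<le> T"
      then have b: "(\<xi>, \<eta>) \<in> ?B" "(0, \<eta> - \<xi>) \<in> ?B" by (auto simp: cbox_Pair_eq)
      show "norm (q (\<xi>, \<eta>)) \<le> N * (C * (\<eta> - \<xi>)) ^ 0 / fact 0"
        using K(2)[OF b(1)] K'(1) by (simp add: N_def)
      have "norm (D (\<eta> - \<xi>)) = 4 * norm (dd (0, 1) q (0, \<eta> - \<xi>))" unfolding DV by (simp add: norm_mult)
      then show "norm (D (\<eta> - \<xi>)) \<le> N * (C * (\<eta> - \<xi>)) ^ 0 / fact 0"
        using K'(2)[OF b(2)] K(1) by (simp add: N_def)
    qed
  next
    case (Suc n)
    \<comment> \<open>Integrate q_(\<xi> \<eta>) in \<xi> up to the diagonal, where q_\<eta> = 0;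
      this raises the power of \<eta> - \<xi> by one and yields the factor 1 / (n + 1).\<close>
    have C0: "norm (dd (0, 1) q (\<xi>, \<eta>)) \<le> M / 4 * (N * C ^ n) * (\<eta> - \<xi>) ^ Suc n / fact (Suc n)"
      if h: "0 \<le> \<xi>" "\<xi> \<le> \<eta>" "\<eta> \<le> T" for \<xi> \<eta>
    proof -
      let ?c = "M / 4 * (N * C ^ n)"
      have "norm (dd (0, 1) q (\<eta>, \<eta>) - dd (0, 1) q (\<xi>, \<eta>)) \<le> - (?c * (\<eta> - \<eta>) ^ Suc n / fact (Suc n)) - - (?c * (\<eta> - \<xi>) ^ Suc n / fact (Suc n))"
      proof (rule increment_bound[OF h(2) has_vector_derivative_slice(1)[OF smooth_dd[OF sq]] power_fact_derivative])
        fix s assume s: "\<xi> \<le> s" "s \<le> \<eta>"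
        have b: "(s, \<eta>) \<in> ?B" using s h by (auto simp: cbox_Pair_eq)
        let ?r = "N * (C * (\<eta> - s)) ^ n / fact n"
        have ih: "norm (q (s, \<eta>)) \<le> ?r" "norm (D (\<eta> - s)) \<le> ?r" using Suc.IH s h by auto
        have r0: "0 \<le> ?r" using order_trans[OF norm_ge_zero ih(1)] .
        have "norm (V1 ((\<eta> - s) / 2)) \<le> M1" using M1(2)[OF b] by simp
        have "norm (V1 ((\<eta> - s) / 2) * q (s, \<eta>) + D (\<eta> - s) * dtime y2 (s, \<eta>)) \<le> M1 * ?r + ?r * M2"
          unfolding norm_mult[symmetric]
          by (rule order_trans[OF norm_triangle_ineq], unfold norm_mult)
            (intro add_mono mult_mono ih M2(2)[OF b] \<open>norm (V1 ((\<eta> - s) / 2)) \<le> M1\<close> M1(1) r0 norm_ge_zero)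
        also have "\<dots> = M * ?r" unfolding M_def by (simp only: distrib_right mult.commute)
        finally have "norm (dd (1, 0) (dd (0, 1) q) (s, \<eta>)) \<le> M * ?r / 4"
          unfolding q12 by (simp only: norm_divide norm_minus_cancel) simp
        also have "\<dots> = ?c * (\<eta> - s) ^ n / fact n" by (simp add: power_mult_distrib)
        finally show "norm (dd (1, 0) (dd (0, 1) q) (s, \<eta>)) \<le> ?c * (\<eta> - s) ^ n / fact n" .
      qed
      then show ?thesis using qt0[of \<eta>] h by simp
    qed
    have grow: "c * (N * C ^ n) * d ^ Suc n / fact (Suc n) \<le> N * (C * d) ^ Suc n / fact (Suc n)"
      if "c \<le> C" "0 \<le> d" for c d
    proof -
      have "c * (N * C ^ n * d ^ Suc n) \<le> C * (N * C ^ n * d ^ Suc n)"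
        using that M0 by (intro mult_right_mono mult_nonneg_nonneg zero_le_power)
      then have "c * (N * C ^ n) * d ^ Suc n \<le> N * (C * d) ^ Suc n"
        by (simp add: power_mult_distrib mult_ac)
      then show ?thesis by (rule divide_right_mono) simp
    qed
    show ?case
    proof (intro allI impI conjI)
      fix \<xi> \<eta> assume "0 \<le> \<xi> \<and> \<xi> \<le> \<eta> \<and> \<eta> \<le> T"
      then have h: "0 \<le> \<xi>" "\<xi> \<le> \<eta>" "\<eta> \<le> T" by auto
      let ?d = "\<eta> - \<xi>"
      let ?b = "M / 4 * (N * C ^ n) * ?d ^ Suc n / fact (Suc n)"
      have b0: "0 \<le> ?b" using order_trans[OF norm_ge_zero C0[OF h]] .
      \<comment> \<open>A second integration from the diagonal; estimating its length by T keeps q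
        at the same rate as D.\<close>
      have "norm (q (\<xi>, \<eta>) - q (\<xi>, \<xi>)) \<le> ?b * \<eta> - ?b * \<xi>"
      proof (rule increment_bound[OF h(2) has_vector_derivative_slice(2)[OF sq], where \<phi>'="\<lambda>_. ?b"])
        show "((\<lambda>s. ?b * s) has_real_derivative ?b) (at s)" for s
          using DERIV_cmult[OF DERIV_ident, of ?b s] by simp
        fix s assume s: "\<xi> \<le> s" "s \<le> \<eta>"
        have "norm (dd (0, 1) q (\<xi>, s)) \<le> M / 4 * (N * C ^ n) * (s - \<xi>) ^ Suc n / fact (Suc n)"
          using C0[of \<xi> s] s h by simp
        also have "\<dots> \<le> ?b"
          using s M0 by (intro divide_right_mono mult_left_mono power_mono) auto
        finally show "norm (dd (0, 1) q (\<xi>, s)) \<le> ?b" .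
      qed
      then have "norm (q (\<xi>, \<eta>)) \<le> ?b * ?d" using q0[OF h(1)] by (simp only: right_diff_distrib) simp
      also have "\<dots> \<le> ?b * T" using h b0 by (intro mult_left_mono) auto
      also have "\<dots> = (M / 4 * T) * (N * C ^ n) * ?d ^ Suc n / fact (Suc n)" by simp
      also have "\<dots> \<le> N * (C * ?d) ^ Suc n / fact (Suc n)"
      proof (rule grow)
        have "M / 4 * T \<le> M * T" using M0 T by (intro mult_right_mono) auto
        also have "\<dots> \<le> C" using M0 by (simp add: C_def algebra_simps)
        finally show "M / 4 * T \<le> C" .
      qed (use h in simp)
      finally show "norm (q (\<xi>, \<eta>)) \<le> N * (C * ?d) ^ Suc n / fact (Suc n)" .
      have "norm (D ?d) = 4 * norm (dd (0, 1) q (0, ?d))" unfolding DV by (simp add: norm_mult)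
      also have "\<dots> \<le> 4 * (M / 4 * (N * C ^ n) * (?d - 0) ^ Suc n / fact (Suc n))"
        by (intro mult_left_mono C0) (use h in auto)
      also have "\<dots> = M * (N * C ^ n) * ?d ^ Suc n / fact (Suc n)" by simp
      also have "\<dots> \<le> N * (C * ?d) ^ Suc n / fact (Suc n)"
        by (rule grow) (use h M0 T in \<open>auto simp: C_def algebra_simps\<close>)
      finally show "norm (D ?d) \<le> N * (C * ?d) ^ Suc n / fact (Suc n)" .
    qed
  qed
  \<comment> \<open>Taken at \<xi> = 0 and \<eta> = T = 2 x, where D(T) = V1 x - V2 x.\<close>
  then have "norm (D T) \<le> N * (C * T) ^ n / fact n" for n
    using T by (metis diff_zero order_refl)
  moreover have "(\<lambda>n. N * (inverse (fact n) * (C * T) ^ n)) \<longlonglongrightarrow> N * 0"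
    by (intro tendsto_mult tendsto_const summable_LIMSEQ_zero[OF summable_exp])
  ultimately have "norm (D T) \<le> 0"
    by (intro LIMSEQ_le_const[of "\<lambda>n. N * (inverse (fact n) * (C * T) ^ n)" 0 "norm (D T)"])
      (auto simp: divide_inverse mult_ac)
  then show ?thesis by (simp add: D_def T_def)
qed

text \<open>Both square roots solve a'' = V a with a(0) = 1 and a'(0) = 0, since A = 1 near 0. Hence
  their Wronskian vanishes, and it is the numerator of the derivative of their quotient.\<close>

lemma coefficient_unique:
  assumes A: "admissible A1" "admissible A2" and pot: "\<And>x. pot A1 x = pot A2 x"
  shows "A1 = A2"
proof -
  let ?a = "sqA A1" and ?b = "sqA A2"
  have s: "smooth ?a" "smooth ?b" by (intro smooth_sqA A)+
  have ne: "?a x \<noteq> 0" "?b x \<noteq> 0" for x by (intro sqA_nonzero A)+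
  have near: "sqA A 0 = 1 \<and> dd 1 (sqA A) 0 = 0" if A: "admissible A" for A
  proof -
    obtain xm where xm: "0 < xm" "\<And>x. x < xm \<Longrightarrow> A x = 1" by (rule epot_near_0[OF A], rule that)
    have "dd 1 (sqA A) 0 = 0"
      by (rule dd_eq_0_if_const_on_open[of "{..<xm}" _ _ 1]) (use xm in \<open>auto simp: sqA_def\<close>)
    then show ?thesis using xm by (simp add: sqA_def)
  qed
  define W where "W x = dd 1 ?a x * ?b x - ?a x * dd 1 ?b x" for x
  have sW: "smooth W" unfolding W_def[abs_def] by (intro smooth_diff smooth_mult smooth_dd s)
  have "dd 1 W x = 0" for x
  proof -
    have "dd 1 (dd 1 ?a) x = pot A1 x * ?a x" "dd 1 (dd 1 ?b) x = pot A2 x * ?b x"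
      using ne[of x] by (simp_all add: pot_def)
    then have "dd 1 (dd 1 ?a) x = pot A1 x * ?a x" "dd 1 (dd 1 ?b) x = pot A1 x * ?b x"
      by (simp_all only: pot)
    then show ?thesis
      unfolding W_def[abs_def] by (simp add: dd_diff dd_mult smooth_mult smooth_dd s algebra_simps)
  qed
  then have "(W has_vector_derivative 0) (at x within UNIV)" for x
    using smooth_has_vector_derivative[OF sW, of x UNIV] by simp
  then obtain c where "\<And>x. W x = c" using has_vector_derivative_zero_constant[of UNIV W] by auto
  moreover have "W 0 = 0" using near[OF A(1)] near[OF A(2)] by (simp add: W_def)
  ultimately have W0: "W x = 0" for x by metis
  let ?r = "\<lambda>x. ?a x * inverse (?b x)"
  have "(?r has_vector_derivative 0) (at x within UNIV)" for x
  proof -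
    have "((\<lambda>x. inverse (?b x)) has_derivative (\<lambda>h. - (inverse (?b x) * dd h ?b x * inverse (?b x)))) (at x)"
      by (rule Deriv.has_derivative_inverse[OF ne(2) smooth_has_derivative[OF s(2)]])
    then have d: "dd 1 (\<lambda>x. inverse (?b x)) x = - (inverse (?b x) * dd 1 ?b x * inverse (?b x))"
      by (rule dd_eqI)
    have sr: "smooth ?r" "smooth (\<lambda>x. inverse (?b x))" by (intro smooth_mult smooth_inverse s ne)+
    have "dd 1 ?r x = W x * (inverse (?b x) * inverse (?b x))"
      unfolding dd_mult[OF s(1) sr(2)] d W_def using ne(2)[of x] by (simp add: field_simps)
    then show ?thesis using smooth_has_vector_derivative[OF sr(1), of x UNIV] W0 by simp
  qed
  then obtain c where c: "\<And>x. ?r x = c" using has_vector_derivative_zero_constant[of UNIV ?r] by auto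
  have "c = 1" using c[of 0] near[OF A(1)] near[OF A(2)] by simp
  then have "?a x = ?b x" for x using c[of x] ne(2)[of x] by (simp add: field_simps)
  then show ?thesis by (simp add: sqA_def fun_eq_iff)
qed

theorem mainTheorem14:
  assumes "admissible A1" and "admissible A2"
    and "\<forall>f. cdist1 f \<longrightarrow> (\<forall>g. NtD A1 f g \<longleftrightarrow> NtD A2 f g)"
  shows "A1 = A2"
proof (rule coefficient_unique[OF assms(1,2)])
  obtain y1 where y1: "goursat (epot A1) y1" by (rule goursat_exists_for[OF assms(1)])
  obtain y2 where y2: "goursat (epot A2) y2" by (rule goursat_exists_for[OF assms(2)])
  let ?p = "\<lambda>t. y1 (t, t)"
  have sp: "smooth ?p" "smooth (\<lambda>t. y2 (t, t))" by (intro dd_diagonal(1) goursat_smooth[OF y1] goursat_smooth[OF y2])+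
  \<comment> \<open>The trace constructed for \<open>A1\<close> is carried over to
    \<open>A2\<close>, where it belongs to an unknown solution; \<open>forward_uniqueness\<close>
    for \<open>A2\<close> compares it with y2(t, t).\<close>
  have N: "NtD A2 (\<lambda>\<psi>. - \<psi> 0) (\<lambda>\<psi>. integral {0..} (\<lambda>t. ?p t * \<psi> t))"
    using NtD_minus_delta[OF assms(1) y1] assms(3) cdist1_minus_delta by blast
  have eq: "y1 (t, t) = y2 (t, t)" if "0 \<le> t" for t
  proof (cases "t = 0")
    case True
    then show ?thesis using goursat_axis[OF y1] goursat_axis[OF y2] by simp
  next
    case False
    with that have "0 < t" by simp
    then show ?thesis
      using pairing_determines[OF sp forward_uniqueness[OF assms(2) y2 smooth_continuous[OF sp(1)] N]] by simp
  qed
  fix x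
  \<comment> \<open>The trace determines \<open>epot\<close>, which is \<open>pot\<close> for x
    \<ge> 0; for x < 0 both potentials vanish by admissibility.\<close>
  show "pot A1 x = pot A2 x"
  proof (cases "0 \<le> x")
    case True
    have "epot A x = pot A x" if "admissible A" for A
    proof -
      obtain xm where "\<And>x. 0 \<le> x \<Longrightarrow> epot A x = pot A x" by (rule epot_near_0[OF \<open>admissible A\<close>], rule that)
      then show ?thesis using True by simp
    qed
    then show ?thesis
      using potential_unique[OF y1 y2 smooth_epot[OF assms(1)] smooth_epot[OF assms(2)] eq True] assms by simp
  next
    case False
    have "pot A x = 0" if A: "admissible A" for A
    proof -
      obtain xm where xm: "0 < xm" "\<And>x. x < xm \<Longrightarrow> pot A x = 0" by (rule pot_support[OF A], rule that)
      then show ?thesis using False by simp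
    qed
    then show ?thesis using assms by simp
  qed
qed

end
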